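(* Let $M^R_t$ be the maximal displacement at time $t$ of the branching reflected Brownian motion started at the origin, and for $0<\delta<1$ let $q^R_\delta(t):=\sup\{x\ge 0:\ \mathbb{P}(M^R_t\le x)\le \delta\}$. Then for every $0<\delta<1$, $$q^R_\delta(t)=\sqrt{2}\,t-\frac{3}{2\sqrt{2}}\log t+\mathcal{O}(1)\qquad\text{as } t\to\infty .$$
   Context: Branching reflected Brownian motion (quadratic, i.e. binary, branching): the system starts with a single particle at the origin, which moves on $[0,\infty)$ as a reflected Brownian motion with zero drift and unit variance (a process with the law of $|B|$, $B$ a standard linear Brownian motion). After an exponential time with parameter $1$ it splits into two particles, which from their common birth place move as independent reflected Brownian motions on $[0,\infty)$ and each branch at rate $1$ into two in the same way, and so on. Equivalently, it can be constructed by taking the absolute values of the positions of all particles of a binary branching Brownian motion (branching rate $1$) started at $0$. $N^R(t)$ is the set of particles alive at time $t$, $X^R_v(t)$ is the position of $v\in N^R(t)$ at time $t$, and $M^R_t:=\max_{v\in N^R(t)}X^R_v(t)$. *)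

theory Defs
  imports "HOL-Probability.Probability" "HOL-Library.Landau_Symbols"
begin

text \<open>
  Brownian motion is required to start at 0 and to have continuous paths for every outcome, not
  just almost surely: the motions below are evaluated at random times, and this keeps
  the resulting events measurable without completeness of the underlying measure.
\<close>

locale standard_brownian_motion = prob_space M for M :: "'w measure" +
  fixes B :: "real \<Rightarrow> 'w \<Rightarrow> real"
  assumes measurable_at: "\<And>t. 0 \<le> t \<Longrightarrow> B t \<in> borel_measurable M"
    and starts_at_0: "\<And>\<omega>. \<omega> \<in> space M \<Longrightarrow> B 0 \<omega> = 0"
    and continuous_paths: "\<And>\<omega>. \<omega> \<in> space M \<Longrightarrow> continuous_on {0..} (\<lambda>t. B t \<omega>)"
    and normal_increments: "\<And>s t. 0 \<le> s \<Longrightarrow> s < t \<Longrightarrow>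
      distributed M lborel (\<lambda>\<omega>. B t \<omega> - B s \<omega>) (normal_density 0 (sqrt (t - s)))"
    and independent_increments: "\<And>r :: nat \<Rightarrow> real. 0 \<le> r 0 \<Longrightarrow> strict_mono r \<Longrightarrow>
      indep_vars (\<lambda>_. borel) (\<lambda>i \<omega>. B (r (Suc i)) \<omega> - B (r i) \<omega>) UNIV"

text \<open>
  Particles are labelled by binary words; the word \<open>[]\<close> is the initial particle and the
  two children of \<open>u\<close> are \<open>False # u\<close> and \<open>True # u\<close> (so a word is read from right to left).
  The particle \<open>u\<close> has lifetime \<open>T u\<close> and is driven by the Brownian motion \<open>B u\<close>, run from
  its birth: if it is born at the place \<open>x\<close>, it moves as the reflected Brownian
  motion \<open>\<bar>x + B u s\<bar>\<close>, where \<open>s\<close> is the time since its birth.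
\<close>

type_synonym particle = "bool list"

definition reflected_path :: "real \<Rightarrow> (real \<Rightarrow> real) \<Rightarrow> real \<Rightarrow> real" where
  "reflected_path x \<beta> s = \<bar>x + \<beta> s\<bar>"

primrec birth_time :: "(particle \<Rightarrow> 'w \<Rightarrow> real) \<Rightarrow> particle \<Rightarrow> 'w \<Rightarrow> real" where
  "birth_time T [] \<omega> = 0"
| "birth_time T (i # u) \<omega> = birth_time T u \<omega> + T u \<omega>"

primrec birth_place ::
  "(particle \<Rightarrow> 'w \<Rightarrow> real) \<Rightarrow> (particle \<Rightarrow> real \<Rightarrow> 'w \<Rightarrow> real) \<Rightarrow> particle \<Rightarrow> 'w \<Rightarrow> real" where
  "birth_place T B [] \<omega> = 0"
| "birth_place T B (i # u) \<omega> =
    reflected_path (birth_place T B u \<omega>) (\<lambda>s. B u s \<omega>) (T u \<omega>)"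

definition alive :: "(particle \<Rightarrow> 'w \<Rightarrow> real) \<Rightarrow> real \<Rightarrow> 'w \<Rightarrow> particle set" where
  "alive T t \<omega> = {u. birth_time T u \<omega> \<le> t \<and> t < birth_time T u \<omega> + T u \<omega>}"

definition position ::
  "(particle \<Rightarrow> 'w \<Rightarrow> real) \<Rightarrow> (particle \<Rightarrow> real \<Rightarrow> 'w \<Rightarrow> real) \<Rightarrow> particle \<Rightarrow> real \<Rightarrow> 'w \<Rightarrow> real" where
  "position T B u t \<omega> =
    reflected_path (birth_place T B u \<omega>) (\<lambda>s. B u s \<omega>) (t - birth_time T u \<omega>)"

text \<open>
  The set of living particles is almost surely finite and nonempty at every time \<open>t \<ge> 0\<close>; on the
  exceptional null set \<open>Max\<close> is an unspecified constant.
\<close>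

definition max_displacement ::
  "(particle \<Rightarrow> 'w \<Rightarrow> real) \<Rightarrow> (particle \<Rightarrow> real \<Rightarrow> 'w \<Rightarrow> real) \<Rightarrow> real \<Rightarrow> 'w \<Rightarrow> real" where
  "max_displacement T B t \<omega> = Max ((\<lambda>u. position T B u t \<omega>) ` alive T t \<omega>)"

definition quantile ::
  "'w measure \<Rightarrow> (particle \<Rightarrow> 'w \<Rightarrow> real) \<Rightarrow> (particle \<Rightarrow> real \<Rightarrow> 'w \<Rightarrow> real) \<Rightarrow> real \<Rightarrow> real \<Rightarrow> real" where
  "quantile M T B \<delta> t =
    Sup {x. 0 \<le> x \<and> measure M {\<omega> \<in> space M. max_displacement T B t \<omega> \<le> x} \<le> \<delta>}"

text \<open>
  The last two assumptions together say that all the lifetimes \<open>T u\<close> and all the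
  processes \<open>B u\<close> (as random elements of the product space over the times \<open>s \<ge> 0\<close>) are
  mutually independent; the first of them uses the generated sigma-algebras because
  \<open>indep_var\<close> wants both variables to have the same codomain type. Lifetimes are positive for every outcome so that no \<open>B u\<close> is
  evaluated at a negative time, where nothing is assumed about it.
\<close>

locale branching_reflected_brownian_motion = prob_space M for M :: "'w measure" +
  fixes T :: "particle \<Rightarrow> 'w \<Rightarrow> real"
    and B :: "particle \<Rightarrow> real \<Rightarrow> 'w \<Rightarrow> real"
  assumes lifetime_pos: "\<And>u \<omega>. \<omega> \<in> space M \<Longrightarrow> 0 < T u \<omega>"
    and lifetime_exponential: "\<And>u. distributed M lborel (T u) (exponential_density 1)"
    and motion_brownian: "\<And>u. standard_brownian_motion M (B u)"
    and lifetime_motion_independent: "\<And>u.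
      indep_set (sets (vimage_algebra (space M) (T u) borel))
        (sets (vimage_algebra (space M) (\<lambda>\<omega>. \<lambda>s\<in>{0..}. B u s \<omega>) (\<Pi>\<^sub>M s\<in>{0..}. borel)))"
    and particles_independent:
      "indep_vars (\<lambda>_. borel \<Otimes>\<^sub>M (\<Pi>\<^sub>M s\<in>{0..}. borel))
        (\<lambda>u \<omega>. (T u \<omega>, \<lambda>s\<in>{0..}. B u s \<omega>)) UNIV"

end

theory Submission
  imports Defs "HOL-Real_Asymp.Real_Asymp"
begin

text \<open>
  By symmetry the maximum of the reflected system exceeds \<open>z\<close> with a probability
  between one and two times the corresponding probability for ordinary branching Brownian motion, so it is
  enough to locate the front of the F-KPP equation
  \<open>u\<^sub>t = u\<^sub>x\<^sub>x / 2 + u - u\<^sup>2\<close> up to a bounded error. Conditioning on the first branching time gives this equation in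
  integrated form, and a comparison principle for it is obtained from a first-touching argument. The
  upper bound then comes from an explicit supersolution of the linearised equation, a tilted heat dipole
  \<open>exp (- sqrt 2 * y) * s powr (- 3 / 2) * y * exp (- y\<^sup>2 / (2 * s))\<close> whose zero follows the curve
  with the logarithmic correction. The lower bound comes from a similar explicit subsolution along a straight
  line, which shows that at the predicted place the probability is bounded away from 0; after a further
  bounded time it is close to 1.
\<close>

section \<open>Gaussian and exponential kernels\<close>

text \<open>The coefficient 3 / (2 * sqrt 2) balances two exponents. At bounded distance from its
  zero the heat dipole decays like s powr (- 3 / 2), while moving the frame back by d gains a factor
  exp (sqrt 2 * d) from the tilt; they cancel for sqrt 2 * d = 3 / 2 * ln s. The dipole is exact
  only in a frame of constant speed, so moving its zero along the logarithmic curve leaves an error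
  of order ln s / s that must be absorbed with the right sign. From above this is done by ln s times
  a polynomial in y / sqrt s. From below the correction becomes a smaller slope over a fixed
  horizon: the frame is straight, concavity of ln keeps the barrier small before the horizon, and
  only the quadratic term has to be absorbed. Comparison needs solutions that are continuous up to
  time 0, which the indicator of a half line does not provide as initial value. A Lipschitz ramp
  replaces it, at the price of a shift by 1, harmless for a bounded error.\<close>

definition gauss :: "real measure" where
  "gauss = density lborel std_normal_density"

definition expo :: "real measure" where
  "expo = density lborel (exponential_density 1)"

lemma sets_gauss [simp, measurable_cong]: "sets gauss = sets borel"
  and space_gauss [simp]: "space gauss = UNIV"
  and sets_expo [simp, measurable_cong]: "sets expo = sets borel"
  and space_expo [simp]: "space expo = UNIV"
  by (simp_all add: gauss_def expo_def)

interpretation gauss: prob_space gauss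
  unfolding gauss_def by (rule prob_space_normal_density) simp

interpretation expo: prob_space expo
  unfolding expo_def by (rule prob_space_exponential_density) simp

interpretation expo_gauss: pair_prob_space expo gauss ..

interpretation gauss_gauss: pair_prob_space gauss gauss ..

lemma gauss_UNIV [simp]: "measure gauss UNIV = 1"
  and expo_UNIV [simp]: "measure expo UNIV = 1"
  using gauss.prob_space expo.prob_space by simp_all

text \<open>The fourth moment serves the remainder in \<open>touching\<close>: a term k^4 at k of
  size sqrt h has mean of order h^2 and disappears in the derivative at h = 0.\<close>

lemma gauss_moments:
  shows "integrable gauss (\<lambda>k. k)" "(\<integral>k. k \<partial>gauss) = 0"
    and "integrable gauss (\<lambda>k. k^2)" "(\<integral>k. k^2 \<partial>gauss) = 1"
    and "integrable gauss (\<lambda>k. k^4)" "(\<integral>k. k^4 \<partial>gauss) = 3"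
proof -
  have *: "integrable gauss (\<lambda>k. k^n)" "(\<integral>k. k^n \<partial>gauss) = (\<integral>x. std_normal_density x * x^n \<partial>lborel)" for n
    using integrable_std_normal_moment[of n]
    by (simp_all add: gauss_def integrable_density integral_density)
  show "integrable gauss (\<lambda>k. k)" using *(1)[of 1] by simp
  show "integrable gauss (\<lambda>k. k^2)" "integrable gauss (\<lambda>k. k^4)" by (rule *)+
  show "(\<integral>k. k \<partial>gauss) = 0" using *(2)[of 1] integral_std_normal_moment_odd[of 0] by simp
  show "(\<integral>k. k^2 \<partial>gauss) = 1"
    using *(2)[of 2] integral_std_normal_moment_even[of 1] by simp
  show "(\<integral>k. k^4 \<partial>gauss) = 3"
    using *(2)[of 4] integral_std_normal_moment_even[of 2] by (simp add: fact_numeral)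
qed

lemma (in prob_space) distr_pair_snd:
  assumes "sigma_finite_measure N"
  shows "distr (M \<Otimes>\<^sub>M N) N snd = N"
proof (rule measure_eqI)
  fix A assume A: "A \<in> sets (distr (M \<Otimes>\<^sub>M N) N snd)"
  then have "snd -` A \<inter> space (M \<Otimes>\<^sub>M N) = space M \<times> A"
    by (auto simp: space_pair_measure dest: sets.sets_into_space)
  with A show "emeasure (distr (M \<Otimes>\<^sub>M N) N snd) A = emeasure N A"
    by (simp add: emeasure_distr sigma_finite_measure.emeasure_pair_measure_Times[OF assms] emeasure_space_1)
qed simp

lemma distributed_gauss: "distributed gauss lborel (\<lambda>x. x) std_normal_density"
  by (simp add: distributed_def gauss_def distr_id2)

lemma distr_gauss_uminus: "distr gauss borel uminus = gauss"
proof -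
  from gauss.normal_density_affine[OF distributed_gauss, of "-1" 0]
  have "distributed gauss lborel uminus std_normal_density" by simp
  then show ?thesis by (simp add: distributed_def gauss_def cong: distr_cong)
qed

lemma integral_gauss_uminus:
  fixes f :: "real \<Rightarrow> real"
  assumes [measurable]: "f \<in> borel_measurable borel"
  shows "(\<integral>k. f (- k) \<partial>gauss) = (\<integral>k. f k \<partial>gauss)"
  by (subst (2) distr_gauss_uminus [symmetric]) (simp add: integral_distr)

lemma distributed_scaled_gauss:
  assumes "prob_space M" "distributed M lborel X std_normal_density" "0 < s"
  shows "distributed M lborel (\<lambda>\<omega>. sqrt s * X \<omega>) (normal_density 0 (sqrt s))"
  using prob_space.normal_density_affine[OF assms(1,2), of "sqrt s" 0] assms(3) by simp

lemma integral_normal_gauss: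
  fixes f :: "real \<Rightarrow> real"
  assumes [measurable]: "f \<in> borel_measurable borel" and "0 < s"
    and X: "distributed M lborel X (normal_density 0 (sqrt s))"
  shows "(\<integral>\<omega>. f (X \<omega>) \<partial>M) = (\<integral>k. f (sqrt s * k) \<partial>gauss)"
proof -
  have [measurable]: "X \<in> borel_measurable M"
    using X by (auto simp: distributed_def)
  have "(\<integral>\<omega>. f (X \<omega>) \<partial>M) = (\<integral>x. f x \<partial>distr M lborel X)"
    by (simp add: integral_distr)
  also have "distr M lborel X = distr gauss lborel (\<lambda>k. sqrt s * k)"
    using X distributed_scaled_gauss[OF gauss.prob_space_axioms distributed_gauss \<open>0 < s\<close>]
    by (simp add: distributed_def)
  also have "(\<integral>x. f x \<partial>\<dots>) = (\<integral>k. f (sqrt s * k) \<partial>gauss)"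
    by (simp add: integral_distr)
  finally show ?thesis .
qed

text \<open>Semigroup property of the heat flow: the two displacements are independent normal
  variables and their variances add.\<close>

lemma integral_gauss_gauss:
  fixes f :: "real \<Rightarrow> real"
  assumes f[measurable]: "f \<in> borel_measurable borel" and "0 \<le> s" "0 \<le> t"
    and bd: "\<And>x. \<bar>f x\<bar> \<le> c"
  shows "(\<integral>k. (\<integral>l. f (sqrt s * k + sqrt t * l) \<partial>gauss) \<partial>gauss) = (\<integral>m. f (sqrt (s + t) * m) \<partial>gauss)"
\<comment> \<open>A displacement of variance 0 has no density, so it is split off.\<close>
proof (cases "s = 0 \<or> t = 0")
  case True
  then show ?thesis by auto
next
  case False
  then have st: "0 < s" "0 < t" using assms by auto
  let ?N = "gauss \<Otimes>\<^sub>M gauss"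
  have fst: "distr ?N gauss fst = gauss"
    by (rule gauss.distr_pair_fst)
  have snd: "distr ?N gauss snd = gauss"
    by (rule gauss.distr_pair_snd[OF gauss.sigma_finite_measure_axioms])
  have 1: "distributed ?N lborel (\<lambda>x. sqrt s * fst x) (normal_density 0 (sqrt s))"
  proof (rule distributed_scaled_gauss[OF gauss_gauss.prob_space_axioms _ st(1)])
    have "distr ?N lborel fst = distr ?N gauss fst"
      by (intro distr_cong) auto
    then show "distributed ?N lborel fst std_normal_density"
      using fst by (simp add: distributed_def gauss_def)
  qed
  have 2: "distributed ?N lborel (\<lambda>x. sqrt t * snd x) (normal_density 0 (sqrt t))"
  proof (rule distributed_scaled_gauss[OF gauss_gauss.prob_space_axioms _ st(2)])
    have "distr ?N lborel snd = distr ?N gauss snd"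
      by (intro distr_cong) auto
    then show "distributed ?N lborel snd std_normal_density"
      using snd by (simp add: distributed_def gauss_def)
  qed
  have "gauss_gauss.indep_var gauss fst gauss snd"
    by (subst gauss_gauss.indep_var_distribution_eq) (simp add: fst snd distr_id2)
  then have ind: "gauss_gauss.indep_var borel (\<lambda>x. sqrt s * fst x) borel (\<lambda>x. sqrt t * snd x)"
    by (rule gauss_gauss.indep_var_compose[unfolded comp_def]) measurable
  have "distributed ?N lborel (\<lambda>x. sqrt s * fst x + sqrt t * snd x) (normal_density 0 (sqrt (s + t)))"
    using gauss_gauss.add_indep_normal[OF ind _ _ 1 2] st by simp
  then have "(\<integral>x. f (sqrt s * fst x + sqrt t * snd x) \<partial>?N) = (\<integral>m. f (sqrt (s + t) * m) \<partial>gauss)"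
    using st by (intro integral_normal_gauss) auto
  moreover have "integrable ?N (\<lambda>x. f (sqrt s * fst x + sqrt t * snd x))"
    by (rule gauss_gauss.integrable_const_bound[of _ c]) (use bd in auto)
  ultimately show ?thesis
    using gauss_gauss.integral_fst'[of "\<lambda>x. f (sqrt s * fst x + sqrt t * snd x)"] by simp
qed

lemma expo_measure: "0 \<le> h \<Longrightarrow> measure expo {h<..} = exp (- h)" "0 \<le> h \<Longrightarrow> measure expo {..h} = 1 - exp (- h)"
proof -
  have *: "distributed expo lborel (\<lambda>x. x) (exponential_density 1)"
    by (simp add: distributed_def expo_def distr_id2)
  show "0 \<le> h \<Longrightarrow> measure expo {h<..} = exp (- h)"
    using expo.exponential_distributedD_gt[OF *, of h] by (simp add: greaterThan_def)
  show "0 \<le> h \<Longrightarrow> measure expo {..h} = 1 - exp (- h)"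
    using expo.exponential_distributedD_le[OF *, of h] by (simp add: atMost_def)
qed

lemma expo_pos: "AE \<tau> in expo. 0 < \<tau>"
  using expo.AE_in_set_eq_1[of "{0<..}"] expo_measure(1)[of 0] by simp

lemma expo_memoryless:
  fixes f :: "real \<Rightarrow> real"
  assumes [measurable]: "f \<in> borel_measurable borel" and "0 \<le> h"
  shows "(\<integral>\<tau>. (if h < \<tau> then f \<tau> else 0) \<partial>expo) = exp (- h) * (\<integral>\<tau>. f (\<tau> + h) \<partial>expo)"
proof -
  have "(\<integral>\<tau>. (if h < \<tau> then f \<tau> else 0) \<partial>expo)
      = (\<integral>\<tau>. exponential_density 1 \<tau> * (if h < \<tau> then f \<tau> else 0) \<partial>lborel)"
    by (simp add: expo_def integral_density exponential_density_nonneg)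
  also have "\<dots> = (\<integral>\<tau>. exponential_density 1 (h + 1 * \<tau>) * (if h < h + 1 * \<tau> then f (h + 1 * \<tau>) else 0) \<partial>lborel)"
    by (subst lborel_integral_real_affine[of 1 _ h]) simp_all
  also have "\<dots> = (\<integral>\<tau>. exp (-h) * (exponential_density 1 \<tau> * f (\<tau> + h)) \<partial>lborel)"
  proof (rule integral_cong_AE)
    \<comment> \<open>At \<tau> = 0 the strict test on the left fails although the density on the
      right is 1, hence only almost everywhere.\<close>
    show "AE \<tau> in lborel. exponential_density 1 (h + 1 * \<tau>) * (if h < h + 1 * \<tau> then f (h + 1 * \<tau>) else 0)
       = exp (-h) * (exponential_density 1 \<tau> * f (\<tau> + h))"
      using AE_lborel_singleton[of 0] by eventually_elim
        (use \<open>0 \<le> h\<close> in \<open>auto simp: exponential_density_def exp_diff exp_minus add.commute field_simps\<close>)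
  qed (simp_all add: exponential_density_def)
  also have "\<dots> = exp (- h) * (\<integral>\<tau>. f (\<tau> + h) \<partial>expo)"
    by (simp add: expo_def integral_density exponential_density_nonneg)
  finally show ?thesis .
qed

section \<open>The branching recursion\<close>

text \<open>One standard normal variable is enough per particle: the recursion looks at its path at
  a single time r, where the displacement has the law of sqrt r times that variable.\<close>

abbreviation clock_noise :: "(real \<times> real) measure" where
  "clock_noise \<equiv> expo \<Otimes>\<^sub>M gauss"

lemma integrable_clock_noise:
  fixes F :: "real \<times> real \<Rightarrow> real"
  assumes "F \<in> borel_measurable clock_noise" "\<And>p. \<bar>F p\<bar> \<le> c"
  shows "integrable clock_noise F"
  by (rule expo_gauss.integrable_const_bound[of _ c]) (use assms in auto)

lemma distr_clock_noise_fst: "distr clock_noise expo fst = expo"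
  by (rule gauss.distr_pair_fst)

lemma AE_clock_noise_pos: "AE p in clock_noise. 0 < fst p"
proof -
  have "AE \<tau> in distr clock_noise expo fst. 0 < \<tau>"
    unfolding distr_clock_noise_fst by (rule expo_pos)
  then show ?thesis by (subst (asm) AE_distr_iff) auto
qed

lemma integral_clock_noise_mono:
  fixes F H :: "real \<times> real \<Rightarrow> real"
  assumes "F \<in> borel_measurable clock_noise" "\<And>p. \<bar>F p\<bar> \<le> c"
    and "H \<in> borel_measurable clock_noise" "\<And>p. \<bar>H p\<bar> \<le> d"
    and "\<And>\<tau> k. 0 < \<tau> \<Longrightarrow> F (\<tau>, k) \<le> H (\<tau>, k)"
  shows "(\<integral>p. F p \<partial>clock_noise) \<le> (\<integral>p. H p \<partial>clock_noise)"
  using assms AE_clock_noise_pos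
  by (intro integral_mono_AE integrable_clock_noise) (auto elim!: eventually_mono)

lemma integral_clock:
  fixes f :: "real \<Rightarrow> real"
  assumes [measurable]: "f \<in> borel_measurable borel"
  shows "(\<integral>p. f (fst p) \<partial>clock_noise) = (\<integral>\<tau>. f \<tau> \<partial>expo)"
    and "integrable clock_noise (\<lambda>p. f (fst p)) \<longleftrightarrow> integrable expo f"
  by (subst (2) distr_clock_noise_fst[symmetric]; subst integral_distr integrable_distr_eq; simp)+

lemma distr_clock_noise_snd: "distr clock_noise gauss snd = gauss"
  by (rule expo.distr_pair_snd[OF gauss.sigma_finite_measure_axioms])

lemma integral_noise:
  fixes f :: "real \<Rightarrow> real"
  assumes [measurable]: "f \<in> borel_measurable borel"
  shows "(\<integral>p. f (snd p) \<partial>clock_noise) = (\<integral>k. f k \<partial>gauss)"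
    and "integrable clock_noise (\<lambda>p. f (snd p)) \<longleftrightarrow> integrable gauss f"
  by (subst (2) distr_clock_noise_snd[symmetric]; subst integral_distr integrable_distr_eq; simp)+

lemma integral_clock_noise:
  fixes F :: "real \<times> real \<Rightarrow> real"
  assumes "F \<in> borel_measurable clock_noise" "\<And>p. \<bar>F p\<bar> \<le> c"
  shows "(\<integral>p. F p \<partial>clock_noise) = (\<integral>\<tau>. (\<integral>k. F (\<tau>, k) \<partial>gauss) \<partial>expo)"
  using expo_gauss.integral_fst'[OF integrable_clock_noise[OF assms]] by simp

lemma integral_clock_noise_reflect:
  fixes F :: "real \<times> real \<Rightarrow> real"
  assumes [measurable]: "F \<in> borel_measurable clock_noise" and "\<And>p. \<bar>F p\<bar> \<le> c"
  shows "(\<integral>p. F (fst p, - snd p) \<partial>clock_noise) = (\<integral>p. F p \<partial>clock_noise)"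
proof -
  have "(\<integral>p. F (fst p, - snd p) \<partial>clock_noise) = (\<integral>\<tau>. (\<integral>k. F (\<tau>, - k) \<partial>gauss) \<partial>expo)"
    by (subst integral_clock_noise[of _ c]) (use assms in auto)
  also have "\<dots> = (\<integral>p. F p \<partial>clock_noise)"
    by (subst integral_gauss_uminus) (use assms in \<open>auto simp: integral_clock_noise[of _ c]\<close>)
  finally show ?thesis .
qed

text \<open>The tilted density is 1 / (1 + l) times the exponential density of rate 1 + l. The value
  l = 1 enters the Lipschitz bound, l = 3 the absence of explosion.\<close>

lemma expo_laplace:
  assumes "0 \<le> l"
  shows "(\<integral>\<tau>. exp (- l * \<tau>) \<partial>expo) = 1 / (1 + l)" "integrable expo (\<lambda>\<tau>. exp (- l * \<tau>))"
proof -
  interpret E: prob_space "density lborel (exponential_density (1 + l))"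
    by (rule prob_space_exponential_density) (use assms in simp)
  have *: "exponential_density 1 \<tau> * exp (- l * \<tau>) = exponential_density (1 + l) \<tau> * (1 / (1 + l))" for \<tau>
    using assms by (simp add: exponential_density_def exp_add[symmetric] distrib_left mult.commute)
  have "(\<integral>\<tau>. exp (- l * \<tau>) \<partial>expo) = (\<integral>\<tau>. exponential_density 1 \<tau> * exp (- l * \<tau>) \<partial>lborel)"
    unfolding expo_def by (subst integral_density) (auto simp: exponential_density_nonneg)
  also have "\<dots> = (\<integral>\<tau>. 1 / (1 + l) \<partial>density lborel (exponential_density (1 + l)))"
    unfolding * by (subst integral_density) (use assms in \<open>auto simp: exponential_density_nonneg\<close>)
  finally show "(\<integral>\<tau>. exp (- l * \<tau>) \<partial>expo) = 1 / (1 + l)"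
    using E.prob_space by simp
  show "integrable expo (\<lambda>\<tau>. exp (- l * \<tau>))"
    using expo_pos assms by (intro expo.integrable_const_bound[of _ 1]) (auto elim!: eventually_mono)
qed

text \<open>
  \<open>surv g n t x\<close> is the expectation, for the branching Brownian motion started at \<open>x\<close>, of the
  product of \<open>g\<close> over the positions of the particles of generation less than \<open>n\<close> alive at time
  \<open>t\<close>; the recursion conditions on the first branching time.
\<close>

definition branch_step :: "(real \<Rightarrow> real) \<Rightarrow> (real \<Rightarrow> real \<Rightarrow> real) \<Rightarrow> real \<Rightarrow> real \<Rightarrow> real" where
  "branch_step g Q t x = (\<integral>p. (if t < fst p then g (x + sqrt t * snd p)
     else (Q (t - fst p) (x + sqrt (fst p) * snd p))\<^sup>2) \<partial>clock_noise)"

primrec surv :: "(real \<Rightarrow> real) \<Rightarrow> nat \<Rightarrow> real \<Rightarrow> real \<Rightarrow> real" where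
  "surv g 0 = (\<lambda>t x. 1)"
| "surv g (Suc n) = branch_step g (surv g n)"

definition survival :: "(real \<Rightarrow> real) \<Rightarrow> real \<Rightarrow> real \<Rightarrow> real" where
  "survival g t x = lim (\<lambda>n. surv g n t x)"

locale initial_value =
  fixes g :: "real \<Rightarrow> real"
  assumes g_measurable [measurable]: "g \<in> borel_measurable borel"
    and g_nonneg: "0 \<le> g x" and g_le1: "g x \<le> 1"
begin

lemma branch_step_measurable [measurable]:
  assumes [measurable]: "case_prod Q \<in> borel_measurable (borel \<Otimes>\<^sub>M borel)"
  shows "case_prod (branch_step g Q) \<in> borel_measurable (borel \<Otimes>\<^sub>M borel)"
  unfolding branch_step_def by measurable

lemma surv_measurable [measurable]: "case_prod (surv g n) \<in> borel_measurable (borel \<Otimes>\<^sub>M borel)"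
  by (induction n) simp_all

lemma branch_step_bounds:
  assumes [measurable]: "case_prod Q \<in> borel_measurable (borel \<Otimes>\<^sub>M borel)"
    and "\<And>t x. 0 \<le> Q t x" "\<And>t x. Q t x \<le> 1"
  shows "0 \<le> branch_step g Q t x \<and> branch_step g Q t x \<le> 1"
proof
  show "0 \<le> branch_step g Q t x"
    unfolding branch_step_def by (intro Bochner_Integration.integral_nonneg) (simp add: g_nonneg)
  have "branch_step g Q t x \<le> (\<integral>p. 1 \<partial>clock_noise)"
    unfolding branch_step_def
    by (rule integral_clock_noise_mono[of _ 1 _ 1])
      (auto simp: g_nonneg g_le1 assms power_le_one)
  then show "branch_step g Q t x \<le> 1"
    using expo_gauss.prob_space by simp
qed

lemma surv_bounds: "0 \<le> surv g n t x" "surv g n t x \<le> 1"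
proof -
  have "\<forall>t x. 0 \<le> surv g n t x \<and> surv g n t x \<le> 1"
    by (induction n) (auto simp: branch_step_bounds)
  then show "0 \<le> surv g n t x" "surv g n t x \<le> 1" by auto
qed

text \<open>A lineage cut off at generation n contributes the factor 1, so admitting one more
  generation can only lower the product. Hence the limit in \<open>survival\<close> exists.\<close>

lemma surv_Suc_le: "surv g (Suc n) t x \<le> surv g n t x"
proof (induction n arbitrary: t x)
  case 0
  then show ?case using surv_bounds(2)[of "Suc 0" t x] by simp
next
  case (Suc n)
  have "branch_step g (surv g (Suc n)) t x \<le> branch_step g (surv g n) t x"
    unfolding branch_step_def
    by (rule integral_clock_noise_mono[of _ 1 _ 1])
      (auto simp: g_nonneg g_le1 surv_bounds power_le_one Suc power_mono simp del: surv.simps)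
  then show ?case by simp
qed

lemma surv_tendsto: "(\<lambda>n. surv g n t x) \<longlonglongrightarrow> survival g t x"
proof -
  have "decseq (\<lambda>n. surv g n t x)" by (intro decseq_SucI surv_Suc_le)
  then have "convergent (\<lambda>n. surv g n t x)"
    using decseq_convergent[of "\<lambda>n. surv g n t x" 0] surv_bounds(1)[of _ t x] by (metis convergentI)
  then show ?thesis unfolding survival_def by (simp add: convergent_LIMSEQ_iff)
qed

lemma survival_measurable [measurable]: "case_prod (survival g) \<in> borel_measurable (borel \<Otimes>\<^sub>M borel)"
  by (rule borel_measurable_LIMSEQ_real[of _ "\<lambda>n. case_prod (surv g n)"])
    (auto simp: surv_tendsto)

lemma survival_bounds: "0 \<le> survival g t x" "survival g t x \<le> 1"
  using LIMSEQ_le_const[OF surv_tendsto, of 0] LIMSEQ_le_const2[OF surv_tendsto, of _ _ 1] surv_bounds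
  by auto

lemma survival_fixpoint: "survival g t x = branch_step g (survival g) t x"
proof (rule LIMSEQ_unique)
  show "(\<lambda>n. surv g (Suc n) t x) \<longlonglongrightarrow> survival g t x"
    using surv_tendsto by (rule LIMSEQ_Suc)
  have "(\<lambda>n. branch_step g (surv g n) t x) \<longlonglongrightarrow> branch_step g (survival g) t x"
    unfolding branch_step_def
  proof (rule integral_dominated_convergence[where w = "\<lambda>_. 1"])
    show "AE p in clock_noise. (\<lambda>n. if t < fst p then g (x + sqrt t * snd p)
          else (surv g n (t - fst p) (x + sqrt (fst p) * snd p))\<^sup>2) \<longlonglongrightarrow>
        (if t < fst p then g (x + sqrt t * snd p)
          else (survival g (t - fst p) (x + sqrt (fst p) * snd p))\<^sup>2)"
      by (auto intro!: tendsto_power surv_tendsto)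
  qed (auto simp: g_nonneg g_le1 surv_bounds power_le_one)
  then show "(\<lambda>n. surv g (Suc n) t x) \<longlonglongrightarrow> branch_step g (survival g) t x" by simp
qed

text \<open>If the first clock exceeds h, its residual is again exponential, and the displacements
  before and after h add up to one Gaussian. This localises the equation to a short time interval,
  which the touching argument needs.\<close>

lemma survival_restart:
  assumes "0 \<le> h" "h \<le> t"
  shows "survival g t x = (\<integral>p. (if h < fst p then survival g (t - h) (x + sqrt h * snd p)
     else (survival g (t - fst p) (x + sqrt (fst p) * snd p))\<^sup>2) \<partial>clock_noise)"
proof -
  let ?S = "survival g"
  \<comment> \<open>The expectation conditioned on the first branching time; \<open>c\<close> below
    is the value when no branching has occurred up to h.\<close>
  define \<Psi> where "\<Psi> \<tau> = (\<integral>k. (if t < \<tau> then g (x + sqrt t * k)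
     else (?S (t - \<tau>) (x + sqrt \<tau> * k))\<^sup>2) \<partial>gauss)" for \<tau>
  define c where "c = (\<integral>k. ?S (t - h) (x + sqrt h * k) \<partial>gauss)"
  have [measurable]: "\<Psi> \<in> borel_measurable borel"
    unfolding \<Psi>_def by measurable
  have bd: "\<bar>if b then g y else (?S s z)\<^sup>2\<bar> \<le> 1" "\<bar>if b then ?S r y else (?S s z)\<^sup>2\<bar> \<le> 1" for b r y s z
    by (auto simp: g_nonneg g_le1 survival_bounds power_le_one)
  have \<Psi>_bd: "\<bar>\<Psi> \<tau>\<bar> \<le> 1" for \<tau>
    unfolding \<Psi>_def using bd(1)
    by (intro order.trans[OF integral_abs_bound] gauss.integral_le_const gauss.integrable_const_bound[of _ 1]) auto
  have \<Psi>_int: "integrable expo \<Psi>" "integrable expo (\<lambda>\<tau>. if h < \<tau> then \<Psi> \<tau> else 0)"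
      "integrable expo (\<lambda>\<tau>. if h < \<tau> then 0 else \<Psi> \<tau>)"
    by (rule expo.integrable_const_bound[of _ 1]; use \<Psi>_bd in auto)+
  have "?S t x = (\<integral>\<tau>. \<Psi> \<tau> \<partial>expo)"
    unfolding survival_fixpoint[of t x] branch_step_def \<Psi>_def
    by (subst integral_clock_noise[of _ 1]) (auto simp: bd(1)[simplified] cong: if_cong)
  also have "\<dots> = (\<integral>\<tau>. (if h < \<tau> then \<Psi> \<tau> else 0) + (if h < \<tau> then 0 else \<Psi> \<tau>) \<partial>expo)"
    by (intro Bochner_Integration.integral_cong) auto
  also have "\<dots> = exp (- h) * (\<integral>\<tau>. \<Psi> (\<tau> + h) \<partial>expo) + (\<integral>\<tau>. (if h < \<tau> then 0 else \<Psi> \<tau>) \<partial>expo)"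
    using \<Psi>_int assms by (simp add: expo_memoryless)
  also have "(\<integral>\<tau>. \<Psi> (\<tau> + h) \<partial>expo) = c"
  proof -
    let ?F = "\<lambda>k \<tau> l. if t - h < \<tau> then g (x + sqrt h * k + sqrt (t - h) * l)
       else (?S (t - h - \<tau>) (x + sqrt h * k + sqrt \<tau> * l))\<^sup>2"
    have inner: "(\<integral>k. (\<integral>l. ?F k \<tau> l \<partial>gauss) \<partial>gauss) = \<Psi> (\<tau> + h)" if "0 < \<tau>" for \<tau>
    proof (cases "t - h < \<tau>")
      case True
      then show ?thesis
        using integral_gauss_gauss[of "\<lambda>z. g (x + z)" h "t - h" 1] assms
        by (simp add: \<Psi>_def g_nonneg g_le1 add.assoc less_diff_eq)
    next
      case False
      then show ?thesis
        using integral_gauss_gauss[of "\<lambda>z. (?S (t - h - \<tau>) (x + z))\<^sup>2" h "\<tau>" 1] assms that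
        by (simp add: \<Psi>_def survival_bounds power_le_one add.assoc less_diff_eq diff_diff_eq add.commute[of h])
    qed
    have "c = (\<integral>k. (\<integral>\<tau>. (\<integral>l. ?F k \<tau> l \<partial>gauss) \<partial>expo) \<partial>gauss)"
      unfolding c_def survival_fixpoint[of "t - h"] branch_step_def
      by (subst integral_clock_noise[of _ 1]) (auto simp: bd(1)[simplified] cong: if_cong)
    also have "\<dots> = (\<integral>\<tau>. (\<integral>k. (\<integral>l. ?F k \<tau> l \<partial>gauss) \<partial>gauss) \<partial>expo)"
    proof -
      have "integrable clock_noise (\<lambda>(\<tau>, k). \<integral>l. ?F k \<tau> l \<partial>gauss)"
        by (rule integrable_clock_noise[of _ 1])
          (auto intro!: order.trans[OF integral_abs_bound] gauss.integral_le_const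
            gauss.integrable_const_bound[of _ 1] simp: bd(1)[simplified])
      from expo_gauss.Fubini_integral[OF this] show ?thesis .
    qed
    also have "\<dots> = (\<integral>\<tau>. \<Psi> (\<tau> + h) \<partial>expo)"
      using expo_pos by (intro integral_cong_AE) (auto elim!: eventually_mono simp: inner)
    finally show ?thesis by simp
  qed
  also have "exp (- h) * c = (\<integral>\<tau>. (if h < \<tau> then c else 0) \<partial>expo)"
    using expo_memoryless[of "\<lambda>_. c" h] assms by simp
  also have "\<dots> + (\<integral>\<tau>. (if h < \<tau> then 0 else \<Psi> \<tau>) \<partial>expo)
      = (\<integral>\<tau>. (if h < \<tau> then c else 0) + (if h < \<tau> then 0 else \<Psi> \<tau>) \<partial>expo)"
    by (subst Bochner_Integration.integral_add)
      (auto intro!: expo.integrable_const_bound[of _ "\<bar>c\<bar>"] \<Psi>_int)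
  also have "\<dots> = (\<integral>\<tau>. (\<integral>k. (if h < \<tau> then ?S (t - h) (x + sqrt h * k)
     else (?S (t - \<tau>) (x + sqrt \<tau> * k))\<^sup>2) \<partial>gauss) \<partial>expo)"
    using assms by (intro Bochner_Integration.integral_cong) (auto simp: c_def \<Psi>_def)
  also have "\<dots> = (\<integral>p. (if h < fst p then ?S (t - h) (x + sqrt h * snd p)
     else (?S (t - fst p) (x + sqrt (fst p) * snd p))\<^sup>2) \<partial>clock_noise)"
    by (subst integral_clock_noise[of _ 1]) (auto simp: bd(2)[simplified] cong: if_cong)
  finally show ?thesis .
qed

text \<open>Two systems started at x and y and driven by the same noise keep every particle pair at
  distance |x - y|, and the mean number of particles is exp t.\<close>

lemma surv_lipschitz:
  assumes "\<And>x y. \<bar>g x - g y\<bar> \<le> L * \<bar>x - y\<bar>" "0 \<le> L" "0 \<le> t"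
  shows "\<bar>surv g n t x - surv g n t y\<bar> \<le> L * exp t * \<bar>x - y\<bar>"
  using assms(3)
proof (induction n arbitrary: t x y)
  case 0
  then show ?case using assms by simp
next
  case (Suc n)
  let ?F = "\<lambda>x p. if t < fst p then g (x + sqrt t * snd p)
     else (surv g n (t - fst p) (x + sqrt (fst p) * snd p))\<^sup>2"
  let ?d = "\<bar>x - y\<bar>"
  \<comment> \<open>The recursion for the mean number of particles: 1 without a branching before t,
    otherwise twice exp (t - \<tau>). Its integral is exp t again, which closes the
    induction.\<close>
  let ?B = "\<lambda>\<tau>. if t < \<tau> then 1 else 2 * exp t * exp (- 1 * \<tau>)"
  have B: "?B = (\<lambda>\<tau>. indicator {t<..} \<tau> + (2 * exp t * exp (- 1 * \<tau>)
      - 2 * exp t * (if t < \<tau> then exp (- 1 * \<tau>) else 0)))"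
    by auto
  have int_tail: "integrable expo (\<lambda>\<tau>. if t < \<tau> then exp (- 1 * \<tau>) else 0)"
    using \<open>0 \<le> t\<close> by (intro expo.integrable_const_bound[of _ 1]) auto
  have "(\<integral>\<tau>. ?B \<tau> \<partial>expo) = exp (- t) + (2 * exp t * (1 / 2)
      - 2 * exp t * (\<integral>\<tau>. (if t < \<tau> then exp (- 1 * \<tau>) else 0) \<partial>expo))"
    unfolding B using expo_laplace[of 1] int_tail
    by (simp add: expo.emeasure_eq_measure expo_measure(1)[OF \<open>0 \<le> t\<close>])
  also have "(\<integral>\<tau>. (if t < \<tau> then exp (- 1 * \<tau>) else 0) \<partial>expo) = exp (- t) * (\<integral>\<tau>. exp (- t) * exp (- 1 * \<tau>) \<partial>expo)"
    using \<open>0 \<le> t\<close> by (subst expo_memoryless) (auto simp: exp_add[symmetric] exp_diff exp_minus field_simps)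
  also have "\<dots> = exp (- t) * exp (- t) / 2"
    using expo_laplace[of 1] by simp
  finally have B_int: "(\<integral>\<tau>. ?B \<tau> \<partial>expo) = exp t"
    by (simp add: exp_minus field_simps)
  have B_integrable: "integrable expo ?B"
    unfolding B using expo_laplace[of 1] int_tail
    by (simp add: expo.emeasure_eq_measure)
  have meas: "?F x \<in> borel_measurable clock_noise" for x
    by measurable
  have int: "integrable clock_noise (?F x)" for x
    by (rule integrable_clock_noise[of _ 1, OF meas]) (auto simp: g_nonneg g_le1 surv_bounds power_le_one)
  have le: "\<bar>?F x p - ?F y p\<bar> \<le> L * ?d * ?B (fst p)" if "0 < fst p" for p
  proof (cases "t < fst p")
    case True
    then show ?thesis using assms(1)[of "x + sqrt t * snd p" "y + sqrt t * snd p"] by simp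
  next
    case False
    let ?a = "surv g n (t - fst p) (x + sqrt (fst p) * snd p)"
    let ?b = "surv g n (t - fst p) (y + sqrt (fst p) * snd p)"
    have "\<bar>?a\<^sup>2 - ?b\<^sup>2\<bar> = (?a + ?b) * \<bar>?a - ?b\<bar>"
      using surv_bounds[of n] by (simp add: power2_eq_square square_diff_square_factored abs_mult)
    also have "\<dots> \<le> 2 * (L * exp (t - fst p) * ?d)"
      using Suc.IH[of "t - fst p" "x + sqrt (fst p) * snd p" "y + sqrt (fst p) * snd p"] False
        surv_bounds(1)[of n "t - fst p"] add_mono[OF surv_bounds(2) surv_bounds(2), of n "t - fst p" _ n "t - fst p"]
      by (intro mult_mono) auto
    finally show ?thesis using False by (simp add: exp_diff exp_minus field_simps)
  qed
  have "AE p in clock_noise. \<bar>?F x p - ?F y p\<bar> \<le> L * ?d * ?B (fst p)"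
    using AE_clock_noise_pos by eventually_elim (rule le)
  moreover have B': "integrable clock_noise (\<lambda>p. ?B (fst p))" "(\<integral>p. ?B (fst p) \<partial>clock_noise) = exp t"
    by (rule integral_clock(2)[THEN iffD2, OF _ B_integrable], measurable)
      (rule trans[OF integral_clock(1) B_int], measurable)
  ultimately have "(\<integral>p. \<bar>?F x p - ?F y p\<bar> \<partial>clock_noise) \<le> (\<integral>p. L * ?d * ?B (fst p) \<partial>clock_noise)"
    using int by (intro integral_mono_AE) auto
  also have "\<dots> = L * ?d * exp t" by (subst integral_mult_right_zero) (simp only: B')
  also have "(\<integral>p. \<bar>?F x p - ?F y p\<bar> \<partial>clock_noise) \<ge> \<bar>\<integral>p. ?F x p - ?F y p \<partial>clock_noise\<bar>"
    by (rule integral_abs_bound)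
  also have "(\<integral>p. ?F x p - ?F y p \<partial>clock_noise) = surv g (Suc n) t x - surv g (Suc n) t y"
    using int by (simp add: branch_step_def)
  finally show ?case by (simp add: mult_ac)
qed

lemma survival_lipschitz:
  assumes "\<And>x y. \<bar>g x - g y\<bar> \<le> L * \<bar>x - y\<bar>" "0 \<le> L" "0 \<le> t"
  shows "\<bar>survival g t x - survival g t y\<bar> \<le> L * exp t * \<bar>x - y\<bar>"
  by (rule LIMSEQ_le_const2[OF tendsto_rabs[OF tendsto_diff[OF surv_tendsto surv_tendsto]]])
    (use surv_lipschitz[OF assms] in auto)

end

lemma surv_mono:
  assumes "initial_value g" "initial_value g'" "\<And>x. g x \<le> g' x"
  shows "surv g n t x \<le> surv g' n t x"
proof (induction n arbitrary: t x)
  case (Suc n)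
  interpret g: initial_value g by fact
  interpret g': initial_value g' by fact
  show ?case
    unfolding surv.simps branch_step_def
    by (rule integral_clock_noise_mono[of _ 1 _ 1])
      (auto simp: g.g_nonneg g.g_le1 g'.g_nonneg g'.g_le1 g.surv_bounds g'.surv_bounds
        power_le_one Suc power_mono assms)
qed simp

lemma surv_reflect:
  assumes "initial_value g"
  shows "surv (\<lambda>x. g (c - x)) n t x = surv g n t (c - x)"
proof (induction n arbitrary: t x)
  case (Suc n)
  interpret g: initial_value g by fact
  let ?F = "\<lambda>p. if t < fst p then g (c - x + sqrt t * snd p)
       else (surv g n (t - fst p) (c - x + sqrt (fst p) * snd p))\<^sup>2"
  have "surv (\<lambda>x. g (c - x)) (Suc n) t x = (\<integral>p. ?F (fst p, - snd p) \<partial>clock_noise)"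
    unfolding surv.simps branch_step_def
    by (intro Bochner_Integration.integral_cong refl) (auto simp: Suc algebra_simps)
  also have "\<dots> = surv g (Suc n) t (c - x)"
    by (subst integral_clock_noise_reflect[of _ 1])
      (auto simp: branch_step_def g.g_nonneg g.g_le1 g.surv_bounds power_le_one)
  finally show ?case .
qed simp

text \<open>A union bound for the event that some particle lies in a forbidden set. It will split
  the exit from a symmetric interval into two one-sided exits.\<close>

lemma surv_subadditive:
  assumes "initial_value g" "initial_value g1" "initial_value g2"
    and "\<And>x. 1 - g x \<le> (1 - g1 x) + (1 - g2 x)"
  shows "1 - surv g n t x \<le> (1 - surv g1 n t x) + (1 - surv g2 n t x)"
proof (induction n arbitrary: t x)
  case (Suc n)
  interpret g: initial_value g by fact
  interpret g1: initial_value g1 by fact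
  interpret g2: initial_value g2 by fact
  let ?F = "\<lambda>g p. if t < fst p then g (x + sqrt t * snd p)
       else (surv g n (t - fst p) (x + sqrt (fst p) * snd p))\<^sup>2"
  \<comment> \<open>Branching squares the values. In the second case the claim follows from 1 + (b +
    c - 1)^2 - b^2 - c^2 = 2 * (1 - b) * (1 - c).\<close>
  have sq: "b\<^sup>2 + c\<^sup>2 \<le> 1 + a\<^sup>2" if "0 \<le> b" "b \<le> 1" "0 \<le> c" "c \<le> 1" "0 \<le> a" "1 - a \<le> (1 - b) + (1 - c)"
    for a b c :: real
  proof (cases "b + c \<le> 1")
    case True
    have "b\<^sup>2 + c\<^sup>2 \<le> b + c"
      using that by (intro add_mono) (auto simp: power2_eq_square mult_left_le_one_le)
    then show ?thesis using True zero_le_power2[of a] by linarith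
  next
    case False
    have "(b + c - 1)\<^sup>2 \<le> a\<^sup>2" using that False by (intro power_mono) auto
    moreover have "0 \<le> (1 - b) * (1 - c)" using that by auto
    ultimately show ?thesis by (simp add: power2_eq_square algebra_simps)
  qed
  have int: "integrable clock_noise (?F h)" if "h \<in> {g, g1, g2}" for h
    by (rule integrable_clock_noise[of _ 1])
      (use that in \<open>auto simp: g.g_nonneg g.g_le1 g1.g_nonneg g1.g_le1 g2.g_nonneg g2.g_le1
        g.surv_bounds g1.surv_bounds g2.surv_bounds power_le_one\<close>)
  have "?F g1 p + ?F g2 p \<le> 1 + ?F g p" for p
    using assms(4)[of "x + sqrt t * snd p"]
    by (auto intro!: sq Suc simp: g.surv_bounds g1.surv_bounds g2.surv_bounds)
  then have "(\<integral>p. ?F g1 p + ?F g2 p \<partial>clock_noise) \<le> (\<integral>p. 1 + ?F g p \<partial>clock_noise)"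
    using int by (intro integral_mono Bochner_Integration.integrable_add) auto
  then show ?case
    using int expo_gauss.prob_space by (simp add: branch_step_def)
qed simp

section \<open>Mild solutions and comparison\<close>

text \<open>Within time h either a branching occurs, with probability at most h, or the particle
  moves by an amount of order sqrt h and the spatial Lipschitz bound applies.\<close>

lemma (in initial_value) survival_time_modulus:
  assumes "\<And>x y. \<bar>g x - g y\<bar> \<le> L * \<bar>x - y\<bar>" "0 \<le> L" "0 \<le> h" "h \<le> t"
  shows "\<bar>survival g t x - survival g (t - h) x\<bar> \<le> L * exp t * sqrt h + h"
proof -
  let ?S = "survival g"
  let ?F = "\<lambda>p. if h < fst p then ?S (t - h) (x + sqrt h * snd p)
     else (?S (t - fst p) (x + sqrt (fst p) * snd p))\<^sup>2"
  let ?c = "L * exp t * sqrt h"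
  have c: "0 \<le> ?c" using assms by simp
  have int: "integrable clock_noise ?F"
    by (rule integrable_clock_noise[of _ 1]) (auto simp: survival_bounds power_le_one)
  have int_snd: "integrable clock_noise (\<lambda>p. (snd p)\<^sup>2)" "(\<integral>p. (snd p)\<^sup>2 \<partial>clock_noise) = 1"
    by (rule integral_noise(2)[THEN iffD2, OF _ gauss_moments(3)], measurable)
      (rule trans[OF integral_noise(1) gauss_moments(4)], measurable)
  have int_ind: "integrable clock_noise (\<lambda>p. indicator {..h} (fst p) :: real)"
    "(\<integral>p. indicator {..h} (fst p) \<partial>clock_noise) = 1 - exp (- h)"
    by (subst integral_clock; simp add: expo.emeasure_eq_measure expo_measure(2)[OF assms(3)])+
  have "\<bar>?S t x - ?S (t - h) x\<bar> = \<bar>(\<integral>p. ?F p - ?S (t - h) x \<partial>clock_noise)\<bar>"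
    using int expo_gauss.prob_space survival_restart[OF assms(3,4), of x] by simp
  also have "\<dots> \<le> (\<integral>p. \<bar>?F p - ?S (t - h) x\<bar> \<partial>clock_noise)"
    by (rule integral_abs_bound)
  also have "\<dots> \<le> (\<integral>p. ?c * ((1 + (snd p)\<^sup>2) / 2) + indicator {..h} (fst p) \<partial>clock_noise)"
  proof (intro integral_mono)
    fix p :: "real \<times> real"
    show "\<bar>?F p - ?S (t - h) x\<bar> \<le> ?c * ((1 + (snd p)\<^sup>2) / 2) + indicator {..h} (fst p)"
    proof (cases "h < fst p")
      case True
      have "\<bar>?S (t - h) (x + sqrt h * snd p) - ?S (t - h) x\<bar> \<le> L * exp (t - h) * \<bar>sqrt h * snd p\<bar>"
        using survival_lipschitz[OF assms(1,2), of "t - h" "x + sqrt h * snd p" x] assms by simp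
      also have "\<dots> \<le> L * exp t * \<bar>sqrt h * snd p\<bar>"
        using assms by (intro mult_right_mono mult_left_mono) auto
      also have "\<dots> = ?c * \<bar>snd p\<bar>" using assms by (simp add: abs_mult)
      \<comment> \<open>Replaces the absolute moment by (1 + k^2) / 2, whose mean is exactly
        1.\<close>
      also have "\<dots> \<le> ?c * ((1 + (snd p)\<^sup>2) / 2)"
        using sum_squares_ge_zero[of "\<bar>snd p\<bar> - 1" 0] 
        by (intro mult_left_mono c) (simp add: power2_eq_square algebra_simps)
      finally show ?thesis using True by simp
    next
      case False
      have "\<bar>?F p - ?S (t - h) x\<bar> \<le> 1"
        using False survival_bounds[of "t - h" x] survival_bounds[of "t - fst p" "x + sqrt (fst p) * snd p"]
          power_le_one[of "?S (t - fst p) (x + sqrt (fst p) * snd p)" 2]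
        by (simp add: abs_le_iff) (smt (verit) zero_le_power2)
      then show ?thesis using False c by (simp add: add_increasing)
    qed
  qed (use int int_snd int_ind in auto)
  also have "\<dots> = ?c + (1 - exp (- h))"
    using int_snd int_ind expo_gauss.prob_space by (simp add: add_divide_distrib distrib_left)
  also have "\<dots> \<le> ?c + h"
    using exp_ge_add_one_self[of "- h"] by simp
  finally show ?thesis .
qed

lemma (in initial_value) survival_continuous:
  assumes lip: "\<And>x y. \<bar>g x - g y\<bar> \<le> L * \<bar>x - y\<bar>" and "0 \<le> L"
  shows "continuous_on ({0..} \<times> UNIV) (case_prod (survival g))"
  unfolding continuous_on_def
proof (intro ballI)
  fix p :: "real \<times> real" assume "p \<in> {0..} \<times> UNIV"
  then obtain t x where p: "p = (t, x)" "0 \<le> t" by auto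
  let ?S = "survival g" and ?A = "{0..} \<times> (UNIV :: real set)"
  let ?b = "\<lambda>q. L * exp (t + 1) * sqrt \<bar>fst q - t\<bar> + \<bar>fst q - t\<bar> + L * exp t * \<bar>snd q - x\<bar>"
  \<comment> \<open>Freezing the exponential at t + 1 makes the one-sided modulus usable for times
    on either side of t.\<close>
  have tm: "\<bar>?S r y - ?S s y\<bar> \<le> L * exp (t + 1) * sqrt \<bar>r - s\<bar> + \<bar>r - s\<bar>"
    if "0 \<le> s" "s \<le> r" "r \<le> t + 1" for r s y
  proof -
    have "\<bar>?S r y - ?S s y\<bar> \<le> L * exp r * sqrt (r - s) + (r - s)"
      using survival_time_modulus[OF lip \<open>0 \<le> L\<close>, of "r - s" r y] that by simp
    also have "\<dots> \<le> L * exp (t + 1) * sqrt (r - s) + (r - s)"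
      using that \<open>0 \<le> L\<close> by (intro add_right_mono mult_right_mono mult_left_mono) auto
    finally show ?thesis using that by simp
  qed
  have ev: "\<forall>\<^sub>F q in at p within ?A. norm (case_prod ?S q - ?S t x) \<le> ?b q"
  proof -
    have "((\<lambda>q. fst q) \<longlongrightarrow> t) (at p within ?A)" using p by (auto intro!: tendsto_eq_intros)
    then have "\<forall>\<^sub>F q in at p within ?A. fst q < t + 1" by (rule order_tendstoD) simp
    moreover have "\<forall>\<^sub>F q in at p within ?A. q \<in> ?A" by (simp add: eventually_at_filter)
    ultimately show ?thesis
    proof eventually_elim
      case (elim q)
      obtain s y where q: "q = (s, y)" by fastforce
      have "\<bar>?S s y - ?S t y\<bar> \<le> L * exp (t + 1) * sqrt \<bar>s - t\<bar> + \<bar>s - t\<bar>"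
        using tm[of s t y] tm[of t s y] elim q p by (cases "s \<le> t") (auto simp: abs_minus_commute)
      moreover have "\<bar>?S t y - ?S t x\<bar> \<le> L * exp t * \<bar>y - x\<bar>"
        using survival_lipschitz[OF assms \<open>0 \<le> t\<close>] .
      ultimately show ?case by (simp add: q)
    qed
  qed
  have "(?b \<longlongrightarrow> 0) (at p within ?A)"
    using p by (auto intro!: tendsto_eq_intros)
  from Lim_null_comparison[OF ev this]
  show "(case_prod ?S \<longlongrightarrow> case_prod ?S p) (at p within ?A)"
    using p by (simp add: LIM_zero_iff)
qed

text \<open>
  The integral equation is the mild form of \<open>u\<^sub>t = u\<^sub>x\<^sub>x / 2 - u + G u\<close>, restarted a time \<open>h\<close>
  before \<open>t\<close>. For \<open>G a = a\<^sup>2\<close> and, after passing to \<open>1 - u\<close>, for \<open>G a = 1 - (1 - a)\<^sup>2\<close> this is the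
  F-KPP equation.
\<close>

locale mild_solution =
  fixes G :: "real \<Rightarrow> real" and u :: "real \<Rightarrow> real \<Rightarrow> real"
  assumes u_measurable [measurable]: "case_prod u \<in> borel_measurable (borel \<Otimes>\<^sub>M borel)"
    and G_measurable [measurable]: "G \<in> borel_measurable borel"
    and u_nonneg: "0 \<le> u t x" and u_le1: "u t x \<le> 1"
    and u_continuous: "continuous_on ({0..} \<times> UNIV) (case_prod u)"
    and G_range: "0 \<le> a \<Longrightarrow> a \<le> 1 \<Longrightarrow> 0 \<le> G a \<and> G a \<le> 1"
    and G_lipschitz: "0 \<le> a \<Longrightarrow> a \<le> 1 \<Longrightarrow> 0 \<le> b \<Longrightarrow> b \<le> 1 \<Longrightarrow> \<bar>G a - G b\<bar> \<le> 2 * \<bar>a - b\<bar>"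
    and restart: "0 \<le> h \<Longrightarrow> h \<le> t \<Longrightarrow>
      u t x = (\<integral>p. (if h < fst p then u (t - h) (x + sqrt h * snd p)
        else G (u (t - fst p) (x + sqrt (fst p) * snd p))) \<partial>clock_noise)"
begin

text \<open>Comparison is proved only as a bound from above. Applied to the complement, it bounds
  the front from above; applied to the solution itself, it bounds the front from below.\<close>

lemma complement: "mild_solution (\<lambda>a. 1 - G (1 - a)) (\<lambda>t x. 1 - u t x)"
proof
  show "case_prod (\<lambda>t x. 1 - u t x) \<in> borel_measurable (borel \<Otimes>\<^sub>M borel)"
    by measurable
  show "continuous_on ({0..} \<times> UNIV) (case_prod (\<lambda>t x. 1 - u t x))"
    using u_continuous by (auto simp: case_prod_beta intro!: continuous_intros)
  fix h t x :: real assume h: "0 \<le> h" "h \<le> t"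
  let ?F = "\<lambda>p. if h < fst p then u (t - h) (x + sqrt h * snd p)
        else G (u (t - fst p) (x + sqrt (fst p) * snd p))"
  have "integrable clock_noise ?F"
    by (rule integrable_clock_noise[of _ 1]) (auto simp: u_nonneg u_le1 G_range)
  then have "1 - u t x = (\<integral>p. 1 - ?F p \<partial>clock_noise)"
    using restart[OF h, of x] expo_gauss.prob_space by simp
  also have "\<dots> = (\<integral>p. (if h < fst p then 1 - u (t - h) (x + sqrt h * snd p)
        else 1 - G (1 - (1 - u (t - fst p) (x + sqrt (fst p) * snd p)))) \<partial>clock_noise)"
    by (intro Bochner_Integration.integral_cong) auto
  finally show "1 - u t x = \<dots>" .
next
  fix a b :: real assume "0 \<le> a" "a \<le> 1" "0 \<le> b" "b \<le> 1"
  then show "\<bar>1 - G (1 - a) - (1 - G (1 - b))\<bar> \<le> 2 * \<bar>a - b\<bar>"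
    using G_lipschitz[of "1 - a" "1 - b"] by (simp add: abs_minus_commute)
next
  show "(\<lambda>a. 1 - G (1 - a)) \<in> borel_measurable borel" by measurable
qed (use G_range in \<open>simp_all add: u_nonneg u_le1\<close>)

lemma shift:
  assumes "0 \<le> s"
  shows "mild_solution G (\<lambda>t x. u (s + t) (y + x))"
proof
  have "continuous_on ({0..} \<times> UNIV) (\<lambda>p. case_prod u (s + fst p, y + snd p))"
    using assms by (intro continuous_on_compose2[OF u_continuous]) (auto intro!: continuous_intros)
  then show "continuous_on ({0..} \<times> UNIV) (case_prod (\<lambda>t x. u (s + t) (y + x)))"
    by (simp add: case_prod_beta)
next
  fix h t x :: real assume "0 \<le> h" "h \<le> t"
  then show "u (s + t) (y + x) = (\<integral>p. (if h < fst p then u (s + (t - h)) (y + (x + sqrt h * snd p))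
        else G (u (s + (t - fst p)) (y + (x + sqrt (fst p) * snd p)))) \<partial>clock_noise)"
    using restart[of h "s + t" "y + x"] assms by (simp add: add.assoc add_diff_eq cong: if_cong)
next
  show "case_prod (\<lambda>t x. u (s + t) (y + x)) \<in> borel_measurable (borel \<Otimes>\<^sub>M borel)"
    by measurable
qed (use G_range G_lipschitz in \<open>simp_all add: u_nonneg u_le1\<close>)

end

lemma (in initial_value) mild_solution_survival:
  assumes "\<And>x y. \<bar>g x - g y\<bar> \<le> L * \<bar>x - y\<bar>" "0 \<le> L"
  shows "mild_solution (\<lambda>a. a\<^sup>2) (survival g)"
proof
  fix a b :: real assume "0 \<le> a" "a \<le> 1" "0 \<le> b" "b \<le> 1"
  then have "\<bar>a\<^sup>2 - b\<^sup>2\<bar> = (a + b) * \<bar>a - b\<bar>"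
    by (simp add: power2_eq_square square_diff_square_factored abs_mult)
  also have "\<dots> \<le> 2 * \<bar>a - b\<bar>" using \<open>a \<le> 1\<close> \<open>b \<le> 1\<close> by (intro mult_right_mono) auto
  finally show "\<bar>a\<^sup>2 - b\<^sup>2\<bar> \<le> 2 * \<bar>a - b\<bar>" .
qed (use survival_continuous[OF assms] survival_restart in
    \<open>simp_all add: survival_bounds power_le_one\<close>)

section \<open>Touching paraboloids and the comparison principle\<close>

lemma integral_clock_split:
  assumes A: "integrable gauss A" and B: "integrable gauss B" and h: "0 \<le> h"
  shows "integrable clock_noise (\<lambda>p. if h < fst p then A (snd p) else B (snd p))" (is "integrable _ ?F")
    and "(\<integral>p. (if h < fst p then A (snd p) else B (snd p)) \<partial>clock_noise)
      = exp (- h) * (\<integral>k. A k \<partial>gauss) + (1 - exp (- h)) * (\<integral>k. B k \<partial>gauss)"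
proof -
  have [measurable]: "A \<in> borel_measurable borel" "B \<in> borel_measurable borel"
    using A[THEN borel_measurable_integrable] B[THEN borel_measurable_integrable]
    by (simp_all cong: measurable_cong_sets)
  have "integrable clock_noise (\<lambda>p. \<bar>A (snd p)\<bar> + \<bar>B (snd p)\<bar>)"
    by (rule integral_noise(2)[of "\<lambda>k. \<bar>A k\<bar> + \<bar>B k\<bar>", THEN iffD2]) (use A B in auto)
  then show int: "integrable clock_noise ?F"
    by (rule Bochner_Integration.integrable_bound) auto
  let ?a = "\<integral>k. A k \<partial>gauss" and ?b = "\<integral>k. B k \<partial>gauss"
  have "(\<integral>p. ?F p \<partial>clock_noise) = (\<integral>\<tau>. (\<integral>k. ?F (\<tau>, k) \<partial>gauss) \<partial>expo)"
    using expo_gauss.integral_fst'[OF int] by simp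
  also have "\<dots> = (\<integral>\<tau>. indicator {h<..} \<tau> * ?a + indicator {..h} \<tau> * ?b \<partial>expo)"
    by (intro Bochner_Integration.integral_cong refl) (simp add: not_less indicator_def)
  also have "\<dots> = exp (- h) * ?a + (1 - exp (- h)) * ?b"
    using expo_measure[OF h] by (simp add: expo.emeasure_eq_measure)
  finally show "(\<integral>p. ?F p \<partial>clock_noise) = exp (- h) * ?a + (1 - exp (- h)) * ?b" .
qed

text \<open>Turns local bounds into global ones: away from the origin every lower power is absorbed
  by k^4, whose mean is negligible for short times.\<close>

lemma abs_powers_le_fourth:
  fixes k r :: real
  assumes "0 < r" "r \<le> \<bar>k\<bar>"
  shows "1 \<le> k^4 / r^4" "\<bar>k\<bar> \<le> k^4 / r^3" "k\<^sup>2 \<le> k^4 / r\<^sup>2" "1 \<le> k\<^sup>2 / r\<^sup>2"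
proof -
  have *: "r ^ n \<le> \<bar>k\<bar> ^ n" for n using assms by (intro power_mono) auto
  have 4: "k ^ 4 = \<bar>k\<bar> ^ 4" by simp
  show "1 \<le> k^4 / r^4" using *[of 4] assms by (simp add: divide_simps)
  have "\<bar>k\<bar> * r^3 \<le> \<bar>k\<bar> * \<bar>k\<bar>^3" using *[of 3] by (intro mult_left_mono) auto
  then show "\<bar>k\<bar> \<le> k^4 / r^3"
    using assms unfolding 4 by (simp add: divide_simps power_Suc[symmetric] del: power_abs power_Suc)
  have "\<bar>k\<bar>^2 * r^2 \<le> \<bar>k\<bar>^2 * \<bar>k\<bar>^2" using *[of 2] by (intro mult_left_mono) auto
  then show "k\<^sup>2 \<le> k^4 / r\<^sup>2"
    using assms by (simp add: divide_simps power_add[symmetric])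
  show "1 \<le> k\<^sup>2 / r\<^sup>2" using *[of 2] assms by (simp add: divide_simps)
qed

text \<open>
  In other words, \<open>u\<close> is a viscosity subsolution. The paraboloid is inserted into the integral
  equation with \<open>h\<close> tending to 0, so no regularity of \<open>u\<close> beyond continuity is needed.
\<close>

lemma (in mild_solution) touching:
  assumes t: "0 < t"
    and below: "\<And>e. 0 < e \<Longrightarrow> \<exists>r>0. \<forall>h k. 0 < h \<longrightarrow> h \<le> r \<longrightarrow> \<bar>k\<bar> \<le> r \<longrightarrow>
      u (t - h) (x + k) \<le> u t x - a * h + b * k + c / 2 * k\<^sup>2 + e * (h + k\<^sup>2)"
  shows "a \<le> c / 2 - u t x + G (u t x)"
proof (rule ccontr)
  assume neg: "\<not> ?thesis"
  define \<phi> where "\<phi> = u t x"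
  \<comment> \<open>A quarter of the violation: the expansion spends three copies of
    \<open>e\<close> and must keep slope - e.\<close>
  define e where "e = (a - (c / 2 - \<phi> + G \<phi>)) / 4"
  have e: "0 < e" using neg by (simp add: e_def \<phi>_def)
  obtain r1 where r1: "0 < r1" "\<And>h k. 0 < h \<Longrightarrow> h \<le> r1 \<Longrightarrow> \<bar>k\<bar> \<le> r1 \<Longrightarrow>
      u (t - h) (x + k) \<le> \<phi> - a * h + b * k + c / 2 * k\<^sup>2 + e * (h + k\<^sup>2)"
    using below[OF e] by (auto simp: \<phi>_def)
  have "\<exists>d>0. \<forall>q\<in>{0..} \<times> UNIV. dist q (t, x) < d \<longrightarrow> dist (case_prod u q) (case_prod u (t, x)) < e / 2"
    using u_continuous[unfolded continuous_on_iff, rule_format, of "(t, x)" "e / 2"] e t by auto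
  then obtain d where d: "0 < d"
    "\<And>s y. 0 \<le> s \<Longrightarrow> dist (s, y) (t, x) < d \<Longrightarrow> \<bar>u s y - \<phi>\<bar> < e / 2"
    by (auto simp: \<phi>_def dist_real_def)
  define r where "r = Min {r1, d / 4, t, 1}"
  have r: "0 < r" "r \<le> r1" "r \<le> d / 4" "r \<le> t" "r \<le> 1"
    using r1 d t by (auto simp: r_def)
  \<comment> \<open>Continuity of u controls small k; for large k the trivial bound 1 is paid for by
    k^2 / r^2.\<close>
  have G_near: "G (u (t - h) (x + k)) \<le> G \<phi> + e + k\<^sup>2 / r\<^sup>2" if "0 \<le> h" "h \<le> r" for h k
  proof (cases "\<bar>k\<bar> \<le> r")
    case True
    have "dist (t - h, x + k) (t, x) \<le> \<bar>h\<bar> + \<bar>k\<bar>"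
      using sqrt_sum_squares_le_sum_abs[of h k] by (simp add: dist_Pair_Pair dist_real_def)
    also have "\<dots> < d" using True that r d by auto
    finally have "\<bar>u (t - h) (x + k) - \<phi>\<bar> < e / 2" using that r by (intro d) auto
    moreover have "\<bar>G (u (t - h) (x + k)) - G \<phi>\<bar> \<le> 2 * \<bar>u (t - h) (x + k) - \<phi>\<bar>"
      by (rule G_lipschitz) (auto simp: \<phi>_def u_nonneg u_le1)
    ultimately have "G (u (t - h) (x + k)) - G \<phi> \<le> e"
      by (simp add: abs_le_iff abs_less_iff)
    then show ?thesis by (simp add: add_increasing2)
  next
    case False
    then have "1 \<le> k\<^sup>2 / r\<^sup>2" using abs_powers_le_fourth[of r k] r by auto
    moreover have "G (u (t - h) (x + k)) \<le> 1" "0 \<le> G \<phi>"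
      using G_range by (auto simp: \<phi>_def u_nonneg u_le1)
    ultimately show ?thesis using e by linarith
  qed
  \<comment> \<open>Large enough that for |k| > r the quartic term alone outweighs the paraboloid
    and the trivial bound u \<le> 1.\<close>
  define C where "C = (1 + \<bar>a\<bar>) / r^4 + \<bar>b\<bar> / r^3 + \<bar>c\<bar> / r\<^sup>2"
  have C0: "0 \<le> C" using r by (simp add: C_def)
  have u_near: "u (t - h) (x + k) \<le> \<phi> - a * h + e * h + b * k + (c / 2 + e) * k\<^sup>2 + C * k^4"
    if h: "0 < h" "h \<le> r" for h k
  proof (cases "\<bar>k\<bar> \<le> r")
    case True
    then have "u (t - h) (x + k) \<le> \<phi> - a * h + b * k + c / 2 * k\<^sup>2 + e * (h + k\<^sup>2)"
      using r1(2)[of h k] r h by auto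
    moreover have "0 \<le> C * k^4" using C0 by simp
    ultimately show ?thesis by (simp add: algebra_simps)
  next
    case False
    then have k: "1 \<le> k^4 / r^4" "\<bar>k\<bar> \<le> k^4 / r^3" "k\<^sup>2 \<le> k^4 / r\<^sup>2"
      using abs_powers_le_fourth[of r k] r by auto
    have "C * k^4 = (1 + \<bar>a\<bar>) * (k^4 / r^4) + \<bar>b\<bar> * (k^4 / r^3) + \<bar>c\<bar> * (k^4 / r\<^sup>2)"
      by (simp add: C_def algebra_simps)
    also have "\<dots> \<ge> (1 + \<bar>a\<bar>) * 1 + \<bar>b\<bar> * \<bar>k\<bar> + \<bar>c\<bar> * k\<^sup>2"
      using k by (intro add_mono mult_left_mono) auto
    finally have C: "1 + \<bar>a\<bar> + \<bar>b\<bar> * \<bar>k\<bar> + \<bar>c\<bar> * k\<^sup>2 \<le> C * k^4" by simp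
    have "\<bar>a * h\<bar> \<le> \<bar>a\<bar> * 1" using h r by (simp add: abs_mult mult_left_le)
    then have "a * h \<le> \<bar>a\<bar>" by linarith
    moreover have "- (b * k) \<le> \<bar>b\<bar> * \<bar>k\<bar>" using abs_ge_minus_self[of "b * k"] by (simp add: abs_mult)
    moreover have "- (c / 2 * k\<^sup>2) \<le> \<bar>c\<bar> * k\<^sup>2"
    proof -
      have "- (c / 2) * k\<^sup>2 \<le> \<bar>c\<bar> * k\<^sup>2" by (intro mult_right_mono) auto
      then show ?thesis by simp
    qed
    moreover have "0 \<le> e * h" "0 \<le> e * k\<^sup>2" using e h by auto
    moreover have "u (t - h) (x + k) \<le> 1" "0 \<le> \<phi>" by (auto simp: \<phi>_def u_nonneg u_le1)
    ultimately show ?thesis using C by (simp add: distrib_right)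
  qed
  \<comment> \<open>The integral of the global bounds minus u at the touching point. The integral
    equation makes it nonnegative for small h > 0, but it vanishes at 0 with derivative - e.\<close>
  define f where "f h = exp (- h) * (\<phi> - a * h + e * h + (c / 2 + e) * h + 3 * C * h\<^sup>2)
      + (1 - exp (- h)) * (G \<phi> + e + h / r\<^sup>2) - \<phi>" for h
  have f_nonneg: "0 \<le> f h" if h: "0 < h" "h \<le> r" for h
  proof -
    let ?A = "\<lambda>k. \<phi> - a * h + e * h + b * sqrt h * k + (c / 2 + e) * h * k\<^sup>2 + C * h\<^sup>2 * k^4"
    let ?B = "\<lambda>k. G \<phi> + e + h / r\<^sup>2 * k\<^sup>2"
    have sq: "(sqrt h)^2 = h" "(sqrt h)^4 = h\<^sup>2"
      using h by (auto simp: power4_eq_xxxx power2_eq_square)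
    have A: "integrable gauss ?A"
        "(\<integral>k. ?A k \<partial>gauss) = \<phi> - a * h + e * h + (c / 2 + e) * h + C * h\<^sup>2 * 3"
      using gauss_moments by simp_all
    have B: "integrable gauss ?B" "(\<integral>k. ?B k \<partial>gauss) = G \<phi> + e + h / r\<^sup>2"
      using gauss_moments by simp_all
    let ?F = "\<lambda>p. if h < fst p then u (t - h) (x + sqrt h * snd p)
        else G (u (t - fst p) (x + sqrt (fst p) * snd p))"
    have int: "integrable clock_noise ?F"
      by (rule integrable_clock_noise[of _ 1]) (auto simp: u_nonneg u_le1 G_range)
    have "?F p \<le> (if h < fst p then ?A (snd p) else ?B (snd p))" if "0 < fst p" for p
    proof (cases "h < fst p")
      case True
      then show ?thesis
        using u_near[of h "sqrt h * snd p"] h by (simp add: power_mult_distrib sq mult_ac)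
    next
      case False
      have "fst p * (snd p)\<^sup>2 / r\<^sup>2 \<le> h * (snd p)\<^sup>2 / r\<^sup>2"
        using False by (intro divide_right_mono mult_right_mono) auto
      then show ?thesis
        using G_near[of "fst p" "sqrt (fst p) * snd p"] h that False by (simp add: power_mult_distrib)
    qed
    then have "AE p in clock_noise. ?F p \<le> (if h < fst p then ?A (snd p) else ?B (snd p))"
      using AE_clock_noise_pos by (rule eventually_mono[rotated])
    then have "(\<integral>p. ?F p \<partial>clock_noise) \<le> (\<integral>p. (if h < fst p then ?A (snd p) else ?B (snd p)) \<partial>clock_noise)"
      using int integral_clock_split(1)[OF A(1) B(1), of h] h by (intro integral_mono_AE) auto
    also have "\<dots> = f h + \<phi>"
      using h by (subst integral_clock_split(2)[OF A(1) B(1)]) (simp_all only: A B f_def, simp_all)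
    finally show ?thesis
      using restart[of h t x] h r by (simp add: \<phi>_def)
  qed
  have "(f has_real_derivative - a + e + c / 2 + e - \<phi> + (G \<phi> + e)) (at 0)"
    unfolding f_def using r by (auto intro!: derivative_eq_intros)
  moreover have "- a + e + c / 2 + e - \<phi> + (G \<phi> + e) = - e"
    by (simp add: e_def field_simps)
  ultimately have "(f has_real_derivative - e) (at 0)"
    by (rule DERIV_cong)
  from DERIV_neg_dec_right[OF this] e
  obtain d' where "0 < d'" "\<And>h. 0 < h \<Longrightarrow> h < d' \<Longrightarrow> f (0 + h) < f 0"
    by auto
  moreover have "f 0 = 0" by (simp add: f_def)
  ultimately have "f (min r (d' / 2)) < 0" using r by auto
  moreover have "0 \<le> f (min r (d' / 2))" using r \<open>0 < d'\<close> by (intro f_nonneg) auto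
  ultimately show False by simp
qed

text \<open>Supplies the hypothesis of \<open>touching\<close> for smooth functions. The increment
  is split into a time step at the fixed place x + k and a space step at the fixed time t, so no
  mixed derivative appears.\<close>

lemma second_order_taylor_le:
  fixes v vt vx vxx :: "real \<Rightarrow> real \<Rightarrow> real"
  assumes t: "0 < t" and e: "0 < e"
    and dt: "\<And>s y. 0 < s \<Longrightarrow> ((\<lambda>s. v s y) has_real_derivative vt s y) (at s)"
    and dx: "\<And>s y. 0 < s \<Longrightarrow> (v s has_real_derivative vx s y) (at y)"
    and dxx: "\<And>s y. 0 < s \<Longrightarrow> (vx s has_real_derivative vxx s y) (at y)"
    and ct: "continuous_on ({0<..} \<times> UNIV) (case_prod vt)"
    and cxx: "continuous_on UNIV (vxx t)"
  shows "\<exists>r>0. \<forall>h k. 0 < h \<longrightarrow> h \<le> r \<longrightarrow> \<bar>k\<bar> \<le> r \<longrightarrow>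
    v (t - h) (x + k) \<le> v t x - vt t x * h + vx t x * k + vxx t x / 2 * k\<^sup>2 + e * (h + k\<^sup>2)"
proof -
  obtain d1 where d1: "0 < d1"
    "\<And>s y. 0 < s \<Longrightarrow> dist (s, y) (t, x) < d1 \<Longrightarrow> dist (vt s y) (vt t x) < e"
    using ct[unfolded continuous_on_iff, rule_format, of "(t, x)" e] e t by auto
  obtain d2 where d2: "0 < d2" "\<And>y. dist y x < d2 \<Longrightarrow> dist (vxx t y) (vxx t x) < e"
    using cxx[unfolded continuous_on_iff, rule_format, of x e] e by auto
  define r where "r = Min {d1 / 4, d2 / 2, t / 2}"
  have r: "0 < r" "r \<le> d1 / 4" "r \<le> d2 / 2" "r \<le> t / 2"
    using d1 d2 t by (auto simp: r_def)
  have "v (t - h) (x + k) \<le> v t x - vt t x * h + vx t x * k + vxx t x / 2 * k\<^sup>2 + e * (h + k\<^sup>2)"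
    if h: "0 < h" "h \<le> r" and k: "\<bar>k\<bar> \<le> r" for h k
  proof -
    obtain s where s: "t - h < s" "s < t" "v t (x + k) - v (t - h) (x + k) = h * vt s (x + k)"
      using MVT2[of "t - h" t "\<lambda>s. v s (x + k)" "\<lambda>s. vt s (x + k)"] dt h r t by auto
    have "dist (s, x + k) (t, x) \<le> \<bar>s - t\<bar> + \<bar>k\<bar>"
      using sqrt_sum_squares_le_sum_abs[of "s - t" k] by (simp add: dist_Pair_Pair dist_real_def)
    also have "\<dots> < d1" using s h k r d1 by auto
    finally have "dist (vt s (x + k)) (vt t x) < e" using s h r t by (intro d1) auto
    then have "vt t x - e \<le> vt s (x + k)" by (simp add: dist_real_def abs_less_iff)
    then have 1: "v (t - h) (x + k) \<le> v t (x + k) - h * (vt t x - e)"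
      using s h by (smt (verit) mult_left_mono)
    have "\<exists>z. \<bar>z - x\<bar> \<le> \<bar>k\<bar> \<and> v t (x + k) = v t x + vx t x * k + vxx t z / 2 * k\<^sup>2"
    proof (cases "k = 0")
      case False
      let ?diff = "\<lambda>m::nat. if m = 0 then v t else if m = 1 then vx t else vxx t"
      have "\<exists>z. (if x + k < x then x + k < z \<and> z < x else x < z \<and> z < x + k) \<and>
          v t (x + k) = (\<Sum>m<2. ?diff m x / fact m * (x + k - x) ^ m) + ?diff 2 z / fact 2 * (x + k - x)\<^sup>2"
        by (rule Taylor[where a = "x - \<bar>k\<bar>" and b = "x + \<bar>k\<bar>"])
          (use False dx dxx t in \<open>auto simp: less_Suc_eq numeral_2_eq_2\<close>)
      then obtain z where z: "if x + k < x then x + k < z \<and> z < x else x < z \<and> z < x + k"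
          "v t (x + k) = (\<Sum>m<2. ?diff m x / fact m * (x + k - x) ^ m) + ?diff 2 z / fact 2 * (x + k - x)\<^sup>2"
        by blast
      have "\<bar>z - x\<bar> \<le> \<bar>k\<bar>" using z(1) by (simp split: if_splits)
      moreover have "v t (x + k) = v t x + vx t x * k + vxx t z / 2 * k\<^sup>2"
        using z(2) by (simp add: lessThan_Suc numeral_2_eq_2)
      ultimately show ?thesis by blast
    qed auto
    then obtain z where z: "\<bar>z - x\<bar> \<le> \<bar>k\<bar>" "v t (x + k) = v t x + vx t x * k + vxx t z / 2 * k\<^sup>2"
      by auto
    have "dist (vxx t z) (vxx t x) < e"
      using z k r d2 by (intro d2) (auto simp: dist_real_def)
    then have "vxx t z / 2 \<le> vxx t x / 2 + e" using e by (simp add: dist_real_def abs_less_iff)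
    then have "vxx t z / 2 * k\<^sup>2 \<le> (vxx t x / 2 + e) * k\<^sup>2" by (rule mult_right_mono) simp
    then show ?thesis using 1 z(2) by (simp add: algebra_simps)
  qed
  with r(1) show ?thesis by blast
qed

text \<open>
  The hypothesis \<open>interior\<close> says that \<open>v \<ge> 1 \<ge> u\<close> on the lateral boundary of \<open>D\<close>. The proof looks at the
  first time at which \<open>u\<close> touches the strict supersolution \<open>v + e * exp (3 * t) * (1 + x\<^sup>2)\<close>.
\<close>

theorem (in mild_solution) comparison:
  fixes v vt vx vxx :: "real \<Rightarrow> real \<Rightarrow> real"
  assumes D: "closed D"
    and v_cont: "continuous_on ({0..} \<times> UNIV) (case_prod v)"
    and dt: "\<And>t x. 0 < t \<Longrightarrow> ((\<lambda>t. v t x) has_real_derivative vt t x) (at t)"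
    and dx: "\<And>t x. 0 < t \<Longrightarrow> (v t has_real_derivative vx t x) (at x)"
    and dxx: "\<And>t x. 0 < t \<Longrightarrow> (vx t has_real_derivative vxx t x) (at x)"
    and ct: "continuous_on ({0<..} \<times> UNIV) (case_prod vt)"
    and cxx: "\<And>t. 0 < t \<Longrightarrow> continuous_on UNIV (vxx t)"
    and v_nonneg: "\<And>t x. (t, x) \<in> D \<Longrightarrow> 0 \<le> t \<Longrightarrow> t \<le> \<tau> \<Longrightarrow> 0 \<le> v t x"
    and initial: "\<And>x. (0, x) \<in> D \<Longrightarrow> u 0 x \<le> v 0 x"
    and interior: "\<And>t x. (t, x) \<in> D \<Longrightarrow> 0 < t \<Longrightarrow> t \<le> \<tau> \<Longrightarrow> v t x < 1 \<Longrightarrow> (t, x) \<in> interior D"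
    and super: "\<And>t x. (t, x) \<in> D \<Longrightarrow> 0 < t \<Longrightarrow> t \<le> \<tau> \<Longrightarrow> v t x < 1 \<Longrightarrow>
      vxx t x / 2 - v t x + G (v t x) \<le> vt t x"
    and "(t, x) \<in> D" "0 \<le> t" "t \<le> \<tau>"
  shows "u t x \<le> v t x"
proof (rule ccontr)
  assume "\<not> u t x \<le> v t x"
  \<comment> \<open>Chosen so that the perturbed function \<open>w\<close> equals u exactly at the
    assumed violation, which puts that point into \<open>K\<close>.\<close>
  define e where "e = (u t x - v t x) / (exp (3 * t) * (1 + x\<^sup>2))"
  have e: "0 < e"
    using \<open>\<not> u t x \<le> v t x\<close> by (auto simp: e_def intro!: divide_pos_pos mult_pos_pos add_pos_nonneg)
  \<comment> \<open>The growth rate 3 must beat 2 from the Lipschitz constant of G, minus 1 from the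
    decay term, plus 1 from half the second derivative of 1 + x^2. The quadratic growth makes the
    contact set bounded.\<close>
  define w where "w t x = v t x + e * exp (3 * t) * (1 + x\<^sup>2)" for t x
  define K where "K = {p \<in> D \<inter> {0..\<tau>} \<times> UNIV. case_prod w p \<le> case_prod u p}"
  have E_pos: "0 < e * exp (3 * t) * (1 + x\<^sup>2)" for t x
    using e by (intro mult_pos_pos add_pos_nonneg) auto
  have cont: "continuous_on (D \<inter> {0..\<tau>} \<times> UNIV) (case_prod w)" "continuous_on (D \<inter> {0..\<tau>} \<times> UNIV) (case_prod u)"
    by (auto simp: w_def case_prod_beta intro!: continuous_intros
        intro: continuous_on_subset[OF v_cont[unfolded case_prod_beta]] continuous_on_subset[OF u_continuous[unfolded case_prod_beta]])
  have "closed K"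
    unfolding K_def using D
    by (intro continuous_on_closed_Collect_le cont) (auto intro!: closed_Int closed_Times)
  moreover have "K \<subseteq> {0..\<tau>} \<times> {- (1 + 1 / e)..1 + 1 / e}"
  proof
    fix p assume "p \<in> K"
    then obtain s y where p: "p = (s, y)" "(s, y) \<in> D" "0 \<le> s" "s \<le> \<tau>" "w s y \<le> u s y"
      by (auto simp: K_def)
    have "e * (1 * \<bar>y\<bar>) \<le> e * (exp (3 * s) * (1 + y\<^sup>2))"
      using e p sum_squares_ge_zero[of "\<bar>y\<bar> - 1" 0]
      by (intro mult_left_mono mult_mono) (auto simp: power2_eq_square algebra_simps)
    also have "\<dots> \<le> w s y" using v_nonneg[of s y] p by (simp add: w_def mult.assoc)
    also have "\<dots> \<le> 1" using p u_le1[of s y] by linarith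
    finally have "\<bar>y\<bar> \<le> 1 / e" using e by (simp add: field_simps)
    then show "p \<in> {0..\<tau>} \<times> {- (1 + 1 / e)..1 + 1 / e}" using p by (auto simp: abs_le_iff)
  qed
  then have "bounded K" by (rule bounded_subset[rotated]) (simp add: bounded_Times)
  ultimately have "compact K" by (simp add: compact_eq_bounded_closed)
  moreover have "(t, x) \<in> K"
    using assms(12-) e by (auto simp: K_def w_def e_def)
  moreover have "continuous_on K fst" by (intro continuous_intros)
  ultimately obtain p where p: "p \<in> K" "\<And>q. q \<in> K \<Longrightarrow> fst p \<le> fst q"
    using continuous_attains_inf[of K fst] by (metis empty_iff)
  obtain t0 x0 where p0: "p = (t0, x0)" by fastforce
  have t0: "(t0, x0) \<in> D" "0 \<le> t0" "t0 \<le> \<tau>" "w t0 x0 \<le> u t0 x0"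
    using p(1) by (auto simp: p0 K_def)
  have first: "u s y < w s y" if "(s, y) \<in> D" "0 \<le> s" "s < t0" for s y
    using p(2)[of "(s, y)"] that t0 by (auto simp: K_def p0 simp flip: not_le)
  have "t0 \<noteq> 0" using initial[of x0] t0 E_pos[of t0 x0] by (auto simp: w_def)
  then have t0_pos: "0 < t0" using t0 by simp
  \<comment> \<open>Contact with u \<le> 1 forces v < 1, which rules out the lateral boundary and
    makes the differential inequality available.\<close>
  have v_lt: "v t0 x0 < 1"
    using t0 E_pos[of t0 x0] u_le1[of t0 x0] unfolding w_def by linarith
  then have "(t0, x0) \<in> interior D" using interior t0 t0_pos by auto
  then obtain d where d: "0 < d" "ball (t0, x0) d \<subseteq> D"
    using mem_interior by blast
  have near: "(t0 - h, x0 + k) \<in> D" if "\<bar>h\<bar> \<le> d / 4" "\<bar>k\<bar> \<le> d / 4" for h k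
  proof -
    have "dist (t0, x0) (t0 - h, x0 + k) \<le> \<bar>h\<bar> + \<bar>k\<bar>"
      using sqrt_sum_squares_le_sum_abs[of h k] by (simp add: dist_Pair_Pair dist_real_def)
    then show ?thesis using that d by (intro subsetD[OF d(2)]) auto
  qed
  \<comment> \<open>By minimality u < w at all earlier times, so continuity excludes a strict
    overshoot at the first contact.\<close>
  have eq: "u t0 x0 = w t0 x0"
  proof (rule antisym[OF _ t0(4)])
    have "((\<lambda>s. case_prod u (s, x0)) \<longlongrightarrow> case_prod u (t0, x0)) (at_left t0)"
    proof -
      have "continuous_on {0<..} (\<lambda>s. case_prod u (s, x0))"
        by (rule continuous_on_compose2[OF u_continuous]) (auto intro!: continuous_intros)
      then have "isCont (\<lambda>s. case_prod u (s, x0)) t0"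
        using t0_pos by (simp add: continuous_on_eq_continuous_at)
      then show ?thesis by (auto simp: isCont_def intro: filterlim_mono at_le)
    qed
    moreover have "((\<lambda>s. w s x0) \<longlongrightarrow> w t0 x0) (at_left t0)"
    proof -
      have "isCont (\<lambda>s. w s x0) t0"
        unfolding w_def using DERIV_isCont[OF dt[OF t0_pos]] by (intro continuous_intros) auto
      then show ?thesis by (auto simp: isCont_def intro: filterlim_mono at_le)
    qed
    moreover have "\<forall>\<^sub>F s in at_left t0. case_prod u (s, x0) \<le> w s x0"
    proof -
      have "\<forall>\<^sub>F s in at_left t0. s \<in> {max 0 (t0 - d / 4)<..<t0}"
        using t0_pos d by (intro eventually_at_left_real) auto
      then show ?thesis
        by eventually_elim (use first near[of "t0 - s" 0 for s] d in \<open>auto intro!: less_imp_le\<close>)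
    qed
    ultimately show "u t0 x0 \<le> w t0 x0"
      using tendsto_le[of "at_left t0"] by auto
  qed
  define wt where "wt t x = vt t x + 3 * e * exp (3 * t) * (1 + x\<^sup>2)" for t x
  define wx where "wx t x = vx t x + e * exp (3 * t) * (2 * x)" for t x
  define wxx where "wxx t x = vxx t x + e * exp (3 * t) * 2" for t x
  have "wt t0 x0 \<le> wxx t0 x0 / 2 - u t0 x0 + G (u t0 x0)"
  proof (rule touching[OF t0_pos, where b = "wx t0 x0"])
    fix e' :: real assume "0 < e'"
    obtain r where r: "0 < r" "\<And>h k. 0 < h \<Longrightarrow> h \<le> r \<Longrightarrow> \<bar>k\<bar> \<le> r \<Longrightarrow>
        w (t0 - h) (x0 + k) \<le> w t0 x0 - wt t0 x0 * h + wx t0 x0 * k + wxx t0 x0 / 2 * k\<^sup>2 + e' * (h + k\<^sup>2)"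
    proof -
      have "((\<lambda>t. w t x) has_real_derivative wt t x) (at t)" if "0 < t" for t x
        unfolding w_def wt_def using dt[OF that] by (auto intro!: derivative_eq_intros)
      moreover have "(w t has_real_derivative wx t x) (at x)" if "0 < t" for t x
        unfolding w_def[abs_def] wx_def using dx[OF that] by (auto intro!: derivative_eq_intros)
      moreover have "(wx t has_real_derivative wxx t x) (at x)" if "0 < t" for t x
        unfolding wxx_def wx_def[abs_def] using dxx[OF that] by (auto intro!: derivative_eq_intros)
      moreover have "continuous_on ({0<..} \<times> UNIV) (case_prod wt)"
        using ct by (auto simp: wt_def case_prod_beta intro!: continuous_intros)
      moreover have "continuous_on UNIV (wxx t0)"
        unfolding wxx_def[abs_def] using cxx[OF t0_pos] by (auto intro!: continuous_intros)
      ultimately show ?thesis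
        using second_order_taylor_le[OF t0_pos \<open>0 < e'\<close>, of w wt wx wxx x0] that by blast
    qed
    define r' where "r' = Min {r, d / 4, t0}"
    have r': "0 < r'" "r' \<le> r" "r' \<le> d / 4" "r' \<le> t0"
      using r d t0_pos by (auto simp: r'_def)
    have "u (t0 - h) (x0 + k) \<le> u t0 x0 - wt t0 x0 * h + wx t0 x0 * k + wxx t0 x0 / 2 * k\<^sup>2 + e' * (h + k\<^sup>2)"
      if "0 < h" "h \<le> r'" "\<bar>k\<bar> \<le> r'" for h k
      using r(2)[of h k] first[of "t0 - h" "x0 + k"] near[of h k] that r' eq by auto
    with r' show "\<exists>r>0. \<forall>h k. 0 < h \<longrightarrow> h \<le> r \<longrightarrow> \<bar>k\<bar> \<le> r \<longrightarrow> u (t0 - h) (x0 + k)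
        \<le> u t0 x0 - wt t0 x0 * h + wx t0 x0 * k + wxx t0 x0 / 2 * k\<^sup>2 + e' * (h + k\<^sup>2)"
      by blast
  qed
  moreover have "vxx t0 x0 / 2 - v t0 x0 + G (v t0 x0) \<le> vt t0 x0"
    using super t0 t0_pos v_lt by auto
  moreover have "G (w t0 x0) \<le> G (v t0 x0) + 2 * (w t0 x0 - v t0 x0)"
  proof -
    have "v t0 x0 \<le> w t0 x0" using E_pos[of t0 x0] by (simp add: w_def)
    moreover have "0 \<le> v t0 x0" using v_nonneg t0 by auto
    ultimately show ?thesis
      using G_lipschitz[of "w t0 x0" "v t0 x0"] eq u_le1[of t0 x0] v_lt by (auto simp: abs_le_iff)
  qed
  moreover have "e * exp (3 * t0) * (1 + x0\<^sup>2) \<ge> e * exp (3 * t0) * 1"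
    using e by (intro mult_left_mono) auto
  moreover have "0 < e * exp (3 * t0)" using e by simp
  ultimately show False
    unfolding eq wt_def wxx_def unfolding w_def by argo
qed

section \<open>Upper bound for the front\<close>

text \<open>
  Barriers in the frame \<open>y = x - \<mu> * t - c\<close>. The amplitude is chosen such that for \<open>F s y = y\<close> the
  barrier is the exponentially tilted heat dipole, which solves the linearised equation exactly.
\<close>

locale gaussian_barrier =
  fixes F Fs F1 F2 :: "real \<Rightarrow> real \<Rightarrow> real" and \<mu> c s0 C :: real
  assumes s0: "0 < s0"
    and F_chain: "\<And>t x. 0 < t \<Longrightarrow> ((\<lambda>t. F (t + s0) (x - \<mu> * t - c)) has_real_derivative
      Fs (t + s0) (x - \<mu> * t - c) - \<mu> * F1 (t + s0) (x - \<mu> * t - c)) (at t)"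
    and F_deriv: "\<And>s y. 0 < s \<Longrightarrow> (F s has_real_derivative F1 s y) (at y)"
    and F1_deriv: "\<And>s y. 0 < s \<Longrightarrow> (F1 s has_real_derivative F2 s y) (at y)"
    and F_cont: "continuous_on ({0<..} \<times> UNIV) (case_prod F)"
    and Fs_cont: "continuous_on ({0<..} \<times> UNIV) (case_prod Fs)"
    and F1_cont: "continuous_on ({0<..} \<times> UNIV) (case_prod F1)"
    and F2_cont: "\<And>s. 0 < s \<Longrightarrow> continuous_on UNIV (F2 s)"
begin

text \<open>The tilt for speed \<open>\<mu>\<close> with unit growth, times the heat dipole without
  its linear factor. The offset \<open>s0\<close> moves the singularity of the dipole to negative
  times.\<close>

definition amplitude :: "real \<Rightarrow> real \<Rightarrow> real" where
  "amplitude t x = exp (C + (1 - \<mu>\<^sup>2 / 2) * t - \<mu> * (x - \<mu> * t - c)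
     - 3 / 2 * ln (t + s0) - (x - \<mu> * t - c)\<^sup>2 / (2 * (t + s0)))"

definition barrier :: "real \<Rightarrow> real \<Rightarrow> real" where
  "barrier t x = amplitude t x * F (t + s0) (x - \<mu> * t - c)"

definition barrier_t :: "real \<Rightarrow> real \<Rightarrow> real" where
  "barrier_t t x = (let s = t + s0; y = x - \<mu> * t - c in amplitude t x *
     (Fs s y - \<mu> * F1 s y + F s y * (1 + \<mu>\<^sup>2 / 2 - 3 / (2 * s) + \<mu> * y / s + y\<^sup>2 / (2 * s\<^sup>2))))"

definition barrier_x :: "real \<Rightarrow> real \<Rightarrow> real" where
  "barrier_x t x = (let s = t + s0; y = x - \<mu> * t - c in amplitude t x *
     (F1 s y - (\<mu> + y / s) * F s y))"

definition barrier_xx :: "real \<Rightarrow> real \<Rightarrow> real" where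
  "barrier_xx t x = (let s = t + s0; y = x - \<mu> * t - c in amplitude t x *
     (F2 s y - 2 * (\<mu> + y / s) * F1 s y + ((\<mu> + y / s)\<^sup>2 - 1 / s) * F s y))"

lemma amplitude_pos: "0 < amplitude t x"
  by (simp add: amplitude_def)

lemma barrier_deriv_t:
  assumes "0 < t"
  shows "((\<lambda>t. barrier t x) has_real_derivative barrier_t t x) (at t)"
proof -
  have s: "0 < t + s0" using assms s0 by simp
  have "((\<lambda>t. amplitude t x) has_real_derivative amplitude t x *
    (1 + \<mu>\<^sup>2 / 2 - 3 / (2 * (t + s0)) + \<mu> * (x - \<mu> * t - c) / (t + s0) + (x - \<mu> * t - c)\<^sup>2 / (2 * (t + s0)\<^sup>2))) (at t)"
  proof -
    let ?\<Theta> = "\<lambda>t. C + (1 - \<mu>\<^sup>2 / 2) * t - \<mu> * (x - \<mu> * t - c)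
      - 3 / 2 * ln (t + s0) - (x - \<mu> * t - c)\<^sup>2 / (2 * (t + s0))"
    let ?D = "1 + \<mu>\<^sup>2 / 2 - 3 / (2 * (t + s0)) + \<mu> * (x - \<mu> * t - c) / (t + s0)
      + (x - \<mu> * t - c)\<^sup>2 / (2 * (t + s0)\<^sup>2)"
    have q: "((\<lambda>t. (x - \<mu> * t - c)\<^sup>2 / (2 * (t + s0))) has_real_derivative
        - (\<mu> * (x - \<mu> * t - c) / (t + s0)) - (x - \<mu> * t - c)\<^sup>2 / (2 * (t + s0)\<^sup>2)) (at t)"
      using s by (auto intro!: derivative_eq_intros simp: divide_simps) (simp add: algebra_simps power2_eq_square)
    have "((\<lambda>t. C + (1 - \<mu>\<^sup>2 / 2) * t - \<mu> * (x - \<mu> * t - c) - 3 / 2 * ln (t + s0))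
        has_real_derivative 1 + \<mu>\<^sup>2 / 2 - 3 / (2 * (t + s0))) (at t)"
      using s by (auto intro!: derivative_eq_intros simp: power2_eq_square) (simp add: divide_simps)
    from DERIV_diff[OF this q] have "(?\<Theta> has_real_derivative ?D) (at t)"
      by (rule DERIV_cong) simp
    from DERIV_chain2[OF DERIV_exp this] show ?thesis
      by (simp add: amplitude_def)
  qed
  from DERIV_mult[OF this F_chain[OF assms]] show ?thesis
    unfolding barrier_def barrier_t_def Let_def by (rule DERIV_cong) (simp add: algebra_simps)
qed

lemma amplitude_deriv_x:
  assumes "0 < t"
  shows "(amplitude t has_real_derivative amplitude t x * (- \<mu> - (x - \<mu> * t - c) / (t + s0))) (at x)"
proof -
  have s: "0 < t + s0" using assms s0 by simp
  let ?\<Theta> = "\<lambda>x. C + (1 - \<mu>\<^sup>2 / 2) * t - \<mu> * (x - \<mu> * t - c)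
      - 3 / 2 * ln (t + s0) - (x - \<mu> * t - c)\<^sup>2 / (2 * (t + s0))"
  have "(?\<Theta> has_real_derivative (- \<mu> - (x - \<mu> * t - c) / (t + s0))) (at x)"
    using s by (auto intro!: derivative_eq_intros) (simp add: divide_simps, simp add: algebra_simps)
  from DERIV_chain2[OF DERIV_exp this] show ?thesis
    by (simp add: amplitude_def[abs_def])
qed

lemma barrier_deriv_x:
  assumes "0 < t"
  shows "(barrier t has_real_derivative barrier_x t x) (at x)"
proof -
  have s: "0 < t + s0" using assms s0 by simp
  have "((\<lambda>x. F (t + s0) (x - \<mu> * t - c)) has_real_derivative F1 (t + s0) (x - \<mu> * t - c) * 1) (at x)"
    by (rule DERIV_chain2[OF F_deriv[OF s]]) (auto intro!: derivative_eq_intros)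
  from DERIV_mult[OF amplitude_deriv_x[OF assms] this] show ?thesis
    unfolding barrier_def[abs_def] barrier_x_def Let_def by (rule DERIV_cong) (simp add: algebra_simps)
qed

lemma barrier_deriv_xx:
  assumes "0 < t"
  shows "(barrier_x t has_real_derivative barrier_xx t x) (at x)"
proof -
  have s: "0 < t + s0" using assms s0 by simp
  have F: "((\<lambda>x. F (t + s0) (x - \<mu> * t - c)) has_real_derivative F1 (t + s0) (x - \<mu> * t - c) * 1) (at x)"
    by (rule DERIV_chain2[OF F_deriv[OF s]]) (auto intro!: derivative_eq_intros)
  have F1: "((\<lambda>x. F1 (t + s0) (x - \<mu> * t - c)) has_real_derivative F2 (t + s0) (x - \<mu> * t - c) * 1) (at x)"
    by (rule DERIV_chain2[OF F1_deriv[OF s]]) (auto intro!: derivative_eq_intros)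
  have "((\<lambda>x. \<mu> + (x - \<mu> * t - c) / (t + s0)) has_real_derivative 1 / (t + s0)) (at x)"
    using s by (auto intro!: derivative_eq_intros)
  from DERIV_mult[OF amplitude_deriv_x[OF assms] DERIV_diff[OF F1 DERIV_mult[OF this F]]]
  show ?thesis
    unfolding barrier_x_def[abs_def] barrier_xx_def Let_def
  proof (rule DERIV_cong)
    have "a * (- m - w) * (f1 - (m + w) * f0) + (f2 * 1 - (r * f0 + f1 * 1 * (m + w))) * a
        = a * (f2 - 2 * (m + w) * f1 + ((m + w)\<^sup>2 - r) * f0)" for a m w r f0 f1 f2 :: real
      by algebra
    then show "amplitude t x * (- \<mu> - (x - \<mu> * t - c) / (t + s0)) *
        (F1 (t + s0) (x - \<mu> * t - c) - (\<mu> + (x - \<mu> * t - c) / (t + s0)) * F (t + s0) (x - \<mu> * t - c)) +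
        (F2 (t + s0) (x - \<mu> * t - c) * 1 - (1 / (t + s0) * F (t + s0) (x - \<mu> * t - c) +
          F1 (t + s0) (x - \<mu> * t - c) * 1 * (\<mu> + (x - \<mu> * t - c) / (t + s0)))) * amplitude t x
      = amplitude t x * (F2 (t + s0) (x - \<mu> * t - c)
        - 2 * (\<mu> + (x - \<mu> * t - c) / (t + s0)) * F1 (t + s0) (x - \<mu> * t - c)
        + ((\<mu> + (x - \<mu> * t - c) / (t + s0))\<^sup>2 - 1 / (t + s0)) * F (t + s0) (x - \<mu> * t - c))" .
  qed
qed

lemma barrier_continuous:
  "continuous_on ({0..} \<times> UNIV) (case_prod barrier)"
  "continuous_on ({0<..} \<times> UNIV) (case_prod barrier_t)"
  "0 < t \<Longrightarrow> continuous_on UNIV (barrier_xx t)"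
proof -
  let ?h = "\<lambda>p. (fst p + s0, snd p - \<mu> * fst p - c)"
  have comp: "continuous_on ({0..} \<times> UNIV) (\<lambda>p. H (fst p + s0) (snd p - \<mu> * fst p - c))"
    if "continuous_on ({0<..} \<times> UNIV) (case_prod H)" for H :: "real \<Rightarrow> real \<Rightarrow> real"
  proof -
    have "continuous_on ({0..} \<times> UNIV) (\<lambda>p. case_prod H (?h p))"
      by (rule continuous_on_compose2[OF that]) (use s0 in \<open>auto intro!: continuous_intros\<close>)
    then show ?thesis by simp
  qed
  have amp: "continuous_on ({0..} \<times> UNIV) (\<lambda>p. amplitude (fst p) (snd p))"
    unfolding amplitude_def using s0 by (auto intro!: continuous_intros)
  show "continuous_on ({0..} \<times> UNIV) (case_prod barrier)"
    using amp comp[OF F_cont] by (auto simp: barrier_def case_prod_beta intro!: continuous_intros)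
  have "continuous_on ({0..} \<times> UNIV) (case_prod barrier_t)"
    using amp comp[OF F_cont] comp[OF F1_cont] comp[OF Fs_cont] s0
    by (auto simp: barrier_t_def Let_def case_prod_beta intro!: continuous_intros)
  then show "continuous_on ({0<..} \<times> UNIV) (case_prod barrier_t)"
    by (rule continuous_on_subset) auto
  assume t: "0 < t"
  then have s: "0 < t + s0" using s0 by simp
  have "continuous_on UNIV (\<lambda>x. F2 (t + s0) (x - \<mu> * t - c))"
    by (rule continuous_on_compose2[OF F2_cont[OF s]]) (auto intro!: continuous_intros)
  moreover have "continuous_on UNIV (\<lambda>x. F1 (t + s0) (x - \<mu> * t - c))"
    by (rule continuous_on_compose2[OF DERIV_continuous_on[OF DERIV_subset[OF F1_deriv[OF s]]]])
      (auto intro!: continuous_intros)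
  moreover have "continuous_on UNIV (\<lambda>x. F (t + s0) (x - \<mu> * t - c))"
    by (rule continuous_on_compose2[OF DERIV_continuous_on[OF DERIV_subset[OF F_deriv[OF s]]]])
      (auto intro!: continuous_intros)
  moreover have "continuous_on UNIV (amplitude t)"
    unfolding amplitude_def[abs_def] using s by (auto intro!: continuous_intros)
  ultimately show "continuous_on UNIV (barrier_xx t)"
    using s unfolding barrier_xx_def[abs_def] Let_def by (auto intro!: continuous_intros)
qed

text \<open>Tilt, drift and Gaussian cancel, leaving an equation for the profile F alone. Its
  right-hand side vanishes for F s y = y, so only corrections to the linear profile need
  checking.\<close>

lemma barrier_operator:
  fixes t x :: real
  assumes "0 < t"
  defines "s \<equiv> t + s0" and "y \<equiv> x - \<mu> * t - c"
  shows "barrier_t t x - barrier_xx t x / 2 - barrier t x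
    = amplitude t x * (Fs s y - F2 s y / 2 + (y * F1 s y - F s y) / s)"
proof -
  have s: "0 < s" using assms s0 by simp
  have "Fs s y - \<mu> * F1 s y + F s y * (1 + \<mu>\<^sup>2 / 2 - 3 / (2 * s) + \<mu> * y / s + y\<^sup>2 / (2 * s\<^sup>2))
      - (F2 s y - 2 * (\<mu> + y / s) * F1 s y + ((\<mu> + y / s)\<^sup>2 - 1 / s) * F s y) / 2 - F s y
      = Fs s y - F2 s y / 2 + (y * F1 s y - F s y) / s"
    using s by (simp add: field_simps power2_eq_square)
  moreover have "a * X - a * Y / 2 - a * Z = a * (X - Y / 2 - Z)" for a X Y Z :: real
    by (simp add: algebra_simps)
  ultimately show ?thesis
    unfolding barrier_t_def barrier_xx_def barrier_def Let_def s_def[symmetric] y_def[symmetric]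
    by (simp only:)
qed

end

section \<open>The regularised front and its monotonicity\<close>

text \<open>Lipschitz substitute for the indicator of the half line. By reflection,
  \<open>survival ramp t z\<close> approximates the probability that branching Brownian motion from
  0 has no particle above z at time t, and \<open>1 - survival ramp t\<close> is the front.\<close>

definition ramp :: "real \<Rightarrow> real" where
  "ramp x = max 0 (min 1 (1 + x))"

interpretation ramp: initial_value ramp
proof
  show "ramp \<in> borel_measurable borel" unfolding ramp_def by measurable
qed (auto simp: ramp_def)

lemma ramp_lipschitz: "\<bar>ramp x - ramp y\<bar> \<le> 1 * \<bar>x - y\<bar>"
  by (auto simp: ramp_def)

interpretation ramp_solution: mild_solution "\<lambda>a. a\<^sup>2" "survival ramp"
  by (rule ramp.mild_solution_survival[OF ramp_lipschitz]) simp

lemma (in initial_value) survival_0: "survival g 0 x = g x"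
proof -
  have "survival g 0 x = (\<integral>p. g x \<partial>clock_noise)"
    unfolding survival_fixpoint[of 0 x] branch_step_def
    by (rule integral_cong_AE) (use AE_clock_noise_pos in \<open>auto elim!: eventually_mono\<close>)
  then show ?thesis using expo_gauss.prob_space by simp
qed

lemma survival_mono:
  assumes "initial_value g" "initial_value g'" "\<And>x. g x \<le> g' x"
  shows "survival g t x \<le> survival g' t x"
  using LIMSEQ_le[OF initial_value.surv_tendsto[OF assms(1)] initial_value.surv_tendsto[OF assms(2)]]
    surv_mono[OF assms] by auto

lemma survival_reflect:
  assumes "initial_value g"
  shows "survival (\<lambda>x. g (c - x)) t x = survival g t (c - x)"
  unfolding survival_def using surv_reflect[OF assms] by simp

lemma initial_value_reflect:
  assumes "initial_value g" shows "initial_value (\<lambda>x. g (c - x))"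
proof -
  interpret initial_value g by fact
  show ?thesis by standard (auto simp: g_nonneg g_le1)
qed

text \<open>Two reflections compose to a translation, so moving the starting point amounts to moving
  the initial value, and monotonicity in the initial value applies.\<close>

lemma survival_ramp_mono:
  assumes "x \<le> y"
  shows "survival ramp t x \<le> survival ramp t y"
proof -
  let ?h = "\<lambda>z. ramp (y - x - z)"
  have h: "initial_value ?h" by (rule initial_value_reflect) unfold_locales
  have "survival ramp t x \<le> survival (\<lambda>z. ?h (0 - z)) t x"
    by (rule survival_mono[OF ramp.initial_value_axioms initial_value_reflect[OF h]])
      (use assms in \<open>auto simp: ramp_def\<close>)
  also have "\<dots> = survival ?h t (0 - x)" by (rule survival_reflect[OF h])
  also have "\<dots> = survival ramp t (y - x - (0 - x))"
    by (rule survival_reflect[OF ramp.initial_value_axioms])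
  finally show ?thesis by simp
qed

text \<open>
  The term \<open>1 - z\<^sup>2\<close> makes the logarithmic shift of the zero of the dipole an exact solution up to
  the derivative of the logarithm; the remaining terms absorb that error and keep the profile positive
  for large \<open>z\<close>.
\<close>

definition hermite_cubic :: "real \<Rightarrow> real" where
  "hermite_cubic z = 1 - 16 * z - z\<^sup>2 + z^3"

lemma scaled_deriv:
  fixes s0 :: real
  assumes "0 < t + s0"
  shows "((\<lambda>t. (x - m * t - c) / sqrt (t + s0)) has_real_derivative
      - m / sqrt (t + s0) - (x - m * t - c) / sqrt (t + s0) / (2 * (t + s0))) (at t)"
proof -
  have s: "sqrt (t + s0) * sqrt (t + s0) = t + s0" "0 < sqrt (t + s0)" using assms by auto
  have num: "((\<lambda>t. x - m * t - c) has_real_derivative - m) (at t)"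
    by (auto intro!: derivative_eq_intros)
  have den: "((\<lambda>t. sqrt (t + s0)) has_real_derivative inverse (sqrt (t + s0)) / 2 * 1) (at t)"
    by (rule DERIV_chain2[where f = sqrt and g = "\<lambda>t. t + s0", OF DERIV_real_sqrt[OF assms]]) (auto intro!: derivative_eq_intros)
  have "((- m) * r - y * (inverse r / 2 * 1)) / (r * r) = - m / r - y / r / (2 * (r * r))"
    if "0 < r" for r y :: real using that by (simp add: field_simps)
  from DERIV_divide[OF num den] this[OF s(2)] s show ?thesis by simp
qed

text \<open>The time offset is taken so large that sqrt s dominates the logarithmic corrections from
  the start. The numbers 4 and 7 are convenient thresholds for the estimates in
  \<open>operator_nonneg\<close>.\<close>

locale upper_barrier =
  fixes s0 :: real
  assumes s0: "0 < s0"
    and ln_large: "\<And>s. s0 \<le> s \<Longrightarrow> 4 \<le> ln s"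
    and sqrt_large: "\<And>s. s0 \<le> s \<Longrightarrow> 7 * (ln s)\<^sup>2 \<le> sqrt s"
begin

definition a :: real where "a = 3 / (2 * sqrt 2)"

text \<open>The first identity is the balance of exponents: at y = - a * ln s the tilt exactly
  offsets s powr (- 3 / 2).\<close>

lemma a_bounds: "sqrt 2 * a = 3 / 2" "1 < a" "a < 11 / 10"
proof -
  show "sqrt 2 * a = 3 / 2" by (simp add: a_def)
  have "sqrt 2 < 3 / 2" by (rule real_less_lsqrt) (auto simp: power2_eq_square)
  then show "1 < a" by (simp add: a_def divide_simps)
  have "14 / 10 < sqrt 2" by (rule real_less_rsqrt) (auto simp: power2_eq_square)
  then show "a < 11 / 10" by (simp add: a_def divide_simps)
qed

text \<open>The profile is y + a * ln s to leading order, so its zero follows the logarithmic curve.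
  The shift \<open>a * ln s0\<close> makes this leading part equal to x at time 0, and the constant
  2 lifts the barrier to at least 1 on the edge of \<open>D\<close>.\<close>

sublocale gaussian_barrier
  "\<lambda>s y. y + a * ln s * hermite_cubic (y / sqrt s)"
  "\<lambda>s y. a / s * hermite_cubic (y / sqrt s)
     - a * ln s * (- 16 - 2 * (y / sqrt s) + 3 * (y / sqrt s)\<^sup>2) * (y / sqrt s) / (2 * s)"
  "\<lambda>s y. 1 + a * ln s * (- 16 - 2 * (y / sqrt s) + 3 * (y / sqrt s)\<^sup>2) / sqrt s"
  "\<lambda>s y. a * ln s * (- 2 + 6 * (y / sqrt s)) / s"
  "sqrt 2" "a * ln s0" s0 2
proof
  show "0 < s0" by (rule s0)
  have P: "(hermite_cubic has_real_derivative - 16 - 2 * z + 3 * z\<^sup>2) (at z)" for z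
    unfolding hermite_cubic_def[abs_def] by (auto intro!: derivative_eq_intros)
  fix t x :: real assume t: "0 < t"
  let ?z = "(x - sqrt 2 * t - a * ln s0) / sqrt (t + s0)"
  have s: "0 < t + s0" using t s0 by simp
  have "((\<lambda>t. (x - sqrt 2 * t - a * ln s0) + a * ln (t + s0) * hermite_cubic ((x - sqrt 2 * t - a * ln s0) / sqrt (t + s0)))
      has_real_derivative - sqrt 2 + (a / (t + s0) * hermite_cubic ?z + ((- 16 - 2 * ?z + 3 * ?z\<^sup>2) *
        (- sqrt 2 / sqrt (t + s0) - ?z / (2 * (t + s0)))) * (a * ln (t + s0)))) (at t)"
    by (intro DERIV_add DERIV_mult DERIV_chain2[OF P] scaled_deriv[OF s])
      (use s in \<open>auto intro!: derivative_eq_intros\<close>)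
  then show "((\<lambda>t. (x - sqrt 2 * t - a * ln s0) + a * ln (t + s0) * hermite_cubic ((x - sqrt 2 * t - a * ln s0) / sqrt (t + s0)))
      has_real_derivative a / (t + s0) * hermite_cubic ?z
     - a * ln (t + s0) * (- 16 - 2 * ?z + 3 * ?z\<^sup>2) * ?z / (2 * (t + s0))
     - sqrt 2 * (1 + a * ln (t + s0) * (- 16 - 2 * ?z + 3 * ?z\<^sup>2) / sqrt (t + s0))) (at t)"
  proof (rule DERIV_cong)
    have "- m + (A * P + Q * (- m / r - w / d) * L) = A * P - L * Q * w / d - m * (1 + L * Q / r)"
      for A P Q L m r w d :: real by (simp add: divide_inverse algebra_simps)
    then show "- sqrt 2 + (a / (t + s0) * hermite_cubic ?z + (- 16 - 2 * ?z + 3 * ?z\<^sup>2) *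
        (- sqrt 2 / sqrt (t + s0) - ?z / (2 * (t + s0))) * (a * ln (t + s0)))
      = a / (t + s0) * hermite_cubic ?z
     - a * ln (t + s0) * (- 16 - 2 * ?z + 3 * ?z\<^sup>2) * ?z / (2 * (t + s0))
     - sqrt 2 * (1 + a * ln (t + s0) * (- 16 - 2 * ?z + 3 * ?z\<^sup>2) / sqrt (t + s0))" .
  qed
next
  have P: "(hermite_cubic has_real_derivative - 16 - 2 * z + 3 * z\<^sup>2) (at z)" for z
    unfolding hermite_cubic_def[abs_def] by (auto intro!: derivative_eq_intros)
  fix s y :: real assume s: "0 < s"
  then have ss: "sqrt s * sqrt s = s" by simp
  have z: "((\<lambda>y. y / sqrt s) has_real_derivative 1 / sqrt s) (at y)"
    using DERIV_cdivide[OF DERIV_ident, of "sqrt s"] by simp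
  from DERIV_add[OF DERIV_ident DERIV_cmult[OF DERIV_chain2[OF P z], of "a * ln s"]]
  show "((\<lambda>y. y + a * ln s * hermite_cubic (y / sqrt s)) has_real_derivative
      1 + a * ln s * (- 16 - 2 * (y / sqrt s) + 3 * (y / sqrt s)\<^sup>2) / sqrt s) (at y)"
    by (rule DERIV_cong) simp
  have "((\<lambda>z. - 16 - 2 * z + 3 * z\<^sup>2) has_real_derivative - 2 + 6 * z) (at z)" for z :: real
    by (auto intro!: derivative_eq_intros)
  from DERIV_add[OF DERIV_const[of 1] DERIV_cdivide[OF DERIV_cmult[OF DERIV_chain2[OF this z], of "a * ln s"], of "sqrt s"]]
  show "((\<lambda>y. 1 + a * ln s * (- 16 - 2 * (y / sqrt s) + 3 * (y / sqrt s)\<^sup>2) / sqrt s)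
      has_real_derivative a * ln s * (- 2 + 6 * (y / sqrt s)) / s) (at y)"
    by (rule DERIV_cong) (use ss in \<open>simp add: mult.assoc\<close>)
  show "continuous_on UNIV (\<lambda>y. a * ln s * (- 2 + 6 * (y / sqrt s)) / s)"
    using s by (intro continuous_intros) auto
qed (auto simp: case_prod_beta hermite_cubic_def intro!: continuous_intros)

text \<open>The last claim is the sign of the residual. For y \<ge> 0 the term 5 * z * ln s \<ge> 20
  * z beats the - 16 * z of the cubic. For y \<le> 0 the domain forces z to be so small that all
  terms perturb the constant 1.\<close>

lemma operator_nonneg:
  assumes s: "s0 \<le> s" and y: "1 \<le> y + a * ln s"
  shows "0 \<le> y + a * ln s * hermite_cubic (y / sqrt s)"
    and "y \<le> 0 \<Longrightarrow> y + a * ln s \<le> y + a * ln s * hermite_cubic (y / sqrt s)"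
    and "0 \<le> hermite_cubic (y / sqrt s) + ln s * (5 * (y / sqrt s) + (y / sqrt s)^3 / 2)"
proof -
  let ?F = "y + a * ln s * hermite_cubic (y / sqrt s)"
  define z where "z = y / sqrt s"
  have pos: "0 < s" using s s0 by simp
  then have r: "0 < sqrt s" by simp
  have L: "4 \<le> ln s" and Q: "7 * (ln s)\<^sup>2 \<le> sqrt s" using ln_large sqrt_large s by auto
  have LL: "4 * ln s \<le> (ln s)\<^sup>2" using L by (simp add: power2_eq_square)
  have P_neg: "1 \<le> hermite_cubic z" "0 \<le> hermite_cubic z + ln s * (5 * z + z^3 / 2)" if "y \<le> 0"
  proof -
    define w where "w = - z"
    have w: "0 \<le> w" using that r by (simp add: w_def z_def divide_nonpos_pos)
    have "- y \<le> a * ln s" using y by simp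
    also have "\<dots> \<le> 11 / 10 * ln s" using a_bounds L by (intro mult_right_mono) auto
    finally have wL: "w * sqrt s \<le> 11 / 10 * ln s" using r by (simp add: w_def z_def)
    \<comment> \<open>With |y| at most 11 / 10 * ln s this bounds |z| by a multiple of 1 / ln s, so
      that even ln s * |z| stays small.\<close>
    have "w * (7 * (ln s)\<^sup>2) \<le> w * sqrt s" using w Q by (intro mult_left_mono)
    then have "ln s * (w * (7 * ln s)) \<le> ln s * (11 / 10)" using wL by (simp add: power2_eq_square mult_ac)
    then have wl: "w * (7 * ln s) \<le> 11 / 10" using L by (subst (asm) mult_le_cancel_left_pos) auto
    have "w * (7 * 4) \<le> w * (7 * ln s)" using w L by (intro mult_left_mono) auto
    then have w1: "w \<le> 1" using wl by linarith
    have "w\<^sup>2 \<le> w" "w^3 \<le> w"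
      using w w1 by (auto simp: power2_eq_square power3_eq_cube mult_le_one intro: mult_left_le_one_le)
    then show H: "1 \<le> hermite_cubic z"
      using w by (simp add: hermite_cubic_def w_def)
    have "ln s * (5 * w + w^3 / 2) \<le> ln s * (5 * w + w / 2)"
      using L \<open>w^3 \<le> w\<close> by (intro mult_left_mono) auto
    also have "\<dots> = w * (7 * ln s) * (11 / 14)" by (simp add: algebra_simps)
    also have "\<dots> \<le> 11 / 10 * (11 / 14)" using wl by (intro mult_right_mono) auto
    finally have "ln s * (5 * w + w^3 / 2) \<le> 1" by simp
    moreover have "ln s * (5 * z + z^3 / 2) = - (ln s * (5 * w + w^3 / 2))"
      by (simp add: w_def algebra_simps)
    ultimately show "0 \<le> hermite_cubic z + ln s * (5 * z + z^3 / 2)"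
      using H by linarith
  qed
  have P_pos: "0 \<le> ?F" "0 \<le> hermite_cubic z + ln s * (5 * z + z^3 / 2)" if "0 \<le> y"
  proof -
    have z: "0 \<le> z" using that r by (simp add: z_def)
    have q: "0 \<le> 1 - z\<^sup>2 + z^3"
    proof (cases "z \<le> 1")
      case True
      then show ?thesis using z power_le_one[of z 2] by (simp add: add_increasing2)
    next
      case False
      then have "z\<^sup>2 \<le> z^3" by (intro power_increasing) auto
      then show ?thesis by simp
    qed
    have "ln s * (5 * z + z^3 / 2) \<ge> 4 * (5 * z + z^3 / 2)" using L z by (intro mult_right_mono) auto
    moreover have "0 \<le> z ^ 3" using z by simp
    ultimately show "0 \<le> hermite_cubic z + ln s * (5 * z + z^3 / 2)"
      using q z unfolding hermite_cubic_def by argo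
    \<comment> \<open>The negative linear term of the cubic is absorbed by y itself, because sqrt s
      \<ge> 7 * (ln s)^2 \<ge> 28 * ln s.\<close>
    have "16 * a * ln s \<le> 24 * ln s" using a_bounds L by simp
    also have "\<dots> \<le> sqrt s" using LL Q L by linarith
    finally have "16 * a * ln s * y \<le> sqrt s * y" using that by (rule mult_right_mono)
    then have "16 * a * ln s * z \<le> y" using r by (simp add: z_def divide_simps mult.commute)
    moreover have "0 \<le> a * ln s * (1 - z\<^sup>2 + z^3)" using a_bounds L q by (intro mult_nonneg_nonneg) auto
    ultimately show "0 \<le> ?F" unfolding z_def[symmetric] by (simp add: hermite_cubic_def algebra_simps)
  qed
  have F_neg: "y + a * ln s \<le> ?F" if "y \<le> 0"
    using P_neg(1)[OF that] a_bounds L by (simp add: z_def)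
  show "0 \<le> ?F" using P_pos(1) F_neg y by (cases "0 \<le> y") auto
  show "y \<le> 0 \<Longrightarrow> y + a * ln s \<le> ?F" by (rule F_neg)
  show "0 \<le> hermite_cubic (y / sqrt s) + ln s * (5 * (y / sqrt s) + (y / sqrt s)^3 / 2)"
    using P_pos(2) P_neg(2) unfolding z_def by (cases "0 \<le> y") auto
qed

text \<open>Staying one unit ahead of the approximate zero leaves room for the barrier to reach 1 on
  the edge. \<open>max 0\<close> keeps the logarithm continuous at negative times, so that the set
  is closed in the whole plane.\<close>

definition D :: "(real \<times> real) set" where
  "D = {p. 1 \<le> (snd p - sqrt 2 * fst p - a * ln s0) + a * ln (max 0 (fst p) + s0)}"

lemma D_iff: "0 \<le> t \<Longrightarrow> (t, x) \<in> D \<longleftrightarrow> 1 \<le> (x - sqrt 2 * t - a * ln s0) + a * ln (t + s0)"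
  by (simp add: D_def)

lemma front_le_barrier:
  assumes "(t, x) \<in> D" "0 \<le> t"
  shows "1 - survival ramp t x \<le> barrier t x"
proof -
  interpret front: mild_solution "\<lambda>a. 1 - (1 - a)\<^sup>2" "\<lambda>t x. 1 - survival ramp t x"
    by (rule ramp_solution.complement)
  have cont: "continuous_on UNIV (\<lambda>p. (snd p - sqrt 2 * fst p - a * ln s0) + a * ln (max 0 (fst p) + s0))"
    using s0 by (intro continuous_intros) (auto simp: add_nonneg_eq_0_iff)
  show ?thesis
  proof (rule front.comparison[where D = D and \<tau> = t, OF _ barrier_continuous(1) barrier_deriv_t barrier_deriv_x barrier_deriv_xx barrier_continuous(2,3)])
    show "closed D" unfolding D_def by (intro closed_Collect_le cont continuous_intros)
  next
    fix t x assume D: "(t, x) \<in> D" "0 \<le> (t::real)"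
    then show "0 \<le> barrier t x"
      using operator_nonneg(1)[of "t + s0" "x - sqrt 2 * t - a * ln s0"] amplitude_pos[of t x]
      by (simp add: barrier_def D_iff)
  next
    fix x assume D: "(0, x) \<in> D"
    \<comment> \<open>Here \<open>ramp\<close> is 1, so the initial front vanishes on
      \<open>D\<close>.\<close>
    then have "1 \<le> x" by (simp add: D_iff)
    moreover have "0 \<le> barrier 0 x"
      using D operator_nonneg(1)[of "0 + s0" "x - sqrt 2 * 0 - a * ln s0"] amplitude_pos[of 0 x]
      by (simp add: barrier_def D_iff)
    ultimately show "1 - survival ramp 0 x \<le> barrier 0 x"
      by (simp add: ramp.survival_0) (simp add: ramp_def)
  next
    fix t x assume D: "(t, x) \<in> D" and t: "0 < (t::real)" and v: "barrier t x < 1"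
    define s where "s = t + s0"
    define y where "y = x - sqrt 2 * t - a * ln s0"
    have s: "s0 \<le> s" "0 < s" using t s0 by (auto simp: s_def)
    have y: "1 \<le> y + a * ln s" using D t by (simp add: D_iff s_def y_def)
    show "(t, x) \<in> interior D"
    proof -
      \<comment> \<open>On the edge both the profile and the amplitude are at least 1, contradicting
        \<open>v\<close>.\<close>
      have "1 \<noteq> y + a * ln s"
      proof
        assume "1 = y + a * ln s"
        then have eq: "y = 1 - a * ln s" by simp
        have L: "4 \<le> ln s" using ln_large s by auto
        then have "1 * 4 \<le> a * ln s" using a_bounds by (intro mult_mono) auto
        then have y0: "y \<le> 0" using eq by simp
        have "1 \<le> y + a * ln s * hermite_cubic (y / sqrt s)"
          using operator_nonneg(2)[OF s(1) y y0] eq by simp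
        moreover have "1 \<le> amplitude t x"
        proof -
          have "y\<^sup>2 \<le> (a * ln s)\<^sup>2" using y0 eq by (simp add: abs_le_square_iff[symmetric])
          also have "\<dots> \<le> (11 / 10 * ln s)\<^sup>2" using a_bounds L by (intro power_mono mult_right_mono) auto
          also have "\<dots> \<le> 7 * (ln s)\<^sup>2" by (simp add: power_mult_distrib power2_eq_square)
          also have "\<dots> \<le> sqrt s" using sqrt_large s by auto
          also have "\<dots> \<le> s"
          proof -
            have "1 \<le> ln s" using L by simp
            then have "exp 1 \<le> s" using s by (metis exp_le_cancel_iff exp_ln)
            then have "1 \<le> s" using exp_ge_add_one_self[of 1] by linarith
            then show ?thesis by (intro real_le_lsqrt) (auto simp: power2_eq_square)
          qed
          finally have "y\<^sup>2 / (2 * s) \<le> 1 / 2" using s by (simp add: divide_simps)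
          moreover have "sqrt 2 * y = sqrt 2 - 3 / 2 * ln s"
            using a_bounds(1) by (simp add: eq right_diff_distrib mult.assoc[symmetric])
          moreover have "sqrt 2 < 3 / 2" by (rule real_less_lsqrt) (auto simp: power2_eq_square)
          \<comment> \<open>The constant 2 covers sqrt 2 < 3 / 2 together with the Gaussian term,
            which is at most 1 / 2.\<close>
          ultimately have "0 \<le> 2 + (1 - (sqrt 2)\<^sup>2 / 2) * t - sqrt 2 * y - 3 / 2 * ln s - y\<^sup>2 / (2 * s)"
            by simp
          then show ?thesis unfolding amplitude_def s_def[symmetric] y_def[symmetric] by simp
        qed
        ultimately have "1 * 1 \<le> barrier t x"
          unfolding barrier_def s_def[symmetric] y_def[symmetric] by (intro mult_mono) auto
        then show False using v by simp
      qed
      then have "1 < y + a * ln s" using y by simp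
      then have "(t, x) \<in> {p. 1 < (snd p - sqrt 2 * fst p - a * ln s0) + a * ln (max 0 (fst p) + s0)}"
        using t by (simp add: s_def y_def)
      moreover have "open {p. 1 < (snd p - sqrt 2 * fst p - a * ln s0) + a * ln (max 0 (fst p) + s0)}"
        by (intro open_Collect_less cont continuous_intros)
      moreover have "{p. 1 < (snd p - sqrt 2 * fst p - a * ln s0) + a * ln (max 0 (fst p) + s0)} \<subseteq> D"
        by (auto simp: D_def)
      ultimately show ?thesis by (intro interiorI)
    qed
    define z where "z = y / sqrt s"
    have "barrier_t t x - barrier_xx t x / 2 - barrier t x = amplitude t x *
      (a / s * (hermite_cubic z + ln s * (5 * z + z^3 / 2)))"
    proof -
      have r: "sqrt s * sqrt s = s" "0 < sqrt s" using s by auto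
      have yz: "y = z * sqrt s" using r by (simp add: z_def)
      have "a / s * hermite_cubic z - a * ln s * (- 16 - 2 * z + 3 * z\<^sup>2) * z / (2 * s)
          - (a * ln s * (- 2 + 6 * z) / s) / 2
          + (y * (1 + a * ln s * (- 16 - 2 * z + 3 * z\<^sup>2) / sqrt s) - (y + a * ln s * hermite_cubic z)) / s
          = a / s * (hermite_cubic z + ln s * (5 * z + z^3 / 2))"
      proof -
        \<comment> \<open>Here Q and R stand for the first two derivatives of P. The operator Q * z
          / 2 - R / 2 - P annihilates 1 - z^2, sends - 16 * z to 8 * z and z^3 to z^3 / 2 - 3 * z,
          which adds up to 5 * z + z^3 / 2.\<close>
        have "A / s * P - A * L * Q * z / (2 * s) - (A * L * R / s) / 2
            + (y * (1 + A * L * Q / sqrt s) - (y + A * L * P)) / s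
          = A / s * (P + L * (Q * z / 2 - R / 2 - P))" for A L P Q R :: real
          unfolding yz using r s(2) by (simp add: field_simps)
        note this[of a "hermite_cubic z" "ln s" "- 16 - 2 * z + 3 * z\<^sup>2" "- 2 + 6 * z"]
        moreover have "(- 16 - 2 * z + 3 * z\<^sup>2) * z / 2 - (- 2 + 6 * z) / 2 - hermite_cubic z = 5 * z + z^3 / 2"
          by (simp add: hermite_cubic_def field_simps power2_eq_square power3_eq_cube)
        ultimately show ?thesis by (simp only:)
      qed
      then show ?thesis
        unfolding barrier_operator[OF t] s_def[symmetric] y_def[symmetric] z_def[symmetric] by simp
    qed
    moreover have "0 \<le> amplitude t x * (a / s * (hermite_cubic z + ln s * (5 * z + z^3 / 2)))"
      using amplitude_pos[of t x] a_bounds s operator_nonneg(3)[OF s(1) y]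
      by (intro mult_nonneg_nonneg) (auto simp: z_def)
    \<comment> \<open>The quadratic term has the favourable sign, so a supersolution of the linear
      equation suffices.\<close>
    moreover have "- barrier t x + (1 - (1 - barrier t x)\<^sup>2) \<le> barrier t x"
      by (simp add: power2_eq_square algebra_simps)
    ultimately show "barrier_xx t x / 2 - barrier t x + (1 - (1 - barrier t x)\<^sup>2) \<le> barrier_t t x"
      by linarith
  qed (use assms in auto)
qed

end

lemma eventually_upper_barrier: "\<exists>s0. upper_barrier s0"
proof -
  have "\<forall>\<^sub>F s in at_top. (0::real) < s \<and> 4 \<le> ln s \<and> 7 * (ln s)\<^sup>2 \<le> sqrt s"
    by (intro eventually_conj) real_asymp+
  then obtain N where N: "\<And>s. N \<le> s \<Longrightarrow> (0::real) < s \<and> 4 \<le> ln s \<and> 7 * (ln s)\<^sup>2 \<le> sqrt s"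
    by (auto simp: eventually_at_top_linorder)
  show ?thesis
    by (rule exI[of _ N]) (unfold_locales, use N in auto)
qed

text \<open>At y - a * ln s the tilt cancels s powr (- 3 / 2), and the barrier is at most exp (2 -
  sqrt 2 * y) * (y + 1), which is small for large y uniformly in time.\<close>

lemma front_upper_bound:
  assumes "0 < e"
  shows "\<exists>Y. \<forall>\<^sub>F t in at_top. 1 - survival ramp t (sqrt 2 * t - 3 / (2 * sqrt 2) * ln t + Y) \<le> e"
proof -
  obtain s0 where "upper_barrier s0" using eventually_upper_barrier by auto
  then interpret upper_barrier s0 .
  have "((\<lambda>y. exp (2 - sqrt 2 * y) * (y + 1)) \<longlongrightarrow> 0) at_top" by real_asymp
  then have "\<forall>\<^sub>F y in at_top. exp (2 - sqrt 2 * y) * (y + 1) < e"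
    using assms by (rule order_tendstoD(2))
  then have "\<forall>\<^sub>F y in at_top. 1 \<le> y \<and> exp (2 - sqrt 2 * y) * (y + 1) < e"
    by (intro eventually_conj eventually_ge_at_top)
  then obtain y where y: "1 \<le> y" "exp (2 - sqrt 2 * y) * (y + 1) < e"
    by (auto simp: eventually_at_top_linorder)
  define Y where "Y = a * ln s0 + y"
  let ?z = "\<lambda>s. (y - a * ln s) / sqrt s"
  \<comment> \<open>At bounded distance from the curve z is of order ln s / sqrt s, so the
    non-constant part of the cubic vanishes in the limit.\<close>
  have "((\<lambda>s. ln s * (- 16 * ?z s - (?z s)\<^sup>2 + (?z s)^3)) \<longlongrightarrow> 0) at_top"
    using a_bounds(2) by real_asymp
  then have "((\<lambda>s. a * (ln s * (- 16 * ?z s - (?z s)\<^sup>2 + (?z s)^3))) \<longlongrightarrow> a * 0) at_top"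
    by (intro tendsto_intros)
  then have "\<forall>\<^sub>F s in at_top. a * (ln s * (- 16 * ?z s - (?z s)\<^sup>2 + (?z s)^3)) < 1"
    by (intro order_tendstoD) auto
  moreover have "filterlim (\<lambda>t. t + s0) at_top at_top" by real_asymp
  ultimately have "\<forall>\<^sub>F t in at_top. a * (ln (t + s0) * (- 16 * ?z (t + s0) - (?z (t + s0))\<^sup>2 + (?z (t + s0))^3)) < 1"
    by (rule eventually_compose_filterlim)
  moreover have "\<forall>\<^sub>F t in at_top. (0::real) < t" by (rule eventually_gt_at_top)
  ultimately have "\<forall>\<^sub>F t in at_top. 1 - survival ramp t (sqrt 2 * t - 3 / (2 * sqrt 2) * ln t + Y) \<le> e"
  proof eventually_elim
    case (elim t)
    define s where "s = t + s0"
    define x where "x = sqrt 2 * t + a * ln s0 + (y - a * ln s)"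
    have s: "0 < s" "t \<le> s" using elim s0 by (auto simp: s_def)
    have xy: "x - sqrt 2 * t - a * ln s0 = y - a * ln s" by (simp add: x_def)
    have "(t, x) \<in> D" using y elim by (simp add: D_iff xy) (simp add: s_def)
    then have "1 - survival ramp t x \<le> barrier t x"
      using elim by (intro front_le_barrier) auto
    also have "barrier t x = exp (2 - sqrt 2 * (y - a * ln s) - 3 / 2 * ln s - (y - a * ln s)\<^sup>2 / (2 * s))
        * (y - a * ln s + a * ln s * hermite_cubic (?z s))"
      unfolding barrier_def amplitude_def xy s_def[symmetric] by simp
    also have "\<dots> \<le> exp (2 - sqrt 2 * y) * (y + 1)"
    proof (intro mult_mono)
      have "sqrt 2 * (y - a * ln s) = sqrt 2 * y - 3 / 2 * ln s"
        using a_bounds(1) by (simp add: right_diff_distrib mult.assoc[symmetric])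
      then show "exp (2 - sqrt 2 * (y - a * ln s) - 3 / 2 * ln s - (y - a * ln s)\<^sup>2 / (2 * s)) \<le> exp (2 - sqrt 2 * y)"
        using s by simp
      have "a * ln s * hermite_cubic (?z s) = a * ln s + a * (ln s * (- 16 * ?z s - (?z s)\<^sup>2 + (?z s)^3))"
      proof -
        have "A * L * (1 - 16 * z - z\<^sup>2 + z^3) = A * L + A * (L * (- 16 * z - z\<^sup>2 + z^3))" for A L z :: real
          by (simp add: algebra_simps)
        then show ?thesis by (simp only: hermite_cubic_def)
      qed
      then show "y - a * ln s + a * ln s * hermite_cubic (?z s) \<le> y + 1"
        using elim by (simp add: s_def)
      show "0 \<le> y - a * ln s + a * ln s * hermite_cubic (?z s)"
        using operator_nonneg(1)[of s "y - a * ln s"] y elim by (simp add: s_def)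
    qed simp
    also have "\<dots> \<le> e" using y by simp
    finally have "1 - survival ramp t x \<le> e" .
    moreover have "x \<le> sqrt 2 * t - 3 / (2 * sqrt 2) * ln t + Y"
    proof -
      have "a * ln t \<le> a * ln s" using s elim a_bounds by (intro mult_left_mono) auto
      then show ?thesis unfolding x_def Y_def a_def[symmetric] by simp
    qed
    ultimately show ?case using survival_ramp_mono[of x "sqrt 2 * t - 3 / (2 * sqrt 2) * ln t + Y" t] by linarith
  qed
  then show ?thesis by blast
qed

section \<open>Lower bound for the front\<close>

text \<open>The exponent y / 5 is the gap between the tilt 6 / 5 guaranteed by
  \<open>speed_bounds\<close> and the decay exp (- y) needed against the quadratic term. The
  constant is 625 * 64 * 3.\<close>

lemma fourth_power_le_exp:
  fixes y :: real
  assumes "0 \<le> y"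
  shows "(1 + y)^4 \<le> 120000 * exp (y / 5)"
proof -
  define x where "x = (1 + y) / 5"
  have x: "0 \<le> x" using assms by (simp add: x_def)
  have "(x / 2)\<^sup>2 / 2 \<le> exp (x / 2)"
    using exp_lower_Taylor_quadratic[of "x / 2"] x by simp
  then have "((x / 2)\<^sup>2 / 2)\<^sup>2 \<le> (exp (x / 2))\<^sup>2" by (intro power_mono) auto
  also have "(exp (x / 2))\<^sup>2 = exp x" by (simp add: exp_double[symmetric])
  finally have "x^4 \<le> 64 * exp x" by (simp add: power_divide)
  moreover have "(1 + y)^4 = 625 * x^4" by (simp add: x_def power_divide)
  moreover have "exp x \<le> 3 * exp (y / 5)"
  proof -
    have "exp x = exp (1 / 5) * exp (y / 5)" by (simp add: x_def exp_add[symmetric] add_divide_distrib)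
    moreover have "exp (1 / 5) \<le> exp (1::real)" by simp
    ultimately show ?thesis using exp_le by (simp add: order.trans[OF _ exp_le])
  qed
  ultimately show ?thesis by simp
qed

text \<open>Keeps only the unit interval from - y to 1 - y, on which the density is bounded
  below.\<close>

lemma gauss_tail_lower:
  assumes "0 \<le> y"
  shows "1 / 9 * exp (- y\<^sup>2 / 2) \<le> measure gauss {..1 - y}"
proof -
  have dens: "1 / 9 * exp (- y\<^sup>2 / 2) \<le> std_normal_density k" if "k \<in> {- y..1 - y}" for k
  proof -
    have "k\<^sup>2 \<le> y\<^sup>2 + 1"
    proof (cases "k \<le> 0")
      case True
      then have "k\<^sup>2 \<le> y\<^sup>2" using that assms by (simp add: abs_le_square_iff[symmetric])
      then show ?thesis by simp
    next
      case False
      then have "k\<^sup>2 \<le> 1" using that assms by (intro power_le_one) auto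
      then show ?thesis by (simp add: add_increasing)
    qed
    then have "exp (- y\<^sup>2 / 2) * exp (- 1) \<le> exp (- k\<^sup>2 / 2)"
      by (simp add: exp_add[symmetric])
    moreover have "1 / 3 \<le> exp (- 1 :: real)" using exp_le by (simp add: exp_minus divide_simps)
    ultimately have "1 / 3 * exp (- y\<^sup>2 / 2) \<le> exp (- k\<^sup>2 / 2)"
      by (smt (verit) exp_ge_zero mult.commute mult_right_mono)
    moreover have "1 / 3 \<le> 1 / sqrt (2 * pi)"
    proof -
      have "sqrt (2 * pi) \<le> 3" using pi_less_4 by (intro real_le_lsqrt) auto
      then show ?thesis by (simp add: divide_simps)
    qed
    ultimately have "1 / 3 * (1 / 3 * exp (- y\<^sup>2 / 2)) \<le> 1 / sqrt (2 * pi) * exp (- k\<^sup>2 / 2)"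
      by (intro mult_mono) auto
    then show ?thesis by (simp add: std_normal_density_def)
  qed
  have "ennreal (1 / 9 * exp (- y\<^sup>2 / 2)) = (\<integral>\<^sup>+k. ennreal (1 / 9 * exp (- y\<^sup>2 / 2)) * indicator {- y..1 - y} k \<partial>lborel)"
    by (subst nn_integral_cmult_indicator) auto
  also have "\<dots> \<le> (\<integral>\<^sup>+k. ennreal (std_normal_density k) * indicator {..1 - y} k \<partial>lborel)"
    using dens by (intro nn_integral_mono) (auto simp: indicator_def intro!: ennreal_leI)
  also have "\<dots> = emeasure gauss {..1 - y}"
    by (simp add: gauss_def emeasure_density)
  finally show ?thesis by (simp add: gauss.emeasure_eq_measure)
qed

text \<open>Only the event of no branching up to time 1 is kept; there displacement below - 1 - x
  makes \<open>ramp\<close> zero. The lower barrier starts at time 1 because the front at time 0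
  vanishes for x \<ge> 0, while a Gaussian tail can carry a positive barrier.\<close>

lemma front_initial_lower:
  assumes "0 \<le> x + 2"
  shows "1 / 27 * exp (- (x + 2)\<^sup>2 / 2) \<le> 1 - survival ramp 1 x"
proof -
  interpret front: mild_solution "\<lambda>a. 1 - (1 - a)\<^sup>2" "\<lambda>t x. 1 - survival ramp t x"
    by (rule ramp_solution.complement)
  let ?A = "\<lambda>k. indicator {..- 1 - x} k :: real"
  have A: "integrable gauss ?A" "(\<integral>k. ?A k \<partial>gauss) = measure gauss {..- 1 - x}"
    by (auto simp: gauss.emeasure_eq_measure)
  have "exp (- 1) * measure gauss {..- 1 - x} = (\<integral>p. (if 1 < fst p then ?A (snd p) else 0) \<partial>clock_noise)"
    using integral_clock_split(2)[OF A(1), of "\<lambda>_. 0" 1] A by simp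
  also have "\<dots> \<le> (\<integral>p. (if 1 < fst p then 1 - survival ramp 0 (x + snd p)
        else 1 - (survival ramp (1 - fst p) (x + sqrt (fst p) * snd p))\<^sup>2) \<partial>clock_noise)"
  proof (rule integral_clock_noise_mono[of _ 1 _ 1])
    fix \<tau> k :: real assume "0 < \<tau>"
    have "(1 - survival ramp (1 - \<tau>) (x + sqrt \<tau> * k)) \<in> {0..1}"
      using ramp.survival_bounds by auto
    then have "0 \<le> 1 - (survival ramp (1 - \<tau>) (x + sqrt \<tau> * k))\<^sup>2"
      by (auto intro!: power_le_one simp: ramp.survival_bounds)
    then show "(if 1 < fst (\<tau>, k) then ?A (snd (\<tau>, k)) else 0)
       \<le> (if 1 < fst (\<tau>, k) then 1 - survival ramp 0 (x + snd (\<tau>, k))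
        else 1 - (survival ramp (1 - fst (\<tau>, k)) (x + sqrt (fst (\<tau>, k)) * snd (\<tau>, k)))\<^sup>2)"
      by (auto simp: ramp.survival_0 ramp_def indicator_def)
  qed (auto simp: indicator_def ramp.survival_bounds power_le_one)
  also have "\<dots> = 1 - survival ramp 1 x"
    using front.restart[of 1 1 x] by (simp cong: if_cong)
  finally have "exp (- 1) * measure gauss {..- 1 - x} \<le> 1 - survival ramp 1 x" .
  moreover have "1 / 3 * (1 / 9 * exp (- (x + 2)\<^sup>2 / 2)) \<le> exp (- 1) * measure gauss {..- 1 - x}"
    using gauss_tail_lower[OF assms] exp_le
    by (intro mult_mono) (auto simp: exp_minus divide_simps)
  ultimately show ?thesis by simp
qed

text \<open>With the constant of \<open>fourth_power_le_exp\<close> this gives 120000 / 10^7 = 12 /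
  1000, below both the 1 / 27 of the initial comparison and the 1 / 2 needed against the quadratic
  term.\<close>

definition seed_height :: real where "seed_height = - ln (10^7)"

lemma exp_seed_height: "exp seed_height = 1 / 10^7"
  unfolding seed_height_def exp_minus by (subst exp_ln) (simp_all add: inverse_eq_divide)

text \<open>
  For a fixed horizon \<open>T\<close> the logarithmic correction is spread linearly over \<open>[0, T]\<close>, i.e. the front moves on
  the straight line of slope \<open>speed\<close>. The convex term \<open>exp (- y)\<close> of the profile compensates the
  quadratic nonlinearity near the front.
\<close>

locale lower_barrier =
  fixes T :: real
  assumes T: "0 < T" and small: "3 / 2 * ln (1 + T) / T \<le> 7 / 25"
begin

definition \<kappa> :: real where "\<kappa> = 3 / 2 * ln (1 + T) / T"

definition speed :: real where "speed = sqrt (2 - 2 * \<kappa>)"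

lemma \<kappa>_bounds: "0 \<le> \<kappa>" "\<kappa> \<le> 7 / 25"
  using T small by (auto simp: \<kappa>_def)

text \<open>The threshold 7 / 25 is the value of \<kappa> at which 2 - 2 * \<kappa> = (6 / 5)^2. The
  last equation says that slowing down from sqrt 2 yields exponential growth at rate
  \<kappa>.\<close>

lemma speed_bounds: "6 / 5 \<le> speed" "speed \<le> 3 / 2" "1 - speed\<^sup>2 / 2 = \<kappa>"
proof -
  show "6 / 5 \<le> speed" unfolding speed_def
    using \<kappa>_bounds by (intro real_le_rsqrt) (auto simp: power2_eq_square)
  show "speed \<le> 3 / 2" unfolding speed_def
    using \<kappa>_bounds by (intro real_le_lsqrt) (auto simp: power2_eq_square)
  show "1 - speed\<^sup>2 / 2 = \<kappa>" unfolding speed_def using \<kappa>_bounds by (simp add: field_simps)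
qed

text \<open>The - 1 makes the profile vanish at y = 0. It leaves 1 / s in the operator, which y^2 /
  s cancels; what remains is negative of order exp (- y). The offsets 1 and - 2 match the Gaussian
  tail of \<open>front_initial_lower\<close>.\<close>

sublocale gaussian_barrier "\<lambda>s y. y - 1 + exp (- y) + y\<^sup>2 / s" "\<lambda>s y. - (y\<^sup>2 / s\<^sup>2)"
  "\<lambda>s y. 1 - exp (- y) + 2 * y / s" "\<lambda>s y. exp (- y) + 2 / s" speed "- 2" 1 seed_height
proof
  fix t x :: real assume t: "0 < t"
  then show "((\<lambda>t. (x - speed * t - - 2) - 1 + exp (- (x - speed * t - - 2)) + (x - speed * t - - 2)\<^sup>2 / (t + 1))
      has_real_derivative - ((x - speed * t - - 2)\<^sup>2 / (t + 1)\<^sup>2)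
        - speed * (1 - exp (- (x - speed * t - - 2)) + 2 * (x - speed * t - - 2) / (t + 1))) (at t)"
  proof -
    define y where "y = (\<lambda>t. x - speed * t - - 2)"
    have y: "(y has_real_derivative - speed) (at t)"
      unfolding y_def by (auto intro!: derivative_eq_intros)
    have "((\<lambda>t. y t - 1 + exp (- y t) + (y t)\<^sup>2 / (t + 1)) has_real_derivative
      - speed - 0 + exp (- y t) * - (- speed)
        + (2 * y t * (- speed) * (t + 1) - (y t)\<^sup>2 * (1 + 0)) / ((t + 1) * (t + 1))) (at t)"
    proof (intro DERIV_add)
      show "((\<lambda>t. y t - 1) has_real_derivative - speed - 0) (at t)"
        by (intro DERIV_diff y DERIV_const)
      show "((\<lambda>t. exp (- y t)) has_real_derivative exp (- y t) * - (- speed)) (at t)"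
        by (rule DERIV_chain2[OF DERIV_exp DERIV_minus[OF y]])
      have "((\<lambda>t. (y t)\<^sup>2) has_real_derivative 2 * y t * (- speed)) (at t)"
        by (auto intro!: derivative_eq_intros y)
      from DERIV_divide[OF this DERIV_add[OF DERIV_ident DERIV_const[of 1]]]
      show "((\<lambda>t. (y t)\<^sup>2 / (t + 1)) has_real_derivative
        (2 * y t * (- speed) * (t + 1) - (y t)\<^sup>2 * (1 + 0)) / ((t + 1) * (t + 1))) (at t)"
        using t by simp
    qed
    note d = this
    have eq: "- speed - 0 + exp (- Y) * - (- speed) + (2 * Y * (- speed) * d - Y\<^sup>2 * (1 + 0)) / (d * d)
        = - (Y\<^sup>2 / d\<^sup>2) - speed * (1 - exp (- Y) + 2 * Y / d)" if "0 < d" for Y d :: real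
      using that by (simp add: field_simps power2_eq_square)
    have "0 < t + 1" using t by simp
    from DERIV_cong[OF d eq[OF this]] show ?thesis unfolding y_def .
  qed
next
  fix s y :: real assume s: "0 < s"
  then show "((\<lambda>y. y - 1 + exp (- y) + y\<^sup>2 / s) has_real_derivative 1 - exp (- y) + 2 * y / s) (at y)"
    by (auto intro!: derivative_eq_intros)
  show "((\<lambda>y. 1 - exp (- y) + 2 * y / s) has_real_derivative exp (- y) + 2 / s) (at y)"
    using s by (auto intro!: derivative_eq_intros)
  show "continuous_on UNIV (\<lambda>y. exp (- y) + 2 / s)"
    by (intro continuous_intros)
qed (auto simp: case_prod_beta intro!: continuous_intros)

text \<open>By concavity of ln the linear gain \<kappa> * t stays below 3 / 2 * ln (1 + t) up to the
  horizon, with equality at both ends. So the amplitude never outgrows its initial size, yet has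
  fully recovered at time T.\<close>

lemma amplitude_le:
  assumes "0 \<le> t" "t \<le> T" "0 \<le> y" "y = x - speed * t + 2"
  shows "amplitude t x \<le> exp (- (6 / 5) * y - y\<^sup>2 / (2 * (t + 1))) / 10^7"
proof -
  have "(1 - t / T) *\<^sub>R 1 + (t / T) *\<^sub>R (1 + T) = t + 1" using T by (simp add: field_simps)
  moreover have "(1 - t / T) * ln 1 + (t / T) * ln (1 + T) \<le> ln ((1 - t / T) *\<^sub>R 1 + (t / T) *\<^sub>R (1 + T))"
    by (rule concave_onD[OF ln_concave]) (use assms T in auto)
  ultimately have "(1 - t / T) * ln 1 + (t / T) * ln (1 + T) \<le> ln (t + 1)" by (simp only:)
  then have "t / T * ln (1 + T) \<le> ln (t + 1)" by simp
  moreover have "\<kappa> * t = 3 / 2 * (t / T * ln (1 + T))" by (simp add: \<kappa>_def)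
  ultimately have "\<kappa> * t \<le> 3 / 2 * ln (t + 1)" by simp
  moreover have "6 / 5 * y \<le> speed * y" using speed_bounds assms by (intro mult_right_mono) auto
  ultimately have "seed_height + \<kappa> * t - speed * y - 3 / 2 * ln (t + 1) - y\<^sup>2 / (2 * (t + 1))
      \<le> - (6 / 5) * y - y\<^sup>2 / (2 * (t + 1)) + seed_height" by simp
  then have "amplitude t x \<le> exp (- (6 / 5) * y - y\<^sup>2 / (2 * (t + 1)) + seed_height)"
    unfolding amplitude_def speed_bounds(3) using assms(4) by simp
  then show ?thesis by (simp add: exp_add exp_seed_height)
qed

lemma profile_bounds:
  fixes y s :: real
  assumes "0 \<le> y" "1 \<le> s"
  shows "0 \<le> y - 1 + exp (- y) + y\<^sup>2 / s" "y - 1 + exp (- y) + y\<^sup>2 / s \<le> (1 + y)\<^sup>2"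
    "0 < y \<Longrightarrow> 0 < y - 1 + exp (- y) + y\<^sup>2 / s"
proof -
  have 1: "0 \<le> y - 1 + exp (- y)" using exp_ge_add_one_self[of "- y"] by simp
  then show "0 \<le> y - 1 + exp (- y) + y\<^sup>2 / s" using assms by simp
  show "0 < y \<Longrightarrow> 0 < y - 1 + exp (- y) + y\<^sup>2 / s"
    using 1 assms by (intro add_nonneg_pos) auto
  have "y\<^sup>2 / s \<le> y\<^sup>2 / 1" using assms by (intro divide_left_mono) auto
  moreover have "exp (- y) \<le> 1" using assms by simp
  moreover have "(1 + y)\<^sup>2 = 1 + 2 * y + y\<^sup>2" by (simp add: power2_sum)
  ultimately show "y - 1 + exp (- y) + y\<^sup>2 / s \<le> (1 + y)\<^sup>2"
    using assms by linarith
qed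

lemma barrier_small:
  assumes t: "0 \<le> t" "t \<le> T" and y: "0 \<le> y" "y = x - speed * t + 2"
  shows "0 \<le> barrier t x" "barrier t x \<le> 12 / 1000 * exp (- y\<^sup>2 / (2 * (t + 1)))"
    and "amplitude t x * (y - 1 + exp (- y) + y\<^sup>2 / (t + 1))\<^sup>2 \<le> 12 / 1000 * exp (- y)"
    and "0 < y \<Longrightarrow> 0 < barrier t x"
proof -
  let ?F = "y - 1 + exp (- y) + y\<^sup>2 / (t + 1)" and ?g = "exp (- y\<^sup>2 / (2 * (t + 1)))"
  have F: "0 \<le> ?F" "?F \<le> (1 + y)\<^sup>2" using profile_bounds[of y "t + 1"] t y by auto
  have b: "barrier t x = amplitude t x * ?F" unfolding barrier_def using y by simp
  show "0 \<le> barrier t x" using F amplitude_pos[of t x] by (simp add: b)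
  show "0 < y \<Longrightarrow> 0 < barrier t x"
    using profile_bounds(3)[of y "t + 1"] t amplitude_pos[of t x] by (simp add: b)
  have A: "amplitude t x \<le> exp (- (6 / 5) * y) * ?g / 10^7"
    using amplitude_le[OF assms] by (simp add: exp_add[symmetric])
  have g1: "?g \<le> 1" using t by simp
  have P: "exp (- (6 / 5) * y) * (1 + y)^4 \<le> 120000 * exp (- y)"
  proof -
    have "exp (- (6 / 5) * y) * (1 + y)^4 \<le> exp (- (6 / 5) * y) * (120000 * exp (y / 5))"
      using fourth_power_le_exp[OF y(1)] by (intro mult_left_mono) auto
    also have "\<dots> = 120000 * exp (- y)" by (simp add: exp_add[symmetric])
    finally show ?thesis .
  qed
  have "?F\<^sup>2 \<le> ((1 + y)\<^sup>2)\<^sup>2" using F by (intro power_mono) auto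
  then have F2: "?F\<^sup>2 \<le> (1 + y)^4" by simp
  have "amplitude t x * ?F\<^sup>2 \<le> (exp (- (6 / 5) * y) * ?g / 10^7) * (1 + y)^4"
    using A F2 by (intro mult_mono) auto
  also have "\<dots> = (exp (- (6 / 5) * y) * (1 + y)^4) * ?g / 10^7" by simp
  also have "\<dots> \<le> (120000 * exp (- y)) * 1 / 10^7"
    by (intro divide_right_mono mult_mono[OF P g1]) auto
  finally show "amplitude t x * ?F\<^sup>2 \<le> 12 / 1000 * exp (- y)" by simp
  have "(1 + y)\<^sup>2 \<le> (1 + y)^4" using y by (intro power_increasing) auto
  then have "barrier t x \<le> (exp (- (6 / 5) * y) * ?g / 10^7) * (1 + y)^4"
    using A F unfolding b by (intro mult_mono) auto
  also have "\<dots> = (exp (- (6 / 5) * y) * (1 + y)^4) * ?g / 10^7" by simp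
  also have "\<dots> \<le> (120000 * exp (- y)) * ?g / 10^7"
    using P by (intro divide_right_mono mult_right_mono) auto
  also have "\<dots> \<le> (120000 * 1) * ?g / 10^7"
    using y by (intro divide_right_mono mult_right_mono) auto
  finally show "barrier t x \<le> 12 / 1000 * ?g" by simp
qed

lemma front_ge_barrier:
  assumes "0 \<le> x - speed * t + 2" "0 \<le> t" "t \<le> T"
  shows "barrier t x \<le> 1 - survival ramp (1 + t) x"
proof -
  interpret sol: mild_solution "\<lambda>a. a\<^sup>2" "\<lambda>t x. survival ramp (1 + t) (0 + x)"
    by (rule ramp_solution.shift) simp
  define D :: "(real \<times> real) set" where "D = {p. 0 \<le> snd p - speed * fst p + 2}"
  have "survival ramp (1 + t) (0 + x) \<le> 1 - barrier t x"
  proof (rule sol.comparison[where D = D and \<tau> = T and vt = "\<lambda>t x. - barrier_t t x"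
      and vx = "\<lambda>t x. - barrier_x t x" and vxx = "\<lambda>t x. - barrier_xx t x"])
    show "closed D" unfolding D_def by (intro closed_Collect_le continuous_intros)
    show "continuous_on ({0..} \<times> UNIV) (\<lambda>(t, x). 1 - barrier t x)"
      "continuous_on ({0<..} \<times> UNIV) (\<lambda>(t, x). - barrier_t t x)"
      using barrier_continuous(1,2) by (auto simp: case_prod_beta intro!: continuous_intros)
    show "continuous_on UNIV (\<lambda>x. - barrier_xx t x)" if "0 < t" for t
      using barrier_continuous(3)[OF that] by (intro continuous_intros)
    show "((\<lambda>t. 1 - barrier t x) has_real_derivative - barrier_t t x) (at t)"
      "((\<lambda>x. 1 - barrier t x) has_real_derivative - barrier_x t x) (at x)"
      "((\<lambda>x. - barrier_x t x) has_real_derivative - barrier_xx t x) (at x)" if "0 < t" for t x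
      using barrier_deriv_t[OF that] barrier_deriv_x[OF that] barrier_deriv_xx[OF that]
      by (auto intro!: derivative_eq_intros)
  next
    fix t x assume D: "(t, x) \<in> D" "0 \<le> t" "t \<le> T"
    have "barrier t x \<le> 12 / 1000 * exp (- (x - speed * t + 2)\<^sup>2 / (2 * (t + 1)))"
      using barrier_small(2)[of t "x - speed * t + 2" x] D by (simp add: D_def)
    also have "\<dots> \<le> 12 / 1000 * 1" using D by (intro mult_left_mono) auto
    finally show "0 \<le> 1 - barrier t x" by simp
  next
    fix x assume D: "(0, x) \<in> D"
    then have "0 \<le> x + 2" by (simp add: D_def)
    then have "barrier 0 x \<le> 12 / 1000 * exp (- (x + 2)\<^sup>2 / (2 * (0 + 1)))"
      by (intro barrier_small(2)) (use T in auto)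
    also have "2 * (0 + 1) = (2 :: real)" by simp
    finally have "barrier 0 x \<le> 12 / 1000 * exp (- (x + 2)\<^sup>2 / 2)" .
    also have "\<dots> \<le> 1 / 27 * exp (- (x + 2)\<^sup>2 / 2)" by (intro mult_right_mono) auto
    also have "\<dots> \<le> 1 - survival ramp 1 x" using D by (intro front_initial_lower) (simp add: D_def)
    finally show "survival ramp (1 + 0) (0 + x) \<le> 1 - barrier 0 x" by simp
  next
    fix t x assume D: "(t, x) \<in> D" and t: "0 < t" "t \<le> T" and v: "1 - barrier t x < 1"
    define y where "y = x - speed * t + 2"
    define s where "s = t + 1"
    have y0: "0 \<le> y" using D by (simp add: D_def y_def)
    have s: "0 < s" using t by (simp add: s_def)
    \<comment> \<open>On the edge the barrier is 0 and 1 - barrier is 1, so the lateral condition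
      holds trivially.\<close>
    have "y \<noteq> 0"
    proof
      assume "y = 0"
      then have "x - speed * t - - 2 = 0" by (simp add: y_def)
      then have "barrier t x = 0" unfolding barrier_def by simp
      then show False using v by simp
    qed
    then have y: "0 < y" using y0 by simp
    have "open {p. 0 < snd p - speed * fst p + 2}"
      by (intro open_Collect_less continuous_intros)
    moreover have "(t, x) \<in> {p. 0 < snd p - speed * fst p + 2}" using y by (simp add: y_def)
    moreover have "{p. 0 < snd p - speed * fst p + 2} \<subseteq> D" by (auto simp: D_def)
    ultimately show "(t, x) \<in> interior D" by (intro interiorI)
    let ?F = "y - 1 + exp (- y) + y\<^sup>2 / s"
    have "barrier_t t x - barrier_xx t x / 2 - barrier t x = amplitude t x *
        (- (y\<^sup>2 / s\<^sup>2) - (exp (- y) + 2 / s) / 2 + (y * (1 - exp (- y) + 2 * y / s) - ?F) / s)"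
      using barrier_operator[OF t(1), of x] unfolding y_def s_def by simp
    \<comment> \<open>The terms 1 / s and y^2 / s^2 cancel; the surviving - exp (- y) / 2 pays for
      the square of the barrier.\<close>
    also have "- (y\<^sup>2 / s\<^sup>2) - (exp (- y) + 2 / s) / 2 + (y * (1 - exp (- y) + 2 * y / s) - ?F) / s
        = - exp (- y) / 2 - (1 + y) * exp (- y) / s"
      using s by (simp add: field_simps power2_eq_square)
    also have "amplitude t x * \<dots> \<le> amplitude t x * (- exp (- y) / 2)"
      using amplitude_pos[of t x] y s by (intro mult_left_mono) auto
    also have "\<dots> \<le> - (barrier t x)\<^sup>2"
    proof -
      have "(barrier t x)\<^sup>2 = amplitude t x * (amplitude t x * ?F\<^sup>2)"
      proof -
        have "(A * F)\<^sup>2 = A * (A * F\<^sup>2)" for A F :: real by (simp add: power2_eq_square)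
        moreover have "barrier t x = amplitude t x * ?F" by (simp add: barrier_def y_def s_def)
        ultimately show ?thesis by simp
      qed
      also have "\<dots> \<le> amplitude t x * (12 / 1000 * exp (- y))"
        using barrier_small(3)[of t y x] t y amplitude_pos[of t x]
        by (intro mult_left_mono) (auto simp: s_def y_def)
      also have "\<dots> \<le> amplitude t x * (1 / 2 * exp (- y))"
        using amplitude_pos[of t x] by (intro mult_left_mono mult_right_mono) auto
      finally show ?thesis by simp
    qed
    finally show "- barrier_xx t x / 2 - (1 - barrier t x) + (1 - barrier t x)\<^sup>2 \<le> - barrier_t t x"
      by (simp add: power2_eq_square algebra_simps)
  qed (use assms in \<open>auto simp: D_def\<close>)
  then show ?thesis by simp
qed

text \<open>At the horizon the gain offsets the logarithm exactly, so at y = 1 the bound does not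
  depend on T: exp (- 3) bounds the tilt and Gaussian factors, exp (- 1) the profile.\<close>

lemma front_lower_seed: "exp (- 4) / 10^7 \<le> 1 - survival ramp (1 + T) (speed * T - 1)"
proof -
  have "\<kappa> * T = 3 / 2 * ln (T + 1)" using T by (simp add: \<kappa>_def add.commute)
  then have amp: "amplitude T (speed * T - 1) = exp (seed_height - speed - 1 / (2 * (T + 1)))"
    unfolding amplitude_def speed_bounds(3) by simp
  have "exp (- 3 + seed_height) * exp (- 1 :: real) = exp (- 4) * exp seed_height"
    by (simp add: exp_add[symmetric])
  then have "exp (- 4) / 10^7 = exp (- 3 + seed_height) * exp (- 1 :: real)"
    by (simp add: exp_seed_height)
  also have "\<dots> \<le> amplitude T (speed * T - 1) * (1 - 1 + exp (- 1) + 1\<^sup>2 / (T + 1))"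
  proof (intro mult_mono)
    have "1 / (2 * (T + 1)) \<le> 1" using T by (simp add: divide_simps)
    then show "exp (- 3 + seed_height) \<le> amplitude T (speed * T - 1)"
      unfolding amp using speed_bounds by simp
  qed (use T amplitude_pos[of T "speed * T - 1"] in auto)
  also have "\<dots> = barrier T (speed * T - 1)" unfolding barrier_def by simp
  also have "\<dots> \<le> 1 - survival ramp (1 + T) (speed * T - 1)"
    using T by (intro front_ge_barrier) auto
  finally show ?thesis .
qed

end

section \<open>Amplification of a small seed\<close>

text \<open>By monotonicity the front is at least c0 everywhere to the left of y0. Far inside that
  half line it follows the logistic equation up to nearly 1, while the unknown right side intrudes
  by an exponentially small amount.\<close>

lemma front_amplification:
  assumes c0: "0 < c0" "c0 < 1" and "0 < e"
  shows "\<exists>s Y. 0 \<le> s \<and> (\<forall>t y0. 0 \<le> t \<longrightarrow> c0 \<le> 1 - survival ramp t y0 \<longrightarrow>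
    1 - e \<le> 1 - survival ramp (t + s) (y0 - Y))"
proof -
  \<comment> \<open>The logistic solution with initial value c0.\<close>
  define \<rho> where "\<rho> t = c0 * exp t / (1 - c0 + c0 * exp t)" for t
  have den: "0 < 1 - c0 + c0 * exp t" for t
    using c0 by (intro add_pos_pos) auto
  have \<rho>: "0 < \<rho> t" "\<rho> t < 1" for t
    using c0 den[of t] by (auto simp: \<rho>_def)
  have \<rho>_deriv: "(\<rho> has_real_derivative \<rho> t * (1 - \<rho> t)) (at t)" for t
    unfolding \<rho>_def[abs_def] using den[of t]
    by (auto intro!: derivative_eq_intros simp: divide_simps power2_eq_square algebra_simps)
  have "(\<rho> \<longlongrightarrow> 1) at_top" unfolding \<rho>_def[abs_def] using c0 by real_asymp
  then have "\<forall>\<^sub>F s in at_top. 1 - e / 2 < \<rho> s" using \<open>0 < e\<close> by (intro order_tendstoD) auto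
  then have "\<forall>\<^sub>F s in at_top. 0 \<le> s \<and> 1 - e / 2 < \<rho> s" by (intro eventually_conj eventually_ge_at_top)
  then obtain s where s: "0 \<le> s" "1 - e / 2 < \<rho> s" by (auto simp: eventually_at_top_linorder)
  have "((\<lambda>Y. c0 * exp (5 / 2 * s - Y)) \<longlongrightarrow> 0) at_top" using c0 by real_asymp
  then have "\<forall>\<^sub>F Y in at_top. c0 * exp (5 / 2 * s - Y) < e / 2" using \<open>0 < e\<close> by (intro order_tendstoD) auto
  then obtain Y where Y: "c0 * exp (5 / 2 * s - Y) < e / 2" by (auto simp: eventually_at_top_linorder)
  have "1 - e \<le> 1 - survival ramp (t + s) (y0 - Y)"
    if t: "0 \<le> t" and seed: "c0 \<le> 1 - survival ramp t y0" for t y0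
  proof -
    interpret sol: mild_solution "\<lambda>a. a\<^sup>2" "\<lambda>r x. survival ramp (t + r) (y0 + x)"
      by (rule ramp_solution.shift[OF t])
    let ?E = "\<lambda>r x. c0 * exp (5 / 2 * r + x)"
    have "survival ramp (t + s) (y0 + (- Y)) \<le> 1 - \<rho> s + ?E s (- Y)"
    proof (rule sol.comparison[where D = UNIV and \<tau> = s and v = "\<lambda>r x. 1 - \<rho> r + ?E r x"
        and vt = "\<lambda>r x. - (\<rho> r * (1 - \<rho> r)) + 5 / 2 * ?E r x" and vx = ?E and vxx = ?E])
      have "continuous_on UNIV \<rho>"
        using \<rho>_deriv by (intro DERIV_continuous_on) (auto intro: DERIV_subset)
      then have [continuous_intros]: "continuous_on A (\<lambda>p. \<rho> (f p))" if "continuous_on A f" for A and f :: "real \<times> real \<Rightarrow> real"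
        using that by (rule continuous_on_compose2) auto
      show "continuous_on ({0..} \<times> UNIV) (\<lambda>(r, x). 1 - \<rho> r + ?E r x)"
        "continuous_on ({0<..} \<times> UNIV) (\<lambda>(r, x). - (\<rho> r * (1 - \<rho> r)) + 5 / 2 * ?E r x)"
        by (auto simp: case_prod_beta intro!: continuous_intros)
      show "continuous_on UNIV (?E r)" for r by (intro continuous_intros)
      show "((\<lambda>r. 1 - \<rho> r + ?E r x) has_real_derivative - (\<rho> r * (1 - \<rho> r)) + 5 / 2 * ?E r x) (at r)" for r x
        using \<rho>_deriv[of r] by (auto intro!: derivative_eq_intros)
      show "((\<lambda>x. 1 - \<rho> r + ?E r x) has_real_derivative ?E r x) (at x)"
        "(?E r has_real_derivative ?E r x) (at x)" for r x
        by (auto intro!: derivative_eq_intros)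
      show "0 \<le> 1 - \<rho> r + ?E r x" for r x
        using \<rho>(2)[of r] c0 by (intro add_nonneg_nonneg) auto
      \<comment> \<open>Left of the origin the seed gives the bound 1 - c0; right of it the
        exponential alone lifts the supersolution to 1.\<close>
      show "survival ramp (t + 0) (y0 + x) \<le> 1 - \<rho> 0 + ?E 0 x" for x
      proof (cases "x \<le> 0")
        case True
        have "survival ramp t (y0 + x) \<le> survival ramp t y0" using True by (intro survival_ramp_mono) auto
        then show ?thesis using seed c0 by (simp add: \<rho>_def add_increasing2)
      next
        case False
        then have "c0 * 1 \<le> c0 * exp x" using c0 by (intro mult_left_mono) auto
        then show ?thesis using ramp.survival_bounds(2)[of t "y0 + x"] by (simp add: \<rho>_def)
      qed
      show "?E r x / 2 - (1 - \<rho> r + ?E r x) + (1 - \<rho> r + ?E r x)\<^sup>2 \<le> - (\<rho> r * (1 - \<rho> r)) + 5 / 2 * ?E r x"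
        if "1 - \<rho> r + ?E r x < 1" for r x
      proof -
        define E where "E = ?E r x"
        have "0 \<le> E" "E \<le> 1 + 2 * \<rho> r" using that \<rho>[of r] c0 by (auto simp: E_def)
        \<comment> \<open>This product is exactly the difference of the two sides for the rate 5 /
          2.\<close>
        then have "0 \<le> E * (1 + 2 * \<rho> r - E)" by simp
        then show ?thesis unfolding E_def[symmetric] by (simp add: power2_eq_square algebra_simps)
      qed
    qed (use s in auto)
    then show ?thesis using s Y by simp
  qed
  with s show ?thesis by blast
qed

lemma front_lower_bound:
  assumes "0 < e"
  shows "\<exists>Y. \<forall>\<^sub>F t in at_top. 1 - e \<le> 1 - survival ramp t (sqrt 2 * t - 3 / (2 * sqrt 2) * ln t - Y)"
proof -
  define c0 :: real where "c0 = exp (- 4) / 10^7"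
  have "exp (- 4) < (1 :: real)" by simp
  then have c0: "0 < c0" "c0 < 1" by (auto simp: c0_def simp del: exp_less_one_iff)
  obtain s Y0 where s: "0 \<le> s" "\<And>t y0. 0 \<le> t \<Longrightarrow> c0 \<le> 1 - survival ramp t y0 \<Longrightarrow>
    1 - e \<le> 1 - survival ramp (t + s) (y0 - Y0)"
    using front_amplification[OF c0 assms] by blast
  let ?sp = "\<lambda>T. sqrt (2 - 2 * (3 / 2 * ln (1 + T) / T))"
  have ev1: "\<forall>\<^sub>F T in at_top. 0 < T \<and> 3 / 2 * ln (1 + T) / T \<le> (7 / 25 :: real)"
    by (intro eventually_conj) real_asymp+
  \<comment> \<open>Expanding the square root, the reduced slope costs 3 / 4 * ln (1 + T) up to
    o(1); times sqrt 2 this is the logarithmic correction.\<close>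
  have "((\<lambda>T. sqrt (1 - 3 / 2 * ln (1 + T) / T) * T - (1 + T + s) + 3 / 4 * ln (1 + T + s)) \<longlongrightarrow> - (1 + s)) at_top"
    using s(1) by real_asymp
  then have "((\<lambda>T. sqrt 2 * (sqrt (1 - 3 / 2 * ln (1 + T) / T) * T - (1 + T + s) + 3 / 4 * ln (1 + T + s)))
      \<longlongrightarrow> sqrt 2 * - (1 + s)) at_top"
    by (intro tendsto_intros)
  moreover have "sqrt 2 * (sqrt (1 - 3 / 2 * ln (1 + T) / T) * T - (1 + T + s) + 3 / 4 * ln (1 + T + s))
      = ?sp T * T - (sqrt 2 * (1 + T + s) - 3 / (2 * sqrt 2) * ln (1 + T + s))" for T
  proof -
    have "?sp T = sqrt (2 * (1 - 3 / 2 * ln (1 + T) / T))" by (simp add: algebra_simps)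
    then have 1: "?sp T = sqrt 2 * sqrt (1 - 3 / 2 * ln (1 + T) / T)" by (simp only: real_sqrt_mult)
    have 2: "3 / (2 * sqrt 2) = sqrt 2 * (3 / 4)" by (simp add: divide_simps)
    have "q * (r * T - a + 3 / 4 * b) = q * r * T - (q * a - q * (3 / 4) * b)" for q r a b :: real
      by (simp add: algebra_simps)
    then show ?thesis unfolding 1 2 .
  qed
  ultimately have lim: "((\<lambda>T. ?sp T * T - (sqrt 2 * (1 + T + s) - 3 / (2 * sqrt 2) * ln (1 + T + s)))
      \<longlongrightarrow> sqrt 2 * - (1 + s)) at_top"
    by (simp only:)
  \<comment> \<open>The 2 consists of the slack 1 in the limit and the 1 from the seed at speed * T
    - 1.\<close>
  define Y where "Y = sqrt 2 * (1 + s) + 2 + Y0"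
  have "\<forall>\<^sub>F T in at_top. - sqrt 2 * (1 + s) - 1 < ?sp T * T - (sqrt 2 * (1 + T + s) - 3 / (2 * sqrt 2) * ln (1 + T + s))"
    using lim by (rule order_tendstoD) (simp add: algebra_simps)
  with ev1 have "\<forall>\<^sub>F T in at_top. 1 - e \<le> 1 - survival ramp (1 + T + s)
      (sqrt 2 * (1 + T + s) - 3 / (2 * sqrt 2) * ln (1 + T + s) - Y)"
  proof eventually_elim
    case (elim T)
    interpret lower_barrier T using elim by unfold_locales auto
    have sp: "?sp T = speed" by (simp add: speed_def \<kappa>_def)
    have "1 - e \<le> 1 - survival ramp (1 + T + s) (speed * T - 1 - Y0)"
      using front_lower_seed T by (intro s(2)) (auto simp: c0_def)
    moreover have "sqrt 2 * (1 + T + s) - 3 / (2 * sqrt 2) * ln (1 + T + s) - Y \<le> speed * T - 1 - Y0"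
      using elim unfolding sp Y_def by linarith
    ultimately show ?case using survival_ramp_mono[of _ "speed * T - 1 - Y0" "1 + T + s"] by fastforce
  qed
  moreover have "filterlim (\<lambda>t. t - 1 - s) at_top at_top" by real_asymp
  ultimately have "\<forall>\<^sub>F t in at_top. 1 - e \<le> 1 - survival ramp (1 + (t - 1 - s) + s)
      (sqrt 2 * (1 + (t - 1 - s) + s) - 3 / (2 * sqrt 2) * ln (1 + (t - 1 - s) + s) - Y)"
    by (rule eventually_compose_filterlim)
  then show ?thesis by (intro exI[of _ Y]) simp
qed

section \<open>Branching particles\<close>

abbreviation path_space :: "(real \<Rightarrow> real) measure" where
  "path_space \<equiv> \<Pi>\<^sub>M s\<in>{0..}. borel"

abbreviation mark_space :: "(real \<times> (real \<Rightarrow> real)) measure" where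
  "mark_space \<equiv> borel \<Otimes>\<^sub>M path_space"

text \<open>
  Evaluating a path at a random time is not measurable on the product space, but this limit is, and
  it agrees with the evaluation for continuous paths.
\<close>

definition path_eval :: "real \<Rightarrow> (real \<Rightarrow> real) \<Rightarrow> real" where
  "path_eval s \<beta> = lim (\<lambda>k. \<beta> (max 0 (of_int \<lceil>2 ^ k * s\<rceil> / 2 ^ k)))"

lemma path_eval_measurable [measurable]:
  "case_prod path_eval \<in> borel_measurable (borel \<Otimes>\<^sub>M path_space)"
proof -
  have "(\<lambda>x. snd x (max 0 (of_int \<lceil>2 ^ k * (fst x :: real)\<rceil> / 2 ^ k))) \<in> borel_measurable (borel \<Otimes>\<^sub>M path_space)"
    for k :: nat
  \<comment> \<open>At a fixed dyadic level the index takes countably many values, and for each of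
    them the evaluation is a coordinate map.\<close>
  proof (rule measurable_compose_countable[where g = "\<lambda>x. \<lceil>2 ^ k * (fst x :: real)\<rceil>"])
    fix i :: int
    have [measurable]: "(\<lambda>\<beta>. \<beta> (max 0 (of_int i / 2 ^ k))) \<in> borel_measurable path_space"
      by (rule measurable_component_singleton) simp
    show "(\<lambda>x. snd x (max 0 (of_int i / 2 ^ k))) \<in> borel_measurable (borel \<Otimes>\<^sub>M path_space)"
      by measurable
  qed measurable
  then show ?thesis
    unfolding path_eval_def case_prod_beta by (rule borel_measurable_lim_metric)
qed

lemma path_eval_eq:
  assumes \<beta>: "continuous_on {0..} \<beta>" and s: "0 \<le> s"
  shows "path_eval s (restrict \<beta> {0..}) = \<beta> s"
proof -
  let ?q = "\<lambda>k::nat. of_int \<lceil>2 ^ k * s\<rceil> / 2 ^ k :: real"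
  have q: "s \<le> ?q k" "?q k \<le> s + (1 / 2) ^ k" for k
  proof -
    have "2 ^ k * s \<le> of_int \<lceil>2 ^ k * s\<rceil>" "of_int \<lceil>2 ^ k * s\<rceil> \<le> 2 ^ k * s + 1" by linarith+
    then show "s \<le> ?q k" "?q k \<le> s + (1 / 2) ^ k" by (simp_all add: field_simps power_one_over)
  qed
  have "(\<lambda>k. s + (1 / 2) ^ k) \<longlonglongrightarrow> s + 0" by (intro tendsto_intros LIMSEQ_power_zero) auto
  then have lim: "?q \<longlonglongrightarrow> s"
    by (intro tendsto_sandwich[of "\<lambda>_. s" ?q sequentially "\<lambda>k. s + (1 / 2) ^ k"]) (auto simp: q)
  have q0: "0 \<le> ?q k" for k using q(1)[of k] s by linarith
  have "(\<lambda>k. \<beta> (?q k)) \<longlonglongrightarrow> \<beta> s"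
    by (rule continuous_on_tendsto_compose[OF \<beta> lim]) (use s q0 in auto)
  moreover have "restrict \<beta> {0..} (max 0 (?q k)) = \<beta> (?q k)" for k
    using q0[of k] by (simp add: max_absorb2)
  ultimately show ?thesis unfolding path_eval_def by (simp add: limI)
qed

text \<open>The random variable behind \<open>surv\<close>: the product of g over the living
  particles in the first n generations of the subtree of w, with remaining time t and birth place x,
  as a function of the marks alone.\<close>

primrec no_hit :: "(real \<Rightarrow> real) \<Rightarrow> nat \<Rightarrow> particle \<Rightarrow> real \<Rightarrow> real \<Rightarrow>
    (particle \<Rightarrow> real \<times> (real \<Rightarrow> real)) \<Rightarrow> real" where
  "no_hit g 0 w t x y = 1"
| "no_hit g (Suc n) w t x y = (if t < fst (y w) then g \<bar>x + path_eval t (snd (y w))\<bar>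
    else no_hit g n (False # w) (t - fst (y w)) \<bar>x + path_eval (fst (y w)) (snd (y w))\<bar> y
      * no_hit g n (True # w) (t - fst (y w)) \<bar>x + path_eval (fst (y w)) (snd (y w))\<bar> y)"

definition descendants :: "particle \<Rightarrow> particle set" where
  "descendants w = range (\<lambda>v. v @ w)"

lemma descendants_Cons: "descendants (i # w) \<subseteq> descendants w - {w}"
  by (auto simp: descendants_def)

lemma descendants_self: "w \<in> descendants w"
  unfolding descendants_def by (metis append_Nil rangeI)

lemma descendants_disjoint: "descendants (False # w) \<inter> descendants (True # w) = {}"
proof -
  have False if "v @ False # w = v' @ True # w" for v v'
  proof -
    have "length v = length v'" using arg_cong[OF that, of length] by simp
    then show False using that by simp
  qed
  then show ?thesis by (auto simp: descendants_def)
qed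

text \<open>Dependence on the subtree's marks only is what turns independence of disjoint families
  of marks into independence of the two child subtrees.\<close>

lemma no_hit_local:
  assumes "descendants w \<subseteq> A"
  shows "no_hit g n w t x (restrict y A) = no_hit g n w t x y"
  using assms
proof (induction n arbitrary: w t x)
  case (Suc n)
  then have "w \<in> A" "descendants (False # w) \<subseteq> A" "descendants (True # w) \<subseteq> A"
    using descendants_self descendants_Cons by blast+
  then show ?case using Suc.IH by simp
qed simp

context initial_value
begin

lemma no_hit_measurable [measurable (raw)]:
  assumes "descendants w \<subseteq> A"
  shows "(\<lambda>p. no_hit g n w (fst p) (fst (snd p)) (snd (snd p)))
    \<in> borel_measurable (borel \<Otimes>\<^sub>M (borel \<Otimes>\<^sub>M (\<Pi>\<^sub>M u\<in>A. mark_space)))"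
  using assms
proof (induction n arbitrary: w)
  case (Suc n)
  have w: "w \<in> A" "descendants (False # w) \<subseteq> A" "descendants (True # w) \<subseteq> A"
    using Suc.prems descendants_self descendants_Cons by blast+
  let ?N = "borel \<Otimes>\<^sub>M (borel \<Otimes>\<^sub>M (\<Pi>\<^sub>M u\<in>A. mark_space)) :: (real \<times> real \<times> (particle \<Rightarrow> real \<times> (real \<Rightarrow> real))) measure"
  have [measurable]: "(\<lambda>y. y w) \<in> measurable (\<Pi>\<^sub>M u\<in>A. mark_space) mark_space"
    by (rule measurable_component_singleton[OF w(1)])
  have comp: "(\<lambda>p. no_hit g n v (f p) (h p) (snd (snd p))) \<in> borel_measurable ?N"
    if "descendants v \<subseteq> A" and [measurable]: "f \<in> borel_measurable ?N" "h \<in> borel_measurable ?N" for v f h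
  proof -
    have "(\<lambda>p. (f p, h p, snd (snd p))) \<in> measurable ?N ?N" by measurable
    from measurable_compose[OF this Suc.IH[OF that(1)]] show ?thesis by simp
  qed
  have [measurable]:
    "(\<lambda>p. no_hit g n v (fst p - fst (snd (snd p) w))
      \<bar>fst (snd p) + path_eval (fst (snd (snd p) w)) (snd (snd (snd p) w))\<bar> (snd (snd p))) \<in> borel_measurable ?N"
    if "descendants v \<subseteq> A" for v
    by (rule comp[OF that]) measurable
  note m = this[OF w(2)] this[OF w(3)]
  show ?case unfolding no_hit.simps using m by measurable
qed simp

lemma no_hit_measurable':
  assumes "descendants w \<subseteq> A" "f \<in> borel_measurable N" "h \<in> borel_measurable N" "Y \<in> measurable N (\<Pi>\<^sub>M u\<in>A. mark_space)"
  shows "(\<lambda>\<omega>. no_hit g n w (f \<omega>) (h \<omega>) (Y \<omega>)) \<in> borel_measurable N"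
  using measurable_compose[OF measurable_Pair[OF assms(2) measurable_Pair[OF assms(3,4)]] no_hit_measurable[OF assms(1)]]
  by simp

lemma no_hit_bounds: "0 \<le> no_hit g n w t x y \<and> no_hit g n w t x y \<le> 1"
  by (induction n arbitrary: w t x) (auto simp: g_nonneg g_le1 intro: mult_le_one)

end

text \<open>Freezes one of two independent variables. Independence is phrased by generated
  sigma-algebras because a lifetime and a path have different types.\<close>

lemma (in prob_space) indep_set_expectation:
  fixes h :: "'b \<times> 'c \<Rightarrow> real"
  assumes X[measurable]: "X \<in> measurable M S" and Y[measurable]: "Y \<in> measurable M N"
    and ind: "indep_set (sets (vimage_algebra (space M) X S)) (sets (vimage_algebra (space M) Y N))"
    and h[measurable]: "h \<in> borel_measurable (S \<Otimes>\<^sub>M N)" and "\<And>p. \<bar>h p\<bar> \<le> c"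
  shows "(\<integral>\<omega>. h (X \<omega>, Y \<omega>) \<partial>M) = (\<integral>\<omega>'. (\<integral>\<omega>. h (X \<omega>', Y \<omega>) \<partial>M) \<partial>M)"
proof -
  interpret X: prob_space "distr M S X" by (rule prob_space_distr) simp
  interpret Y: prob_space "distr M N Y" by (rule prob_space_distr) simp
  interpret XY: pair_prob_space "distr M S X" "distr M N Y" ..
  have "(\<integral>\<omega>. h (X \<omega>, Y \<omega>) \<partial>M) = (\<integral>p. h p \<partial>distr M (S \<Otimes>\<^sub>M N) (\<lambda>\<omega>. (X \<omega>, Y \<omega>)))"
    by (subst integral_distr) auto
  also have "\<dots> = (\<integral>p. h p \<partial>(distr M S X \<Otimes>\<^sub>M distr M N Y))"
  proof (rule arg_cong[where f = "\<lambda>\<mu>. \<integral>p. h p \<partial>\<mu>"], rule pair_measure_eqI[symmetric])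
    fix A C assume A: "A \<in> sets (distr M S X)" and C: "C \<in> sets (distr M N Y)"
    have "prob ((X -` A \<inter> space M) \<inter> (Y -` C \<inter> space M)) = prob (X -` A \<inter> space M) * prob (Y -` C \<inter> space M)"
      using A C by (intro indep_setD[OF ind]) (auto simp: sets_vimage_algebra)
    moreover have "(\<lambda>\<omega>. (X \<omega>, Y \<omega>)) -` (A \<times> C) \<inter> space M = (X -` A \<inter> space M) \<inter> (Y -` C \<inter> space M)"
      by auto
    ultimately show "emeasure (distr M S X) A * emeasure (distr M N Y) C
        = emeasure (distr M (S \<Otimes>\<^sub>M N) (\<lambda>\<omega>. (X \<omega>, Y \<omega>))) (A \<times> C)"
      using A C by (simp add: emeasure_distr emeasure_eq_measure ennreal_mult)
  qed (auto intro: X.sigma_finite_measure_axioms Y.sigma_finite_measure_axioms)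
  also have "\<dots> = (\<integral>x. (\<integral>y. h (x, y) \<partial>distr M N Y) \<partial>distr M S X)"
    by (rule XY.integral_fst'[symmetric]) (rule XY.integrable_const_bound[of _ c], use assms in auto)
  also have "\<dots> = (\<integral>\<omega>'. (\<integral>y. h (X \<omega>', y) \<partial>distr M N Y) \<partial>M)"
    by (subst integral_distr) auto
  also have "\<dots> = (\<integral>\<omega>'. (\<integral>\<omega>. h (X \<omega>', Y \<omega>) \<partial>M) \<partial>M)"
    by (intro Bochner_Integration.integral_cong refl) (subst integral_distr, auto dest: measurable_space)
  finally show ?thesis .
qed

section \<open>From the particle system to the recursion\<close>

context branching_reflected_brownian_motion
begin

definition path :: "particle \<Rightarrow> 'w \<Rightarrow> real \<Rightarrow> real" where
  "path u \<omega> = (\<lambda>s\<in>{0..}. B u s \<omega>)"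

definition mark :: "particle \<Rightarrow> 'w \<Rightarrow> real \<times> (real \<Rightarrow> real)" where
  "mark u \<omega> = (T u \<omega>, path u \<omega>)"

lemma marks_independent: "indep_vars (\<lambda>_. mark_space) (\<lambda>u \<omega>. mark u \<omega>) UNIV"
  using particles_independent unfolding mark_def path_def .

lemma mark_measurable [measurable]: "mark u \<in> measurable M mark_space"
  using marks_independent by (auto simp: indep_vars_def)

lemma T_measurable [measurable]: "T u \<in> borel_measurable M"
  using measurable_compose[OF mark_measurable measurable_fst, of u] by (simp add: mark_def)

lemma path_measurable [measurable]: "path u \<in> measurable M path_space"
  using measurable_compose[OF mark_measurable measurable_snd, of u] by (simp add: mark_def)

lemma path_eval_path:
  assumes "\<omega> \<in> space M" "0 \<le> s"
  shows "path_eval s (path u \<omega>) = B u s \<omega>"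
  unfolding path_def
  using standard_brownian_motion.continuous_paths[OF motion_brownian assms(1), of u] assms(2)
  by (rule path_eval_eq)

lemma expectation_path:
  fixes f :: "real \<Rightarrow> real"
  assumes [measurable]: "f \<in> borel_measurable borel" and s: "0 \<le> s"
  shows "(\<integral>\<omega>. f (path_eval s (path u \<omega>)) \<partial>M) = (\<integral>k. f (sqrt s * k) \<partial>gauss)"
proof -
  interpret bm: standard_brownian_motion M "B u" by (rule motion_brownian)
  have eq: "(\<integral>\<omega>. f (path_eval s (path u \<omega>)) \<partial>M) = (\<integral>\<omega>. f (B u s \<omega> - B u 0 \<omega>) \<partial>M)"
    using s by (intro Bochner_Integration.integral_cong refl) (simp add: path_eval_path bm.starts_at_0)
  show ?thesis
  proof (cases "s = 0")
    case True
    then show ?thesis unfolding eq by (simp add: prob_space)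
  next
    case False
    then show ?thesis unfolding eq
      using integral_normal_gauss[of f s M "\<lambda>\<omega>. B u s \<omega> - B u 0 \<omega>"] bm.normal_increments[of 0 s] s by simp
  qed
qed

lemma expectation_lifetime:
  fixes f :: "real \<Rightarrow> real"
  assumes [measurable]: "f \<in> borel_measurable borel"
  shows "(\<integral>\<omega>. f (T u \<omega>) \<partial>M) = (\<integral>\<tau>. f \<tau> \<partial>expo)"
proof -
  have "distr M lborel (T u) = expo"
    using lifetime_exponential[of u] by (simp add: distributed_def expo_def)
  then have "(\<integral>\<tau>. f \<tau> \<partial>expo) = (\<integral>\<tau>. f \<tau> \<partial>distr M lborel (T u))" by simp
  also have "\<dots> = (\<integral>\<omega>. f (T u \<omega>) \<partial>M)" by (rule integral_distr) auto
  finally show ?thesis by simp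
qed

text \<open>With the lifetime frozen by independence, the path is evaluated at a deterministic time,
  where it is Gaussian.\<close>

lemma expectation_mark:
  assumes [measurable]: "case_prod Q \<in> borel_measurable (borel \<Otimes>\<^sub>M borel)" "f \<in> borel_measurable borel"
    and bd: "\<And>a b. 0 \<le> Q a b \<and> Q a b \<le> 1" "\<And>a. 0 \<le> f a \<and> f a \<le> 1" and t: "0 \<le> t"
  shows "(\<integral>\<omega>. (if t < T u \<omega> then f (x + path_eval t (path u \<omega>))
      else (Q (t - T u \<omega>) (x + path_eval (T u \<omega>) (path u \<omega>)))\<^sup>2) \<partial>M)
    = branch_step f Q t x"
proof -
  let ?h = "\<lambda>(\<tau>, \<beta>). if t < \<tau> then f (x + path_eval t \<beta>) else (Q (t - \<tau>) (x + path_eval \<tau> \<beta>))\<^sup>2"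
  let ?H = "\<lambda>\<tau> k. if t < \<tau> then f (x + sqrt t * k) else (Q (t - \<tau>) (x + sqrt \<tau> * k))\<^sup>2"
  have "(\<integral>\<omega>. ?h (T u \<omega>, path u \<omega>) \<partial>M) = (\<integral>\<omega>'. (\<integral>\<omega>. ?h (T u \<omega>', path u \<omega>) \<partial>M) \<partial>M)"
  proof (rule indep_set_expectation[where c = 1])
    show "indep_set (sets (vimage_algebra (space M) (T u) borel)) (sets (vimage_algebra (space M) (path u) path_space))"
      using lifetime_motion_independent[of u] unfolding path_def[abs_def] .
  qed (measurable, use bd in \<open>auto simp: power_le_one\<close>)
  also have "\<dots> = (\<integral>\<omega>'. (\<integral>k. ?H (T u \<omega>') k \<partial>gauss) \<partial>M)"
  proof (rule Bochner_Integration.integral_cong[OF refl])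
    fix \<omega>' assume "\<omega>' \<in> space M"
    then have pos: "0 < T u \<omega>'" by (rule lifetime_pos)
    show "(\<integral>\<omega>. ?h (T u \<omega>', path u \<omega>) \<partial>M) = (\<integral>k. ?H (T u \<omega>') k \<partial>gauss)"
    proof (cases "t < T u \<omega>'")
      case True
      then show ?thesis using expectation_path[of "\<lambda>b. f (x + b)" t u] t by simp
    next
      case False
      then show ?thesis
        using expectation_path[of "\<lambda>b. (Q (t - T u \<omega>') (x + b))\<^sup>2" "T u \<omega>'" u] pos by simp
    qed
  qed
  also have "\<dots> = (\<integral>\<tau>. (\<integral>k. ?H \<tau> k \<partial>gauss) \<partial>expo)"
    by (rule expectation_lifetime) measurable
  also have "\<dots> = branch_step f Q t x"
    unfolding branch_step_def
    by (subst integral_clock_noise[of _ 1]) (use bd in \<open>auto simp: power_le_one cong: if_cong\<close>)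
  finally show ?thesis by simp
qed

lemma expectation_no_hit:
  assumes "initial_value g" and even: "\<And>x. g \<bar>x\<bar> = g x" and "0 \<le> t"
  shows "(\<integral>\<omega>. no_hit g n w t x (\<lambda>u. mark u \<omega>) \<partial>M) = surv g n t x"
  using assms(3)
proof (induction n arbitrary: w t x)
  case 0
  then show ?case by (simp add: prob_space)
next
  case (Suc n)
  interpret g: initial_value g by fact
  have abs: "surv g n r \<bar>z\<bar> = surv g n r z" for r z
  proof (cases "0 \<le> z")
    case False
    have "(\<lambda>x. g (0 - x)) = g"
    proof
      fix x show "g (0 - x) = g x" using even[of x] even[of "- x"] by simp
    qed
    then have "surv g n r z = surv g n r (0 - z)"
      using surv_reflect[OF assms(1), of 0 n r z] by simp
    then show ?thesis using False by simp
  qed simp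
  let ?R = "descendants w - {w}"
  let ?PM = "\<lambda>A. \<Pi>\<^sub>M u\<in>A. mark_space"
  let ?h = "\<lambda>(m, y). if t < fst m then g \<bar>x + path_eval t (snd m)\<bar>
    else no_hit g n (False # w) (t - fst m) \<bar>x + path_eval (fst m) (snd m)\<bar> y
      * no_hit g n (True # w) (t - fst m) \<bar>x + path_eval (fst m) (snd m)\<bar> y"
  let ?h' = "\<lambda>(y', y). ?h (y' w, y)"
  have sub: "descendants (i # w) \<subseteq> ?R" for i by (rule descendants_Cons)
  have ind: "indep_set (sets (vimage_algebra (space M) (\<lambda>\<omega>. \<lambda>u\<in>{w}. mark u \<omega>) (?PM {w})))
      (sets (vimage_algebra (space M) (\<lambda>\<omega>. \<lambda>u\<in>?R. mark u \<omega>) (?PM ?R)))"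
  proof -
    have "indep_var (?PM {w}) (\<lambda>\<omega>. \<lambda>u\<in>{w}. mark u \<omega>) (?PM ?R) (\<lambda>\<omega>. \<lambda>u\<in>?R. mark u \<omega>)"
      by (rule indep_var_restrict[OF marks_independent]) auto
    then show ?thesis by (simp add: indep_var_eq sets_vimage_algebra)
  qed
  have meas: "(\<lambda>\<omega>. no_hit g n v s z (\<lambda>u\<in>A. mark u \<omega>)) \<in> borel_measurable M" if "descendants v \<subseteq> A" for v s z A
    by (rule g.no_hit_measurable'[OF that]) measurable
  have "(\<integral>\<omega>. no_hit g (Suc n) w t x (\<lambda>u. mark u \<omega>) \<partial>M)
      = (\<integral>\<omega>. ?h' (\<lambda>u\<in>{w}. mark u \<omega>, \<lambda>u\<in>?R. mark u \<omega>) \<partial>M)"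
    by (intro Bochner_Integration.integral_cong refl) (simp add: no_hit_local[OF sub])
  \<comment> \<open>The mark of w is independent of the marks of its proper descendants and is
    frozen.\<close>
  also have "\<dots> = (\<integral>\<omega>'. (\<integral>\<omega>. ?h' (\<lambda>u\<in>{w}. mark u \<omega>', \<lambda>u\<in>?R. mark u \<omega>) \<partial>M) \<partial>M)"
  proof (rule indep_set_expectation[OF _ _ ind, where c = 1])
    have [measurable]: "(\<lambda>y. y w) \<in> measurable (?PM {w}) mark_space"
      by (rule measurable_component_singleton) simp
    have [measurable]: "(\<lambda>p. no_hit g n (i # w) (t - fst (fst p w)) \<bar>x + path_eval (fst (fst p w)) (snd (fst p w))\<bar> (snd p))
        \<in> borel_measurable (?PM {w} \<Otimes>\<^sub>M ?PM ?R)" for i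
      by (rule g.no_hit_measurable'[OF sub]) measurable
    show "?h' \<in> borel_measurable (?PM {w} \<Otimes>\<^sub>M ?PM ?R)"
      unfolding case_prod_beta fst_conv snd_conv by measurable
    show "(\<lambda>\<omega>. \<lambda>u\<in>{w}. mark u \<omega>) \<in> measurable M (?PM {w})"
      "(\<lambda>\<omega>. \<lambda>u\<in>?R. mark u \<omega>) \<in> measurable M (?PM ?R)"
      by measurable
    show "\<bar>?h' p\<bar> \<le> 1" for p
      using g.no_hit_bounds by (auto simp: case_prod_beta g.g_nonneg g.g_le1 abs_mult intro!: mult_le_one)
  qed
  also have "\<dots> = (\<integral>\<omega>'. (if t < T w \<omega>' then g (x + path_eval t (path w \<omega>'))
      else (surv g n (t - T w \<omega>') (x + path_eval (T w \<omega>') (path w \<omega>')))\<^sup>2) \<partial>M)"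
  proof (rule Bochner_Integration.integral_cong[OF refl])
    fix \<omega>' assume "\<omega>' \<in> space M"
    show "(\<integral>\<omega>. ?h' (\<lambda>u\<in>{w}. mark u \<omega>', \<lambda>u\<in>?R. mark u \<omega>) \<partial>M) = (if t < T w \<omega>' then g (x + path_eval t (path w \<omega>'))
      else (surv g n (t - T w \<omega>') (x + path_eval (T w \<omega>') (path w \<omega>')))\<^sup>2)"
    proof (cases "t < T w \<omega>'")
      case True
      then show ?thesis by (simp add: mark_def even prob_space)
    next
      case False
      let ?s = "t - T w \<omega>'" and ?z = "\<bar>x + path_eval (T w \<omega>') (path w \<omega>')\<bar>"
      let ?N = "\<lambda>i \<omega>. no_hit g n (i # w) ?s ?z (\<lambda>u. mark u \<omega>)"
      have loc: "?N i \<omega> = no_hit g n (i # w) ?s ?z (\<lambda>u\<in>descendants (i # w). mark u \<omega>)" for i \<omega>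
        by (simp add: no_hit_local)
      have "indep_var (?PM (descendants (False # w))) (\<lambda>\<omega>. \<lambda>u\<in>descendants (False # w). mark u \<omega>)
          (?PM (descendants (True # w))) (\<lambda>\<omega>. \<lambda>u\<in>descendants (True # w). mark u \<omega>)"
        by (rule indep_var_restrict[OF marks_independent]) (auto simp: descendants_disjoint)
      moreover have "no_hit g n v ?s ?z \<in> borel_measurable (?PM (descendants v))" for v
        by (rule g.no_hit_measurable'[OF subset_refl]) measurable
      ultimately have ind': "indep_var borel (?N False) borel (?N True)"
        unfolding loc using indep_var_compose[unfolded comp_def] by blast
      have int: "integrable M (?N i)" for i
        using g.no_hit_bounds[of n "i # w"] meas[of "i # w" "descendants (i # w)"]
        by (intro integrable_const_bound[of _ 1]) (auto simp: loc)
      have "(\<integral>\<omega>. ?h' (\<lambda>u\<in>{w}. mark u \<omega>', \<lambda>u\<in>?R. mark u \<omega>) \<partial>M) = (\<integral>\<omega>. ?N False \<omega> * ?N True \<omega> \<partial>M)"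
        using False by (simp add: mark_def[of w \<omega>'] no_hit_local[OF sub])
      also have "\<dots> = (\<integral>\<omega>. ?N False \<omega> \<partial>M) * (\<integral>\<omega>. ?N True \<omega> \<partial>M)"
        by (rule indep_var_lebesgue_integral[OF ind' int int])
      also have "\<dots> = (surv g n ?s ?z)\<^sup>2"
        using False by (simp add: Suc.IH power2_eq_square)
      finally show ?thesis using False by (simp add: abs)
    qed
  qed
  also have "\<dots> = surv g (Suc n) t x"
    using Suc.prems by (subst expectation_mark) (auto simp: g.surv_bounds g.g_nonneg g.g_le1)
  finally show ?case .
qed

lemma birth_time_mono: "\<omega> \<in> space M \<Longrightarrow> birth_time T w \<omega> \<le> birth_time T (v @ w) \<omega>"
  by (induction v) (auto intro: add_increasing2 less_imp_le lifetime_pos)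

lemma birth_time_measurable [measurable]: "birth_time T w \<in> borel_measurable M"
proof (induction w)
  case (Cons i w)
  have "birth_time T (i # w) = (\<lambda>\<omega>. birth_time T w \<omega> + T w \<omega>)" by auto
  then show ?case using Cons by simp
qed (simp add: fun_eq_iff[symmetric] birth_time.simps(1)[abs_def])

lemma descendant_not_alive:
  assumes "\<omega> \<in> space M" "t < birth_time T w \<omega> + T w \<omega>" "v \<noteq> []"
  shows "v @ w \<notin> alive T t \<omega>"
proof -
  obtain v' i where v: "v = v' @ [i]" using assms(3) by (metis rev_exhaust)
  have "birth_time T w \<omega> + T w \<omega> \<le> birth_time T (v' @ (i # w)) \<omega>"
    using birth_time_mono[OF assms(1), of "i # w" v'] by simp
  then show ?thesis using assms(2) by (auto simp: alive_def v)
qed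

lemma no_hit_position:
  assumes \<omega>: "\<omega> \<in> space M" and "birth_time T w \<omega> \<le> t"
  shows "no_hit (\<lambda>y. if \<bar>y\<bar> \<le> z then 1 else 0) n w (t - birth_time T w \<omega>) (birth_place T B w \<omega>) (\<lambda>u. mark u \<omega>)
    = (if \<exists>v. length v < n \<and> v @ w \<in> alive T t \<omega> \<and> z < position T B (v @ w) t \<omega> then 0 else 1)"
  using assms(2)
proof (induction n arbitrary: w)
  case (Suc n)
  let ?g = "\<lambda>y. if \<bar>y\<bar> \<le> z then 1 else 0 :: real"
  let ?P = "\<lambda>n w. \<exists>v. length v < n \<and> v @ w \<in> alive T t \<omega> \<and> z < position T B (v @ w) t \<omega>"
  let ?b = "birth_time T w \<omega>"
  have path: "path_eval s (path w \<omega>) = B w s \<omega>" if "0 \<le> s" for s by (rule path_eval_path[OF \<omega> that])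
  show ?case
  proof (cases "t < ?b + T w \<omega>")
    case True
    have "?P (Suc n) w \<longleftrightarrow> z < position T B w t \<omega>"
    proof
      assume "?P (Suc n) w"
      then show "z < position T B w t \<omega>" using descendant_not_alive[OF \<omega> True] by (metis append_Nil)
    next
      assume "z < position T B w t \<omega>"
      moreover have "w \<in> alive T t \<omega>" using True Suc.prems by (simp add: alive_def)
      ultimately show "?P (Suc n) w" by (intro exI[of _ "[]"]) simp
    qed
    then show ?thesis
      using True Suc.prems by (simp add: mark_def path position_def reflected_path_def not_le)
  next
    case False
    \<comment> \<open>Words grow at the front, so the last letter of v tells through which child of
      w the lineage passes.\<close>
    have "?P (Suc n) w \<longleftrightarrow> ?P n (False # w) \<or> ?P n (True # w)"
    proof
      assume "?P (Suc n) w"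
      then obtain v where v: "length v < Suc n" "v @ w \<in> alive T t \<omega>" "z < position T B (v @ w) t \<omega>" by auto
      then have "v \<noteq> []" using False by (auto simp: alive_def)
      then obtain v' i where "v = v' @ [i]" by (metis rev_exhaust)
      with v show "?P n (False # w) \<or> ?P n (True # w)" by (cases i) auto
    next
      assume "?P n (False # w) \<or> ?P n (True # w)"
      then obtain v i where "length v < n \<and> v @ (i # w) \<in> alive T t \<omega> \<and> z < position T B (v @ (i # w)) t \<omega>"
        by blast
      then show "?P (Suc n) w" by (intro exI[of _ "v @ [i]"]) simp
    qed
    note iff = this
    have IH: "no_hit ?g n (i # w) (t - ?b - T w \<omega>) \<bar>birth_place T B w \<omega> + B w (T w \<omega>) \<omega>\<bar> (\<lambda>u. mark u \<omega>)
        = (if ?P n (i # w) then 0 else 1)" for i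
      using Suc.IH[of "i # w"] False by (simp add: reflected_path_def diff_diff_eq)
    have step: "no_hit ?g (Suc n) w (t - ?b) (birth_place T B w \<omega>) (\<lambda>u. mark u \<omega>)
        = no_hit ?g n (False # w) (t - ?b - T w \<omega>) \<bar>birth_place T B w \<omega> + B w (T w \<omega>) \<omega>\<bar> (\<lambda>u. mark u \<omega>)
        * no_hit ?g n (True # w) (t - ?b - T w \<omega>) \<bar>birth_place T B w \<omega> + B w (T w \<omega>) \<omega>\<bar> (\<lambda>u. mark u \<omega>)"
      using False less_imp_le[OF lifetime_pos[OF \<omega>, of w]] by (simp add: mark_def path)
    have "(if a then 0 else 1) * (if b then 0 else 1) = (if a \<or> b then 0 else 1 :: real)" for a b
      by simp
    then show ?thesis unfolding step IH iff .
  qed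
qed simp

text \<open>Unlike the event for \<open>Max\<close>, this one is a decreasing intersection over
  generations, so its probability is the limit of \<open>surv\<close>.\<close>

definition below :: "real \<Rightarrow> real \<Rightarrow> 'w set" where
  "below t z = {\<omega> \<in> space M. \<forall>u\<in>alive T t \<omega>. position T B u t \<omega> \<le> z}"

lemma initial_value_indicator: "initial_value (\<lambda>y. if \<bar>y\<bar> \<le> z then 1 else 0)"
  by unfold_locales auto

lemma prob_below:
  assumes "0 \<le> t"
  shows "below t z \<in> events" "prob (below t z) = survival (\<lambda>y. if \<bar>y\<bar> \<le> z then 1 else 0) t 0"
proof -
  let ?g = "\<lambda>y. if \<bar>y\<bar> \<le> z then 1 else 0 :: real"
  interpret g: initial_value ?g by (rule initial_value_indicator)
  define E where "E n = {\<omega> \<in> space M. no_hit ?g n [] t 0 (\<lambda>u. mark u \<omega>) = 1}" for n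
  have E: "E n = {\<omega> \<in> space M. \<forall>v. length v < n \<longrightarrow> v \<in> alive T t \<omega> \<longrightarrow> position T B v t \<omega> \<le> z}" for n
  proof -
    have "no_hit ?g n [] t 0 (\<lambda>u. mark u \<omega>) = 1 \<longleftrightarrow>
        (\<forall>v. length v < n \<longrightarrow> v \<in> alive T t \<omega> \<longrightarrow> position T B v t \<omega> \<le> z)" if "\<omega> \<in> space M" for \<omega>
    proof -
      have "no_hit ?g n [] t 0 (\<lambda>u. mark u \<omega>)
          = (if \<exists>v. length v < n \<and> v \<in> alive T t \<omega> \<and> z < position T B v t \<omega> then 0 else 1)"
        using no_hit_position[OF that, of "[]" t z n] assms by simp
      then show ?thesis by (auto simp: not_less split: if_splits)
    qed
    then show ?thesis unfolding E_def by blast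
  qed
  have meas: "(\<lambda>\<omega>. no_hit ?g n [] t 0 (\<lambda>u. mark u \<omega>)) \<in> borel_measurable M" for n
  proof -
    have "(\<lambda>\<omega>. no_hit ?g n [] t 0 (\<lambda>u\<in>UNIV. mark u \<omega>)) \<in> borel_measurable M"
      by (rule g.no_hit_measurable'[OF subset_UNIV]) measurable
    then show ?thesis unfolding no_hit_local[OF subset_UNIV] .
  qed
  then have events: "E n \<in> events" for n unfolding E_def by measurable
  have "prob (E n) = surv ?g n t 0" for n
  proof -
    have "prob (E n) = (\<integral>\<omega>. indicator (E n) \<omega> \<partial>M)" using events by simp
    also have "\<dots> = (\<integral>\<omega>. no_hit ?g n [] t 0 (\<lambda>u. mark u \<omega>) \<partial>M)"
      using no_hit_position[of _ "[]" t z n] assms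
      by (intro Bochner_Integration.integral_cong refl) (auto simp: E_def indicator_def)
    also have "\<dots> = surv ?g n t 0"
      by (rule expectation_no_hit[OF initial_value_indicator _ assms]) simp
    finally show ?thesis .
  qed
  moreover have "(\<lambda>n. prob (E n)) \<longlonglongrightarrow> prob (\<Inter>n. E n)"
  proof (rule finite_Lim_measure_decseq)
    show "range E \<subseteq> events" using events by blast
    show "decseq E" unfolding decseq_def E by (blast intro: order.strict_trans2)
  qed
  ultimately have "(\<lambda>n. surv ?g n t 0) \<longlonglongrightarrow> prob (\<Inter>n. E n)" by simp
  then have "prob (\<Inter>n. E n) = survival ?g t 0"
    using g.surv_tendsto by (rule LIMSEQ_unique)
  moreover have "(\<Inter>n. E n) = below t z" unfolding E below_def by blast
  moreover have "(\<Inter>n. E n) \<in> events" using events by (intro sets.countable_INT) auto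
  ultimately show "below t z \<in> events" "prob (below t z) = survival ?g t 0" by simp_all
qed

section \<open>Absence of explosion\<close>

definition ancestors :: "particle \<Rightarrow> particle set" where
  "ancestors w = (\<lambda>k. drop (Suc k) w) ` {..<length w}"

lemma ancestors_Cons: "ancestors (i # w) = insert w (ancestors w)" "w \<notin> ancestors w"
proof -
  have "{..<length (i # w)} = insert 0 (Suc ` {..<length w})"
    by (auto simp: lessThan_Suc_eq_insert_0)
  then show "ancestors (i # w) = insert w (ancestors w)"
    by (simp add: ancestors_def image_image)
  have "length u < length w" if "u \<in> ancestors w" for u
    using that by (auto simp: ancestors_def)
  then show "w \<notin> ancestors w" by blast
qed

lemma finite_ancestors: "finite (ancestors w)"
  by (simp add: ancestors_def)

lemma birth_time_ancestors: "exp (- 3 * birth_time T w \<omega>) = (\<Prod>u\<in>ancestors w. exp (- 3 * T u \<omega>))"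
proof (induction w)
  case (Cons i w)
  have "exp (- 3 * (birth_time T w \<omega> + T w \<omega>)) = exp (- 3 * T w \<omega>) * exp (- 3 * birth_time T w \<omega>)"
    by (simp add: exp_add[symmetric] distrib_left)
  then show ?case
    by (simp only: birth_time.simps ancestors_Cons prod.insert finite_ancestors Cons not_False_eq_True)
qed (simp add: ancestors_def)

lemma card_ancestors: "card (ancestors w) = length w"
  by (induction w) (simp_all add: ancestors_Cons finite_ancestors, simp add: ancestors_def)

text \<open>Exponential moment for a Chernoff bound. The parameter 3 gives 1 / 4 per generation,
  which beats the 2 ^ n words of length n.\<close>

lemma expectation_birth_time:
  "(\<integral>\<omega>. exp (- 3 * birth_time T w \<omega>) \<partial>M) = (1 / 4) ^ length w" "integrable M (\<lambda>\<omega>. exp (- 3 * birth_time T w \<omega>))"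
proof -
  have int: "integrable M (\<lambda>\<omega>. exp (- 3 * T u \<omega>))" for u
    by (rule integrable_const_bound[of _ 1]) (auto simp: less_imp_le[OF lifetime_pos])
  have "indep_vars (\<lambda>_. borel) (\<lambda>u \<omega>. exp (- 3 * fst (mark u \<omega>))) (ancestors w)"
    by (rule indep_vars_compose2[OF indep_vars_subset[OF marks_independent subset_UNIV]]) measurable
  then have ind: "indep_vars (\<lambda>_. borel) (\<lambda>u \<omega>. exp (- 3 * T u \<omega>)) (ancestors w)"
    by (simp add: mark_def)
  have lap: "(\<integral>\<omega>. exp (- 3 * T u \<omega>) \<partial>M) = 1 / 4" for u
    using expectation_lifetime[of "\<lambda>\<tau>. exp (- 3 * \<tau>)" u] expo_laplace(1)[of 3] by simp
  show "(\<integral>\<omega>. exp (- 3 * birth_time T w \<omega>) \<partial>M) = (1 / 4) ^ length w"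
    unfolding birth_time_ancestors indep_vars_lebesgue_integral[OF finite_ancestors ind int] lap
    by (simp only: prod_constant card_ancestors)
  show "integrable M (\<lambda>\<omega>. exp (- 3 * birth_time T w \<omega>))"
    unfolding birth_time_ancestors by (rule indep_vars_integrable[OF finite_ancestors ind int])
qed

lemma prob_birth_le: "prob {\<omega> \<in> space M. birth_time T w \<omega> \<le> t} \<le> exp (3 * t) * (1 / 4) ^ length w"
proof -
  let ?A = "{\<omega> \<in> space M. birth_time T w \<omega> \<le> t}"
  have "prob ?A = (\<integral>\<omega>. indicator ?A \<omega> \<partial>M)" by simp
  also have "\<dots> \<le> (\<integral>\<omega>. exp (3 * t) * exp (- 3 * birth_time T w \<omega>) \<partial>M)"
  proof (rule integral_mono)
    show "integrable M (\<lambda>\<omega>. indicator ?A \<omega> :: real)" by (simp add: emeasure_eq_measure)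
    show "integrable M (\<lambda>\<omega>. exp (3 * t) * exp (- 3 * birth_time T w \<omega>))"
      using expectation_birth_time(2)[of w] by (rule integrable_mult_right)
    show "indicator ?A \<omega> \<le> exp (3 * t) * exp (- 3 * birth_time T w \<omega>)" for \<omega>
      by (simp add: indicator_def exp_add[symmetric])
  qed
  also have "\<dots> = exp (3 * t) * (1 / 4) ^ length w"
    using expectation_birth_time by simp
  finally show ?thesis .
qed

lemma AE_generation_unborn: "AE \<omega> in M. \<exists>n. \<forall>w. length w = n \<longrightarrow> t < birth_time T w \<omega>"
proof -
  let ?A = "\<lambda>w. {\<omega> \<in> space M. birth_time T w \<omega> \<le> t}"
  define C where "C n = (\<Union>w\<in>{w. length w = n}. ?A w)" for n
  have fin: "finite {w :: particle. length w = n}" "card {w :: particle. length w = n} = 2 ^ n" for n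
    using finite_lists_length_eq[of "UNIV :: bool set" n] card_lists_length_eq[of "UNIV :: bool set" n] by auto
  have C: "C n \<in> events" for n unfolding C_def using fin(1) by (intro sets.finite_UN) auto
  have le: "prob (C n) \<le> exp (3 * t) * (1 / 2) ^ n" for n
  proof -
    have "prob (C n) \<le> (\<Sum>w\<in>{w. length w = n}. prob (?A w))"
      unfolding C_def using fin(1) by (intro finite_measure_subadditive_finite) auto
    also have "\<dots> \<le> (\<Sum>w\<in>{w :: particle. length w = n}. exp (3 * t) * (1 / 4) ^ n)"
      using prob_birth_le[of _ t] by (intro sum_mono) auto
    also have "\<dots> = exp (3 * t) * (2 ^ n * (1 / 4) ^ n)" using fin(2) by simp
    also have "\<dots> = exp (3 * t) * (1 / 2) ^ n" by (simp add: power_mult_distrib[symmetric])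
    finally show ?thesis .
  qed
  have lim: "(\<lambda>n. exp (3 * t) * (1 / 2) ^ n) \<longlonglongrightarrow> exp (3 * t) * 0"
    by (intro tendsto_intros LIMSEQ_power_zero) auto
  have "prob (\<Inter>n. C n) \<le> exp (3 * t) * (1 / 2) ^ n" for n
  proof (rule order.trans[OF _ le])
    show "prob (\<Inter>n. C n) \<le> prob (C n)" using C by (intro finite_measure_mono) auto
  qed
  then have "prob (\<Inter>n. C n) \<le> exp (3 * t) * 0"
    using LIMSEQ_le_const[OF lim, of "prob (\<Inter>n. C n)"] by blast
  then have "prob (\<Inter>n. C n) = 0" by (simp add: measure_le_0_iff)
  then have "(\<Inter>n. C n) \<in> null_sets M"
    using C by (intro null_setsI) (auto simp: emeasure_eq_measure)
  moreover have "{\<omega> \<in> space M. \<not> (\<exists>n. \<forall>w. length w = n \<longrightarrow> t < birth_time T w \<omega>)} \<subseteq> (\<Inter>n. C n)"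
    by (auto simp: C_def not_less)
  ultimately show ?thesis by (rule AE_I')
qed

lemma alive_finite_nonempty:
  assumes \<omega>: "\<omega> \<in> space M" and t: "0 \<le> t" and n: "\<And>w. length w = n \<Longrightarrow> t < birth_time T w \<omega>"
  shows "finite (alive T t \<omega>)" "alive T t \<omega> \<noteq> {}"
proof -
  have "length w < n" if "w \<in> alive T t \<omega>" for w
  proof (rule ccontr)
    assume "\<not> length w < n"
    then have "w = take (length w - n) w @ drop (length w - n) w" "length (drop (length w - n) w) = n" by auto
    then have "t < birth_time T w \<omega>"
      using n birth_time_mono[OF \<omega>] by (metis order_less_le_trans)
    then show False using that by (simp add: alive_def)
  qed
  then have "alive T t \<omega> \<subseteq> {w. set w \<subseteq> UNIV \<and> length w \<le> n}" by (auto intro: less_imp_le)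
  then show "finite (alive T t \<omega>)" by (rule finite_subset) (rule finite_lists_length_le, simp)
  show "alive T t \<omega> \<noteq> {}"
  proof
    assume "alive T t \<omega> = {}"
    \<comment> \<open>With nobody alive, every particle born by time t has also split by then, so
      all words are born.\<close>
    then have "birth_time T w \<omega> \<le> t" for w
      by (induction w) (use t in \<open>auto simp: alive_def not_less\<close>)
    then show False using n[of "replicate n False"] by (simp add: not_less[symmetric])
  qed
qed

section \<open>Measurability and distribution of the maximum\<close>

lemma alive_measurable [measurable]: "Measurable.pred M (\<lambda>\<omega>. u \<in> alive T t \<omega>)"
  unfolding alive_def by measurable

lemma birth_place_measurable [measurable]: "birth_place T B w \<in> borel_measurable M"
proof (induction w)
  case (Cons i w)
  have "(\<lambda>\<omega>. \<bar>birth_place T B w \<omega> + path_eval (T w \<omega>) (path w \<omega>)\<bar>) \<in> borel_measurable M"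
    using Cons by measurable
  then show ?case
    by (rule measurable_cong[THEN iffD1, rotated])
      (simp add: reflected_path_def path_eval_path less_imp_le[OF lifetime_pos])
qed simp

text \<open>For a particle that is not alive the position is of no interest, and its value is replaced
  by 0, because the driving motion is not known to be measurable at negative times.\<close>

lemma position_measurable [measurable]:
  "(\<lambda>\<omega>. if u \<in> alive T t \<omega> then position T B u t \<omega> else 0) \<in> borel_measurable M"
proof -
  have "(\<lambda>\<omega>. if u \<in> alive T t \<omega> then
      \<bar>birth_place T B u \<omega> + path_eval (t - birth_time T u \<omega>) (path u \<omega>)\<bar> else 0) \<in> borel_measurable M"
    by measurable
  then show ?thesis
    by (rule measurable_cong[THEN iffD1, rotated])
      (auto simp: position_def reflected_path_def path_eval_path alive_def)
qed

text \<open>The measure may be incomplete, so agreement with \<open>below\<close> off a null set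
  does not give measurability; the exceptional outcomes have to be described explicitly.\<close>

lemma max_displacement_event:
  assumes t: "0 \<le> t"
  shows "{\<omega> \<in> space M. max_displacement T B t \<omega> \<le> z} \<in> events"
proof -
  let ?p = "\<lambda>u \<omega>. if u \<in> alive T t \<omega> then position T B u t \<omega> else 0"
  \<comment> \<open>\<open>Max\<close> depends on the set of positions, so finiteness of that image
    counts, not of the set of particles. Quantifying over lists of words keeps the condition a
    countable one.\<close>
  define fin where "fin \<omega> \<longleftrightarrow> (\<exists>us :: particle list. (\<forall>u\<in>set us. u \<in> alive T t \<omega>) \<and>
      (\<forall>v. v \<in> alive T t \<omega> \<longrightarrow> (\<exists>u\<in>set us. ?p v \<omega> = ?p u \<omega>)))" for \<omega>
  have fin_iff: "fin \<omega> \<longleftrightarrow> finite ((\<lambda>u. position T B u t \<omega>) ` alive T t \<omega>)" (is "_ \<longleftrightarrow> finite ?I") for \<omega>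
  proof
    assume "fin \<omega>"
    then obtain us where "\<forall>u\<in>set us. u \<in> alive T t \<omega>"
      "\<forall>v. v \<in> alive T t \<omega> \<longrightarrow> (\<exists>u\<in>set us. ?p v \<omega> = ?p u \<omega>)" by (auto simp: fin_def)
    then have "?I \<subseteq> (\<lambda>u. position T B u t \<omega>) ` set us" by force
    then show "finite ?I" by (rule finite_subset) simp
  next
    assume "finite ?I"
    from finite_subset_image[OF this subset_refl]
    obtain A where A: "finite A" "A \<subseteq> alive T t \<omega>" "?I = (\<lambda>u. position T B u t \<omega>) ` A"
      by (elim exE conjE) (rule that)
    obtain us where us: "set us = A" using finite_list[OF A(1)] by blast
    have "\<exists>u\<in>set us. ?p v \<omega> = ?p u \<omega>" if "v \<in> alive T t \<omega>" for v
    proof -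
      have "position T B v t \<omega> \<in> ?I" using that by (rule imageI)
      then obtain u where u: "u \<in> A" "position T B v t \<omega> = position T B u t \<omega>"
        unfolding A(3) by (rule imageE)
      moreover have "u \<in> alive T t \<omega>" using u(1) A(2) by (rule subsetD[rotated])
      ultimately show ?thesis using that us by (intro bexI[of _ u]) simp_all
    qed
    then show "fin \<omega>" unfolding fin_def using A us by blast
  qed
  have [measurable]: "Measurable.pred M fin"
    unfolding fin_def by measurable
  \<comment> \<open>The default value of \<open>Max\<close> is the same for infinite sets and for
    the empty set.\<close>
  have Max_infinite: "Max A = Max {}" if "infinite A" for A :: "real set"
    using that by (simp add: Max.infinite Max.eq_fold')
  have "max_displacement T B t \<omega> \<le> z \<longleftrightarrow>
      (if (\<exists>u. u \<in> alive T t \<omega>) \<and> fin \<omega> then \<forall>u. u \<in> alive T t \<omega> \<longrightarrow> ?p u \<omega> \<le> z else Max {} \<le> z)" for \<omega>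
  proof (cases "(\<exists>u. u \<in> alive T t \<omega>) \<and> fin \<omega>")
    case True
    then have "finite ((\<lambda>u. position T B u t \<omega>) ` alive T t \<omega>)" "(\<lambda>u. position T B u t \<omega>) ` alive T t \<omega> \<noteq> {}"
      using fin_iff by auto
    then show ?thesis using True by (auto simp: max_displacement_def)
  next
    case False
    then consider "alive T t \<omega> = {}" | "infinite ((\<lambda>u. position T B u t \<omega>) ` alive T t \<omega>)"
      using fin_iff by blast
    then have "max_displacement T B t \<omega> = Max {}"
      unfolding max_displacement_def by cases (simp, rule Max_infinite)
    then show ?thesis by (simp only: if_not_P[OF False])
  qed
  then have "{\<omega> \<in> space M. max_displacement T B t \<omega> \<le> z} = {\<omega> \<in> space M.
      if (\<exists>u. u \<in> alive T t \<omega>) \<and> fin \<omega> then \<forall>u. u \<in> alive T t \<omega> \<longrightarrow> ?p u \<omega> \<le> z else Max {} \<le> z}"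
    by simp
  also have "\<dots> \<in> events" by measurable
  finally show ?thesis .
qed

lemma prob_max_displacement:
  assumes t: "0 \<le> t"
  shows "prob {\<omega> \<in> space M. max_displacement T B t \<omega> \<le> z}
    = survival (\<lambda>y. if \<bar>y\<bar> \<le> z then 1 else 0) t 0"
proof -
  have "AE \<omega> in M. \<omega> \<in> {\<omega> \<in> space M. max_displacement T B t \<omega> \<le> z} \<longleftrightarrow> \<omega> \<in> below t z"
    using AE_generation_unborn[of t] AE_space
  proof eventually_elim
    case (elim \<omega>)
    then obtain n where n: "\<And>w. length w = n \<Longrightarrow> t < birth_time T w \<omega>" by auto
    from alive_finite_nonempty[OF _ t this] elim show ?case
      by (auto simp: max_displacement_def below_def)
  qed
  then have "prob {\<omega> \<in> space M. max_displacement T B t \<omega> \<le> z} = prob (below t z)"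
    using max_displacement_event[OF t] prob_below(1)[OF t] by (rule finite_measure_eq_AE)
  then show ?thesis using prob_below(2)[OF t] by simp
qed

section \<open>Sandwich by the ramp and bounds for quantiles\<close>

lemma prob_max_displacement_le:
  assumes "0 \<le> t"
  shows "prob {\<omega> \<in> space M. max_displacement T B t \<omega> \<le> z} \<le> survival ramp t z"
proof -
  have "survival (\<lambda>y. if \<bar>y\<bar> \<le> z then 1 else 0) t 0 \<le> survival (\<lambda>y. ramp (z - y)) t 0"
    by (rule survival_mono[OF initial_value_indicator initial_value_reflect[OF ramp.initial_value_axioms]])
      (auto simp: ramp_def)
  then show ?thesis
    using survival_reflect[OF ramp.initial_value_axioms, of z t 0] prob_max_displacement[OF assms] by simp
qed

text \<open>\<open>ramp (z - 1 - y)\<close> vanishes for y \<ge> z, so leaving the interval from - z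
  to z costs at most two mirror images of the one-sided front. The shift by 1 is the width of the
  ramp.\<close>

lemma prob_max_displacement_ge:
  assumes "0 \<le> t"
  shows "1 - 2 * (1 - survival ramp t (z - 1)) \<le> prob {\<omega> \<in> space M. max_displacement T B t \<omega> \<le> z}"
proof -
  let ?g = "\<lambda>y. if \<bar>y\<bar> \<le> z then 1 else 0 :: real" and ?h = "\<lambda>y. ramp (z - 1 - y)"
  interpret g: initial_value ?g by (rule initial_value_indicator)
  interpret h: initial_value ?h by (rule initial_value_reflect[OF ramp.initial_value_axioms])
  let ?k = "\<lambda>y. ?h (0 - y)"
  interpret k: initial_value ?k by (rule initial_value_reflect[OF h.initial_value_axioms])
  have "1 - surv ?g n t 0 \<le> (1 - surv ?h n t 0) + (1 - surv ?k n t 0)" for n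
    by (rule surv_subadditive[OF g.initial_value_axioms h.initial_value_axioms k.initial_value_axioms])
      (auto simp: ramp_def)
  then have "1 - survival ?g t 0 \<le> (1 - survival ?h t 0) + (1 - survival ?k t 0)"
    by (intro LIMSEQ_le[OF tendsto_diff[OF tendsto_const g.surv_tendsto]
          tendsto_add[OF tendsto_diff[OF tendsto_const h.surv_tendsto] tendsto_diff[OF tendsto_const k.surv_tendsto]]]) auto
  moreover have "survival ?h t 0 = survival ramp t (z - 1)"
    using survival_reflect[OF ramp.initial_value_axioms, of "z - 1" t 0] by simp
  moreover have "survival ?k t 0 = survival ?h t 0"
    using survival_reflect[OF h.initial_value_axioms, of 0 t 0] by simp
  ultimately show ?thesis using prob_max_displacement[OF assms, of z] by simp
qed

lemma quantile_bounds:
  assumes t: "0 \<le> t" and a: "0 \<le> a" "survival ramp t a \<le> \<delta>"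
    and b: "2 * (1 - survival ramp t (b - 1)) < 1 - \<delta>"
  shows "a \<le> quantile M T B \<delta> t" "quantile M T B \<delta> t \<le> b"
proof -
  let ?F = "\<lambda>x. prob {\<omega> \<in> space M. max_displacement T B t \<omega> \<le> x}"
  let ?S = "{x. 0 \<le> x \<and> ?F x \<le> \<delta>}"
  have upper: "x \<le> b" if "x \<in> ?S" for x
  proof (rule ccontr)
    assume "\<not> x \<le> b"
    then have "?F b \<le> ?F x"
      using max_displacement_event[OF t] by (intro finite_measure_mono) auto
    then show False using that prob_max_displacement_ge[OF t, of b] b by simp
  qed
  have "a \<in> ?S" using a prob_max_displacement_le[OF t, of a] by auto
  moreover have "bdd_above ?S" using upper by (rule bdd_aboveI)
  ultimately show "a \<le> quantile M T B \<delta> t" unfolding quantile_def by (rule cSup_upper)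
  show "quantile M T B \<delta> t \<le> b"
    unfolding quantile_def using \<open>a \<in> ?S\<close> upper by (intro cSup_least) auto
qed

end

theorem theorem1p2:
  fixes M :: "'w measure"
    and T :: "particle \<Rightarrow> 'w \<Rightarrow> real"
    and B :: "particle \<Rightarrow> real \<Rightarrow> 'w \<Rightarrow> real"
    and \<delta> :: real
  assumes "branching_reflected_brownian_motion M T B"
    and "0 < \<delta>" and "\<delta> < 1"
  shows "(\<lambda>t. quantile M T B \<delta> t - (sqrt 2 * t - 3 / (2 * sqrt 2) * ln t)) \<in> O[at_top](\<lambda>_. 1)"
proof -
  interpret branching_reflected_brownian_motion M T B by fact
  let ?m = "\<lambda>t. sqrt 2 * t - 3 / (2 * sqrt 2) * ln t"
  \<comment> \<open>A third, because the front is doubled by reflection and must stay strictly below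
    1 - \<delta>.\<close>
  obtain Y where Y: "\<forall>\<^sub>F t in at_top. 1 - survival ramp t (?m t + Y) \<le> (1 - \<delta>) / 3"
    using front_upper_bound[of "(1 - \<delta>) / 3"] assms by auto
  obtain Z where Z: "\<forall>\<^sub>F t in at_top. 1 - \<delta> \<le> 1 - survival ramp t (?m t - Z)"
    using front_lower_bound[of \<delta>] assms by auto
  \<comment> \<open>The supremum defining the quantile runs over x \<ge> 0, so the lower candidate
    has to be nonnegative.\<close>
  have "filterlim (\<lambda>t. ?m t - Z) at_top at_top" by real_asymp
  then have "\<forall>\<^sub>F t in at_top. 0 \<le> ?m t - Z" unfolding filterlim_at_top by blast
  with Y Z eventually_ge_at_top[of "0 :: real"]
  have "\<forall>\<^sub>F t in at_top. norm (quantile M T B \<delta> t - ?m t) \<le> max \<bar>Y + 1\<bar> \<bar>Z\<bar> * norm (1 :: real)"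
  proof eventually_elim
    case (elim t)
    have "?m t - Z \<le> quantile M T B \<delta> t" "quantile M T B \<delta> t \<le> ?m t + Y + 1"
      using elim assms(2,3) quantile_bounds[of t "?m t - Z" \<delta> "?m t + Y + 1"] by auto
    then show ?case by auto
  qed
  then show ?thesis by (rule bigoI)
qed

end
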